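(* Let $\mathbb{F}_q$ be a finite field of odd order, and let $f, g\in \mathbb{F}_q[x_1,\dots,x_n]$ be two cubic forms. There exists a deterministic algorithm that decides whether $f$ and $g$ are isomorphic in time $q^{O(n)}$, correctly for all but at most a $\frac{1}{q^{\Omega(n)}}$ fraction of $f$.
   Context: A cubic form is a homogeneous polynomial of degree 3, given as the list of its coefficients. For $A=(a_{i,j})\in\mathrm{GL}(n,\mathbb{F}_q)$, $f\circ A := f(\sum_{j} a_{1,j}x_j, \dots, \sum_{j} a_{n,j}x_j)$; $f$ and $g$ are isomorphic if $f=g\circ A$ for some $A\in\mathrm{GL}(n,\mathbb{F}_q)$. The fraction refers to $f$ drawn uniformly at random, i.e. with the coefficients of all degree-3 monomials independent and uniform in $\mathbb{F}_q$; $g$ is arbitrary. *)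

theory Defs
  imports
    Complex_Main
    "HOL-Library.Landau_Symbols"
    "HOL-Algebra.Indexed_Polynomials"
begin

section \<open>Polynomials in several variables over a ring\<close>

text \<open>
  \<^theory>\<open>HOL-Algebra.Indexed_Polynomials\<close> represents a polynomial by its coefficient function on
  monomials, a monomial being the multiset of its variables, and supplies the set of polynomials,
  the constants, the variables and the sum.  The product is added here.
\<close>

definition mpoly_mult ::
    "('a, 'b) ring_scheme \<Rightarrow> ('c multiset \<Rightarrow> 'a) \<Rightarrow> ('c multiset \<Rightarrow> 'a) \<Rightarrow> 'c multiset \<Rightarrow> 'a" where
  "mpoly_mult R P Q = (\<lambda>m. \<Oplus>\<^bsub>R\<^esub>a\<in>{a. a \<subseteq># m}. P a \<otimes>\<^bsub>R\<^esub> Q (m - a))"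

text \<open>The variables \<open>x\<^sub>1, \<dots>, x\<^sub>n\<close> are indexed by \<open>0, \<dots>, n - 1\<close>.\<close>

definition mpoly_ring :: "('a, 'b) ring_scheme \<Rightarrow> nat \<Rightarrow> (nat multiset \<Rightarrow> 'a) ring" where
  "mpoly_ring R n =
    \<lparr>carrier = ring.indexed_pset R {..<n} (carrier R),
     monoid.mult = mpoly_mult R,
     one = ring.indexed_const R \<one>\<^bsub>R\<^esub>,
     zero = ring.indexed_const R \<zero>\<^bsub>R\<^esub>,
     add = ring.indexed_padd R\<rparr>"

definition cubic_forms :: "('a, 'b) ring_scheme \<Rightarrow> nat \<Rightarrow> (nat multiset \<Rightarrow> 'a) set" where
  "cubic_forms R n =
    {f \<in> carrier (mpoly_ring R n). \<forall>m. f m \<noteq> \<zero>\<^bsub>R\<^esub> \<longrightarrow> size m = 3}"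

definition general_linear :: "('a, 'b) ring_scheme \<Rightarrow> nat \<Rightarrow> (nat \<Rightarrow> nat \<Rightarrow> 'a) set" where
  "general_linear R n =
    {A. (\<forall>i<n. \<forall>j<n. A i j \<in> carrier R) \<and>
        (\<exists>B. (\<forall>i<n. \<forall>j<n. B i j \<in> carrier R) \<and>
             (\<forall>i<n. \<forall>j<n. (\<Oplus>\<^bsub>R\<^esub>k\<in>{..<n}. A i k \<otimes>\<^bsub>R\<^esub> B k j) = (if i = j then \<one>\<^bsub>R\<^esub> else \<zero>\<^bsub>R\<^esub>)) \<and>
             (\<forall>i<n. \<forall>j<n. (\<Oplus>\<^bsub>R\<^esub>k\<in>{..<n}. B i k \<otimes>\<^bsub>R\<^esub> A k j) = (if i = j then \<one>\<^bsub>R\<^esub> else \<zero>\<^bsub>R\<^esub>)))}"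

definition linear_form ::
    "('a, 'b) ring_scheme \<Rightarrow> nat \<Rightarrow> (nat \<Rightarrow> 'a) \<Rightarrow> nat multiset \<Rightarrow> 'a" where
  "linear_form R n a =
    (\<Oplus>\<^bsub>mpoly_ring R n\<^esub>j\<in>{..<n}.
       ring.indexed_const R (a j) \<otimes>\<^bsub>mpoly_ring R n\<^esub> ring.indexed_var R j)"

definition subst_matrix ::
    "('a, 'b) ring_scheme \<Rightarrow> nat \<Rightarrow> (nat multiset \<Rightarrow> 'a) \<Rightarrow> (nat \<Rightarrow> nat \<Rightarrow> 'a) \<Rightarrow> nat multiset \<Rightarrow> 'a" where
  "subst_matrix R n f A =
    (\<Oplus>\<^bsub>mpoly_ring R n\<^esub>m\<in>{m. f m \<noteq> \<zero>\<^bsub>R\<^esub>}.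
       ring.indexed_const R (f m) \<otimes>\<^bsub>mpoly_ring R n\<^esub>
       (\<Otimes>\<^bsub>mpoly_ring R n\<^esub>i\<in>{..<n}. linear_form R n (A i) [^]\<^bsub>mpoly_ring R n\<^esub> count m i))"

definition isomorphic_forms ::
    "('a, 'b) ring_scheme \<Rightarrow> nat \<Rightarrow> (nat multiset \<Rightarrow> 'a) \<Rightarrow> (nat multiset \<Rightarrow> 'a) \<Rightarrow> bool" where
  "isomorphic_forms R n f g \<longleftrightarrow> (\<exists>A\<in>general_linear R n. f = subst_matrix R n g A)"

lemma finite_submultisets [simp]: "finite {a. a \<subseteq># m}"
proof (induction m)
  case (add x m)
  have "{a. a \<subseteq># add_mset x m} \<subseteq> {a. a \<subseteq># m} \<union> add_mset x ` {a. a \<subseteq># m}"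
  proof
    fix a assume "a \<in> {a. a \<subseteq># add_mset x m}"
    then have a: "a \<subseteq># add_mset x m" by simp
    show "a \<in> {a. a \<subseteq># m} \<union> add_mset x ` {a. a \<subseteq># m}"
    proof (cases "x \<in># a")
      case True
      then obtain a' where "a = add_mset x a'" by (metis insert_DiffM)
      with a show ?thesis by simp
    next
      case False
      have "count a y \<le> count m y" for y
        using mset_subset_eq_count[OF a, of y] False by (cases "y = x") (auto simp: not_in_iff)
      then show ?thesis by (simp add: subseteq_mset_def)
    qed
  qed
  then show ?case using add by (auto dest: finite_subset)
qed simp

lemma diff_diff_submultiset: "a \<subseteq># m \<Longrightarrow> m - (m - a) = (a :: 'a multiset)"
  by (simp add: multiset_eq_iff subseteq_mset_def)

context cring
begin

lemma mpoly_mult_const: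
  fixes P :: "'c multiset \<Rightarrow> 'a"
  assumes "carrier_coeff P" "k \<in> carrier R"
  shows "mpoly_mult R P (indexed_const k) = (\<lambda>m. P m \<otimes> k)"
proof
  fix m :: "'c multiset"
  have "mpoly_mult R P (indexed_const k) m = (\<Oplus>a\<in>{a. a \<subseteq># m}. if m = a then P a \<otimes> k else \<zero>)"
    unfolding mpoly_mult_def
  proof (rule finsum_cong')
    fix a assume "a \<in> {a. a \<subseteq># m}"
    then show "P a \<otimes> indexed_const k (m - a) = (if m = a then P a \<otimes> k else \<zero>)"
      using assms by (auto simp: indexed_const_def carrier_coeff_def Diff_eq_empty_iff_mset
          dest: subset_mset.antisym)
  qed (use assms in \<open>auto simp: carrier_coeff_def\<close>)
  also have "\<dots> = P m \<otimes> k"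
    using assms by (subst add.finprod_singleton) (auto simp: carrier_coeff_def)
  finally show "mpoly_mult R P (indexed_const k) m = P m \<otimes> k" .
qed

lemma mpoly_mult_carrier_coeff:
  assumes "carrier_coeff P" "carrier_coeff Q"
  shows "carrier_coeff (mpoly_mult R P Q)"
  using assms unfolding carrier_coeff_def mpoly_mult_def by (auto intro!: finsum_closed)

lemma mpoly_mult_add:
  fixes P :: "'c multiset \<Rightarrow> 'a"
  assumes "carrier_coeff P" "carrier_coeff Q" "carrier_coeff S"
  shows "mpoly_mult R P (indexed_padd Q S) = indexed_padd (mpoly_mult R P Q) (mpoly_mult R P S)"
proof
  fix m :: "'c multiset"
  have "mpoly_mult R P (indexed_padd Q S) m
      = (\<Oplus>a\<in>{a. a \<subseteq># m}. P a \<otimes> Q (m - a) \<oplus> P a \<otimes> S (m - a))"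
    unfolding mpoly_mult_def indexed_padd_def
    using assms by (intro finsum_cong') (auto simp: carrier_coeff_def r_distr)
  also have "\<dots> = indexed_padd (mpoly_mult R P Q) (mpoly_mult R P S) m"
    unfolding mpoly_mult_def indexed_padd_def
    using assms by (intro finsum_addf) (auto simp: carrier_coeff_def)
  finally show "mpoly_mult R P (indexed_padd Q S) m
      = indexed_padd (mpoly_mult R P Q) (mpoly_mult R P S) m" .
qed

lemma mpoly_mult_comm:
  fixes P :: "'c multiset \<Rightarrow> 'a"
  assumes "carrier_coeff P" "carrier_coeff Q"
  shows "mpoly_mult R P Q = mpoly_mult R Q P"
proof
  fix m :: "'c multiset"
  have inj: "inj_on (\<lambda>a. m - a) {a. a \<subseteq># m}"
    by (rule inj_onI) (metis mem_Collect_eq diff_diff_submultiset)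
  have img: "(\<lambda>a. m - a) ` {a. a \<subseteq># m} = {a. a \<subseteq># m}"
  proof (intro equalityI subsetI)
    fix a assume "a \<in> {a. a \<subseteq># m}"
    then have "a = m - (m - a)" "m - a \<subseteq># m"
      by (simp_all add: diff_diff_submultiset)
    then show "a \<in> (\<lambda>a. m - a) ` {a. a \<subseteq># m}" by blast
  qed auto
  have "mpoly_mult R Q P m = (\<Oplus>a\<in>(\<lambda>a. m - a) ` {a. a \<subseteq># m}. Q a \<otimes> P (m - a))"
    unfolding img mpoly_mult_def ..
  also have "\<dots> = (\<Oplus>a\<in>{a. a \<subseteq># m}. Q (m - a) \<otimes> P (m - (m - a)))"
    using assms inj by (subst finsum_reindex) (auto simp: carrier_coeff_def)
  also have "\<dots> = mpoly_mult R P Q m"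
    unfolding mpoly_mult_def
    using assms by (intro finsum_cong') (auto simp: carrier_coeff_def m_comm diff_diff_submultiset)
  finally show "mpoly_mult R P Q m = mpoly_mult R Q P m" ..
qed

lemma mpoly_mult_pmult:
  fixes P :: "'c multiset \<Rightarrow> 'a"
  assumes "carrier_coeff P" "carrier_coeff Q"
  shows "mpoly_mult R P (indexed_pmult Q i) = indexed_pmult (mpoly_mult R P Q) i"
proof
  fix m :: "'c multiset"
  show "mpoly_mult R P (indexed_pmult Q i) m = indexed_pmult (mpoly_mult R P Q) i m"
  proof (cases "i \<in># m")
    case False
    then have "mpoly_mult R P (indexed_pmult Q i) m = (\<Oplus>a\<in>{a. a \<subseteq># m}. \<zero>)"
      unfolding mpoly_mult_def using assms
      by (intro finsum_cong') (auto simp: indexed_pmult_def carrier_coeff_def dest: in_diffD)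
    with False show ?thesis by (simp add: indexed_pmult_def)
  next
    case True
    then obtain m' where m: "m = add_mset i m'" by (metis insert_DiffM)
    have iff: "a \<subseteq># m' \<longleftrightarrow> a \<subseteq># m \<and> i \<in># m - a" for a
    proof
      assume "a \<subseteq># m'"
      then show "a \<subseteq># m \<and> i \<in># m - a"
        by (auto simp: m in_diff_count subset_mset.le_iff_add)
    next
      assume a: "a \<subseteq># m \<and> i \<in># m - a"
      then obtain b where b: "m - a = add_mset i b" by (metis insert_DiffM)
      have "m = a + (m - a)" using a by simp
      then have "add_mset i m' = add_mset i (a + b)" unfolding b by (simp add: m)
      then have "m' = a + b" by simp
      then show "a \<subseteq># m'" by simp
    qed
    have "mpoly_mult R P (indexed_pmult Q i) m = (\<Oplus>a\<in>{a. a \<subseteq># m'}. P a \<otimes> Q (m' - a))"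
      unfolding mpoly_mult_def
    proof (rule add.finprod_mono_neutral_cong_right)
      show "{a. a \<subseteq># m'} \<subseteq> {a. a \<subseteq># m}"
        using iff by blast
      show "P a \<otimes> indexed_pmult Q i (m - a) = \<zero>" if "a \<in> {a. a \<subseteq># m} - {a. a \<subseteq># m'}" for a
        using that assms iff[of a] by (auto simp: indexed_pmult_def carrier_coeff_def)
      show "P a \<otimes> indexed_pmult Q i (m - a) = P a \<otimes> Q (m' - a)" if "a \<in> {a. a \<subseteq># m'}" for a
        using that iff[of a] by (auto simp: indexed_pmult_def m)
    qed (use assms in \<open>auto simp: carrier_coeff_def indexed_pmult_def\<close>)
    with True show ?thesis by (simp add: indexed_pmult_def mpoly_mult_def m)
  qed
qed

lemma mpoly_carrier_coeff: "P \<in> carrier (mpoly_ring R n) \<Longrightarrow> carrier_coeff P"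
  unfolding mpoly_ring_def using indexed_pset_in_carrier[OF subset_refl] by simp

lemma mpoly_mult_closed:
  assumes P: "P \<in> carrier (mpoly_ring R n)" and "Q \<in> carrier (mpoly_ring R n)"
  shows "mpoly_mult R P Q \<in> carrier (mpoly_ring R n)"
proof -
  have scale: "(\<lambda>m. P m \<otimes> k) \<in> indexed_pset {..<n} (carrier R)"
    if "k \<in> carrier R" "P \<in> indexed_pset {..<n} (carrier R)" for k P
    using that(2)
  proof induction
    case (indexed_const c)
    have "(\<lambda>m :: nat multiset. indexed_const c m \<otimes> k) = indexed_const (c \<otimes> k)"
      using that(1) indexed_const by (auto simp: indexed_const_def)
    then show ?case using that(1) indexed_const by (auto intro: indexed_pset.indexed_const)
  next
    case (indexed_padd P Q)
    have "(\<lambda>m. indexed_padd P Q m \<otimes> k) = indexed_padd (\<lambda>m. P m \<otimes> k) (\<lambda>m. Q m \<otimes> k)"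
      using indexed_pset_in_carrier[OF subset_refl indexed_padd.hyps(1)] that(1)
        indexed_pset_in_carrier[OF subset_refl indexed_padd.hyps(2)]
      by (auto simp: indexed_padd_def carrier_coeff_def l_distr)
    then show ?case using indexed_padd.IH by (auto intro: indexed_pset.indexed_padd)
  next
    case (indexed_pmult P i)
    have "(\<lambda>m. indexed_pmult P i m \<otimes> k) = indexed_pmult (\<lambda>m. P m \<otimes> k) i"
      using that(1) by (auto simp: indexed_pmult_def)
    then show ?case using indexed_pmult.IH indexed_pmult.hyps by (auto intro: indexed_pset.indexed_pmult)
  qed
  have "Q \<in> indexed_pset {..<n} (carrier R)" using assms(2) by (simp add: mpoly_ring_def)
  then have "mpoly_mult R P Q \<in> indexed_pset {..<n} (carrier R)"
  proof induction
    case (indexed_const k)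
    then show ?case
      using scale P by (simp add: mpoly_mult_const[OF mpoly_carrier_coeff[OF P]] mpoly_ring_def)
  next
    case (indexed_padd Q S)
    note QS = indexed_padd.hyps[THEN indexed_pset_in_carrier[OF subset_refl]]
    show ?case
      using QS indexed_padd.IH
      by (simp add: mpoly_mult_add[OF mpoly_carrier_coeff[OF P]] indexed_pset.indexed_padd)
  next
    case (indexed_pmult Q i)
    note Q = indexed_pset_in_carrier[OF subset_refl indexed_pmult.hyps(1)]
    show ?case
      using Q indexed_pmult.IH indexed_pmult.hyps(2)
      by (simp add: mpoly_mult_pmult[OF mpoly_carrier_coeff[OF P]] indexed_pset.indexed_pmult)
  qed
  then show ?thesis by (simp add: mpoly_ring_def)
qed

lemma mpoly_mult_assoc:
  assumes P: "P \<in> carrier (mpoly_ring R n)" and Q: "Q \<in> carrier (mpoly_ring R n)"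
    and "S \<in> carrier (mpoly_ring R n)"
  shows "mpoly_mult R (mpoly_mult R P Q) S = mpoly_mult R P (mpoly_mult R Q S)"
proof -
  note PQ = mpoly_carrier_coeff[OF P] mpoly_carrier_coeff[OF Q]
  note PQ' = mpoly_mult_carrier_coeff[OF PQ]
  have "S \<in> indexed_pset {..<n} (carrier R)" using assms(3) by (simp add: mpoly_ring_def)
  then show ?thesis
  proof induction
    case (indexed_const k)
    have "mpoly_mult R P Q m \<otimes> k = mpoly_mult R P (\<lambda>m. Q m \<otimes> k) m" for m
    proof -
      have "mpoly_mult R P Q m \<otimes> k = (\<Oplus>a\<in>{a. a \<subseteq># m}. P a \<otimes> Q (m - a) \<otimes> k)"
        unfolding mpoly_mult_def
        using PQ indexed_const by (intro finsum_ldistr) (auto simp: carrier_coeff_def)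
      also have "\<dots> = mpoly_mult R P (\<lambda>m. Q m \<otimes> k) m"
        unfolding mpoly_mult_def
        using PQ indexed_const by (intro finsum_cong') (auto simp: carrier_coeff_def m_assoc)
      finally show ?thesis .
    qed
    then show ?case
      using PQ PQ' indexed_const by (simp add: mpoly_mult_const)
  next
    case (indexed_padd S T)
    note ST = indexed_padd.hyps[THEN indexed_pset_in_carrier[OF subset_refl]]
    show ?case
      using PQ PQ' ST indexed_padd.IH
      by (simp add: mpoly_mult_add mpoly_mult_carrier_coeff)
  next
    case (indexed_pmult S i)
    note S = indexed_pset_in_carrier[OF subset_refl indexed_pmult.hyps(1)]
    show ?case
      using PQ PQ' S indexed_pmult.IH
      by (simp add: mpoly_mult_pmult mpoly_mult_carrier_coeff)
  qed
qed

lemma cring_mpoly_ring: "cring (mpoly_ring R n)"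
proof (rule cringI)
  note cc = mpoly_carrier_coeff
  have one: "indexed_const \<one> \<in> carrier (mpoly_ring R n)"
    by (simp add: mpoly_ring_def indexed_pset.indexed_const)
  have mone: "indexed_const (\<ominus> \<one>) \<in> carrier (mpoly_ring R n)"
    by (simp add: mpoly_ring_def indexed_pset.indexed_const)
  show "abelian_group (mpoly_ring R n)"
  proof (rule abelian_groupI)
    fix P assume P: "P \<in> carrier (mpoly_ring R n)"
    have "mpoly_mult R P (indexed_const (\<ominus> \<one>)) \<oplus>\<^bsub>mpoly_ring R n\<^esub> P = \<zero>\<^bsub>mpoly_ring R n\<^esub>"
      using cc[OF P] by (simp add: mpoly_mult_const)
        (auto simp: mpoly_ring_def indexed_padd_def indexed_const_def carrier_coeff_def
          r_minus l_neg)
    then show "\<exists>Q\<in>carrier (mpoly_ring R n). Q \<oplus>\<^bsub>mpoly_ring R n\<^esub> P = \<zero>\<^bsub>mpoly_ring R n\<^esub>"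
      using mpoly_mult_closed[OF P mone] by blast
  next
    fix P assume P: "P \<in> carrier (mpoly_ring R n)"
    show "\<zero>\<^bsub>mpoly_ring R n\<^esub> \<oplus>\<^bsub>mpoly_ring R n\<^esub> P = P"
      using indexed_padd_zero(2)[OF cc[OF P]] by (simp add: mpoly_ring_def)
  next
    fix P Q S
    assume "P \<in> carrier (mpoly_ring R n)" "Q \<in> carrier (mpoly_ring R n)"
      "S \<in> carrier (mpoly_ring R n)"
    from this[THEN cc] show "P \<oplus>\<^bsub>mpoly_ring R n\<^esub> Q \<oplus>\<^bsub>mpoly_ring R n\<^esub> S
        = P \<oplus>\<^bsub>mpoly_ring R n\<^esub> (Q \<oplus>\<^bsub>mpoly_ring R n\<^esub> S)"
      by (simp add: mpoly_ring_def indexed_padd_def carrier_coeff_def a_assoc)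
  next
    fix P Q
    assume "P \<in> carrier (mpoly_ring R n)" "Q \<in> carrier (mpoly_ring R n)"
    from this[THEN cc] show "P \<oplus>\<^bsub>mpoly_ring R n\<^esub> Q = Q \<oplus>\<^bsub>mpoly_ring R n\<^esub> P"
      by (simp add: mpoly_ring_def indexed_padd_def carrier_coeff_def a_comm)
  qed (auto simp: mpoly_ring_def indexed_pset.indexed_const indexed_pset.indexed_padd)
  show "Group.comm_monoid (mpoly_ring R n)"
  proof (rule comm_monoidI)
    fix P Q assume PQ: "P \<in> carrier (mpoly_ring R n)" "Q \<in> carrier (mpoly_ring R n)"
    show "P \<otimes>\<^bsub>mpoly_ring R n\<^esub> Q \<in> carrier (mpoly_ring R n)"
      using mpoly_mult_closed[OF PQ] by (simp add: mpoly_ring_def)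
    show "P \<otimes>\<^bsub>mpoly_ring R n\<^esub> Q = Q \<otimes>\<^bsub>mpoly_ring R n\<^esub> P"
      using mpoly_mult_comm[OF PQ[THEN cc]] by (simp add: mpoly_ring_def)
  next
    fix P Q S
    assume "P \<in> carrier (mpoly_ring R n)" "Q \<in> carrier (mpoly_ring R n)"
      "S \<in> carrier (mpoly_ring R n)"
    from mpoly_mult_assoc[OF this] show "P \<otimes>\<^bsub>mpoly_ring R n\<^esub> Q \<otimes>\<^bsub>mpoly_ring R n\<^esub> S
        = P \<otimes>\<^bsub>mpoly_ring R n\<^esub> (Q \<otimes>\<^bsub>mpoly_ring R n\<^esub> S)"
      by (simp add: mpoly_ring_def)
  next
    fix P assume P: "P \<in> carrier (mpoly_ring R n)"
    have "mpoly_mult R P (indexed_const \<one>) = P"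
      using cc[OF P] by (simp add: mpoly_mult_const carrier_coeff_def)
    then show "\<one>\<^bsub>mpoly_ring R n\<^esub> \<otimes>\<^bsub>mpoly_ring R n\<^esub> P = P"
      using mpoly_mult_comm[OF cc[OF P] cc[OF one]] by (simp add: mpoly_ring_def)
  qed (use one in \<open>simp add: mpoly_ring_def\<close>)
  fix P Q S
  assume "P \<in> carrier (mpoly_ring R n)" "Q \<in> carrier (mpoly_ring R n)"
    "S \<in> carrier (mpoly_ring R n)"
  note PQS = this[THEN cc]
  have "mpoly_mult R (indexed_padd P Q) S = indexed_padd (mpoly_mult R P S) (mpoly_mult R Q S)"
    using PQS by (simp add: mpoly_mult_comm[of _ S] mpoly_mult_add indexed_padd_in_carrier)
  then show "(P \<oplus>\<^bsub>mpoly_ring R n\<^esub> Q) \<otimes>\<^bsub>mpoly_ring R n\<^esub> S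
      = P \<otimes>\<^bsub>mpoly_ring R n\<^esub> S \<oplus>\<^bsub>mpoly_ring R n\<^esub> Q \<otimes>\<^bsub>mpoly_ring R n\<^esub> S"
    by (simp add: mpoly_ring_def)
qed

end

section \<open>Deterministic algorithms and their running time\<close>

text \<open>
  Algorithms are programs of the first-order, call-by-value, pure Lisp fragment whose only data are
  binary trees (Jones, Computability and Complexity from a Programming Perspective).  Values are
  shared pointers and every construct does a bounded amount of work on them, so counting evaluated
  subexpressions is, up to a polynomial, running time on a Turing machine or on a random access
  machine with logarithmic cost.  Bounds of the form \<open>q\<close> to the power \<open>O(n)\<close> are insensitive to
  such a polynomial, and likewise to the choice of input encoding below, as long as its length is
  polynomial in \<open>q\<close> and \<open>n\<close>.
\<close>

datatype val = NIL | CONS val val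

datatype expr =
    Var nat
  | Empty
  | Pair expr expr
  | Hd expr
  | Tl expr
  | Cond expr expr expr
  | Call nat "expr list"

text \<open>A program is a list of function bodies; \<open>Var i\<close> is the \<open>i\<close>-th argument of the function
  in which it occurs, and execution starts with function \<open>0\<close>.\<close>

type_synonym program = "expr list"

fun hd_val :: "val \<Rightarrow> val" where
  "hd_val NIL = NIL"
| "hd_val (CONS x y) = x"

fun tl_val :: "val \<Rightarrow> val" where
  "tl_val NIL = NIL"
| "tl_val (CONS x y) = y"

text \<open>\<open>evaluates P xs e v k\<close>: with arguments \<open>xs\<close>, the expression \<open>e\<close> evaluates to \<open>v\<close> in \<open>k\<close> steps.\<close>

inductive evaluates :: "program \<Rightarrow> val list \<Rightarrow> expr \<Rightarrow> val \<Rightarrow> nat \<Rightarrow> bool"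
  and evaluates_list :: "program \<Rightarrow> val list \<Rightarrow> expr list \<Rightarrow> val list \<Rightarrow> nat \<Rightarrow> bool"
  for P :: program where
  Var: "i < length xs \<Longrightarrow> evaluates P xs (Var i) (xs ! i) 1"
| Empty: "evaluates P xs Empty NIL 1"
| Pair: "evaluates P xs e1 v1 k1 \<Longrightarrow> evaluates P xs e2 v2 k2 \<Longrightarrow>
    evaluates P xs (Pair e1 e2) (CONS v1 v2) (1 + k1 + k2)"
| Hd: "evaluates P xs e v k \<Longrightarrow> evaluates P xs (Hd e) (hd_val v) (1 + k)"
| Tl: "evaluates P xs e v k \<Longrightarrow> evaluates P xs (Tl e) (tl_val v) (1 + k)"
| Cond_True: "evaluates P xs e v k \<Longrightarrow> v \<noteq> NIL \<Longrightarrow> evaluates P xs e1 v1 k1 \<Longrightarrow>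
    evaluates P xs (Cond e e1 e2) v1 (1 + k + k1)"
| Cond_False: "evaluates P xs e NIL k \<Longrightarrow> evaluates P xs e2 v2 k2 \<Longrightarrow>
    evaluates P xs (Cond e e1 e2) v2 (1 + k + k2)"
| Call: "evaluates_list P xs es vs k \<Longrightarrow> i < length P \<Longrightarrow> evaluates P vs (P ! i) v l \<Longrightarrow>
    evaluates P xs (Call i es) v (1 + k + l)"
| args_Nil: "evaluates_list P xs [] [] 0"
| args_Cons: "evaluates P xs e v k \<Longrightarrow> evaluates_list P xs es vs l \<Longrightarrow>
    evaluates_list P xs (e # es) (v # vs) (k + l)"

definition run :: "program \<Rightarrow> val list \<Rightarrow> val \<Rightarrow> nat \<Rightarrow> bool" where
  "run P xs v k \<longleftrightarrow> P \<noteq> [] \<and> evaluates P xs (P ! 0) v k"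

definition halts_within :: "program \<Rightarrow> val list \<Rightarrow> nat \<Rightarrow> bool" where
  "halts_within P xs T \<longleftrightarrow> (\<exists>v k. run P xs v k \<and> k \<le> T)"

definition accepts :: "program \<Rightarrow> val list \<Rightarrow> bool" where
  "accepts P xs \<longleftrightarrow> (\<exists>v k. run P xs v k \<and> v \<noteq> NIL)"

inductive_cases evaluates_VarE: "evaluates P xs (Var i) v k"
inductive_cases evaluates_EmptyE: "evaluates P xs Empty v k"
inductive_cases evaluates_PairE: "evaluates P xs (Pair e1 e2) v k"
inductive_cases evaluates_HdE: "evaluates P xs (Hd e) v k"
inductive_cases evaluates_TlE: "evaluates P xs (Tl e) v k"
inductive_cases evaluates_CondE: "evaluates P xs (Cond e e1 e2) v k"
inductive_cases evaluates_CallE: "evaluates P xs (Call i es) v k"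
inductive_cases evaluates_NilE: "evaluates_list P xs [] vs k"
inductive_cases evaluates_ConsE: "evaluates_list P xs (e # es) vs k"

lemma evaluates_deterministic:
  "evaluates P xs e v k \<Longrightarrow> evaluates P xs e v' k' \<Longrightarrow> v' = v \<and> k' = k"
  "evaluates_list P xs es vs l \<Longrightarrow> evaluates_list P xs es vs' l' \<Longrightarrow> vs' = vs \<and> l' = l"
proof (induction arbitrary: v' k' and vs' l' rule: evaluates_evaluates_list.inducts)
  case Var
  show ?case
    by (rule evaluates_VarE[OF Var.prems]) simp
next
  case Empty
  show ?case
    by (rule evaluates_EmptyE[OF Empty.prems]) simp
next
  case Pair
  show ?case
    by (rule evaluates_PairE[OF Pair.prems]) (auto dest!: Pair.IH(2,4))
next
  case Hd
  show ?case
    by (rule evaluates_HdE[OF Hd.prems]) (auto dest!: Hd.IH(2))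
next
  case Tl
  show ?case
    by (rule evaluates_TlE[OF Tl.prems]) (auto dest!: Tl.IH(2))
next
  case Cond_True
  show ?case
    by (rule evaluates_CondE[OF Cond_True.prems])
      (use Cond_True.hyps in \<open>auto dest!: Cond_True.IH(2,4)\<close>)
next
  case Cond_False
  show ?case
    by (rule evaluates_CondE[OF Cond_False.prems]) (auto dest!: Cond_False.IH(2,4))
next
  case Call
  show ?case
    by (rule evaluates_CallE[OF Call.prems]) (auto dest!: Call.IH(2,5))
next
  case args_Nil
  show ?case
    by (rule evaluates_NilE[OF args_Nil.prems]) simp
next
  case args_Cons
  show ?case
    by (rule evaluates_ConsE[OF args_Cons.prems]) (auto dest!: args_Cons.IH(2,4))
qed

corollary run_deterministic: "run P xs v k \<Longrightarrow> run P xs v' k' \<Longrightarrow> v' = v \<and> k' = k"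
  unfolding run_def using evaluates_deterministic(1) by blast

section \<open>Encoding of the input\<close>

text \<open>Numbers are written in unary.  The field with \<open>q\<close> elements is given by its addition and
  multiplication tables, its elements being named \<open>0, \<dots>, q - 1\<close> in an arbitrary way.\<close>

fun enc_nat :: "nat \<Rightarrow> val" where
  "enc_nat 0 = NIL"
| "enc_nat (Suc k) = CONS NIL (enc_nat k)"

fun enc_list :: "val list \<Rightarrow> val" where
  "enc_list [] = NIL"
| "enc_list (v # vs) = CONS v (enc_list vs)"

definition enc_table :: "nat \<Rightarrow> (nat \<Rightarrow> nat \<Rightarrow> nat) \<Rightarrow> val" where
  "enc_table q h = enc_list (map (\<lambda>a. enc_list (map (\<lambda>b. enc_nat (h a b)) [0..<q])) [0..<q])"

definition enc_cubic_form :: "nat \<Rightarrow> (nat multiset \<Rightarrow> nat) \<Rightarrow> val" where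
  "enc_cubic_form n f =
    enc_list [enc_nat (f {#i, j, k#}). i \<leftarrow> [0..<n], j \<leftarrow> [i..<n], k \<leftarrow> [j..<n]]"

definition enc_input ::
    "nat ring \<Rightarrow> nat \<Rightarrow> nat \<Rightarrow> (nat multiset \<Rightarrow> nat) \<Rightarrow> (nat multiset \<Rightarrow> nat) \<Rightarrow> val list" where
  "enc_input R q n f g =
    [enc_nat n, enc_nat q, enc_table q (add R), enc_table q (monoid.mult R),
     enc_cubic_form n f, enc_cubic_form n g]"

end

theory Submission
  imports Defs
begin

text \<open>
  Let \<open>T\<^sub>f\<close> be the polarisation of \<open>f\<close> and let \<open>r = 40\<close>. If \<open>f = g \<circ> A\<close> and \<open>w\<^sub>i = A e\<^sub>i\<close>, then
  \<open>T\<^sub>f(e\<^sub>i, x, y) = T\<^sub>g(w\<^sub>i, A x, A y)\<close>, so the columns of \<open>A\<close> and of minus its inverse solve the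
  linear system \<open>T\<^sub>g(w\<^sub>i, e\<^sub>j, a\<^sub>k) + T\<^sub>f(e\<^sub>i, b\<^sub>j, e\<^sub>k) = 0\<close> (\<open>i \<le> r\<close>; \<open>j, k \<le> n\<close>) in the unknown
  vectors \<open>a\<^sub>k\<close> and \<open>b\<^sub>j\<close>. The algorithm runs through all \<open>w\<^sub>1, \<dots>, w\<^sub>r\<close>, computes a basis of the
  solution space, and tests the matrix of every combination of the first \<open>169 n\<close> basis vectors on
  all points. Acceptance is therefore always correct. A change of variables shows that the
  solution space has at most as many elements as the space of adjoints of \<open>f\<close>, which belongs to \<open>g
  = f\<close> and \<open>w\<^sub>i = e\<^sub>i\<close>; so the answer is correct whenever \<open>f\<close> has at most \<open>q\<^sup>1\<^sup>6\<^sup>9\<^sup>n\<close> adjoints.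

  To bound the expected number of adjoints \<open>(A, D)\<close> of a random \<open>f\<close>, let \<open>t \<le> (n - r) / 4\<close> be
  maximal such that \<open>A\<close> has an invertible \<open>t \<times> t\<close> submatrix whose row and column indices are
  disjoint and larger than \<open>r\<close>. If the bound on \<open>t\<close> is not attained, maximality determines all
  entries of \<open>A\<close> off the diagonal and outside \<open>2 t + r\<close> rows and columns, so there are \<open>q\<close> to the
  power \<open>5 t n + O(n)\<close> such \<open>A\<close>. On the other hand, varying the coefficients of suitable monomials
  \<open>x\<^sub>i x\<^sub>l x\<^sub>p\<close> with \<open>i \<le> r\<close> shows that \<open>(A, D)\<close> is an adjoint of at most a fraction \<open>q\<close> to the
  power \<open>- 10 t n\<close> of all \<open>f\<close>, and the same holds with the transpose of \<open>D\<close> in place of \<open>A\<close>. Hence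
  the expectation is \<open>q\<close> to the power \<open>O(n)\<close>, and Markov's inequality applies.
\<close>

section \<open>One commutative ring for all finite fields\<close>

text \<open>Written with the symmetric slices \<open>T_i = T(e_i, _, _)\<close>, an adjoint is a
  pair with \<open>T_i A + D T_i = 0\<close> for all \<open>i\<close> up to \<open>r\<close>. To
  show that few forms admit a given pair, a form is varied so that the change shows through
  \<open>A\<close> but not through \<open>D\<close>: every varied monomial has one variable in the
  row set \<open>I\<close> of the minor and none in the column set \<open>J\<close>, and only
  entries \<open>(l, j)\<close> with \<open>j\<close> in \<open>J\<close> are read, where
  \<open>D T_i\<close> stays fixed. This is why the minor has to avoid the diagonal. A pair can thus
  be charged to \<open>A\<close> or to \<open>D\<close>, not to both at once; the exponent
  \<open>10 t n\<close> is twice the \<open>5 t n\<close> of the count so that its half suffices for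
  each of them. Keeping \<open>t\<close> below a quarter leaves enough indices outside
  \<open>I\<close> and \<open>J\<close> for the varied monomials. The number 169 is
  \<open>2 (2 r + 4) + 1\<close>: each matrix contributes \<open>2 r + 3\<close>, and 1 for the
  number of values of \<open>t\<close>; the last 1 is the gain in Markov's inequality. In
  characteristic 3 the polarisation does not see the cubes \<open>x_i^3\<close>; candidates are
  therefore compared by the values of the forms, which determine a cubic form over every finite
  field of odd order.\<close>

text \<open>The product of all commutative rings on subsets of \<^typ>\<open>nat\<close> is an instance of \<^class>\<open>comm_ring_1\<close>,
  which makes the type class tools available for calculations in any given ring \<open>R\<close>: \<open>proj R\<close> is a
  homomorphism onto \<open>R\<close>, and \<open>emb R\<close> identifies \<open>R\<close> with an ideal of the product.\<close>

typedef prod_ring = "{F :: nat ring \<Rightarrow> nat. \<forall>R. F R \<in> (if cring R then carrier R else {0})}"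
proof
  show "(\<lambda>R. if cring R then \<zero>\<^bsub>R\<^esub> else 0) \<in> {F :: nat ring \<Rightarrow> nat. \<forall>R. F R \<in> (if cring R then
      carrier R else {0})}"
    by (auto simp: cring_def ring.ring_simprules(2))
qed

definition proj :: "nat ring \<Rightarrow> prod_ring \<Rightarrow> nat" where
  "proj R u = Rep_prod_ring u R"

definition tuple :: "(nat ring \<Rightarrow> nat) \<Rightarrow> prod_ring" where
  "tuple F = Abs_prod_ring (\<lambda>R. if cring R then F R else 0)"

lemma proj_tuple:
  assumes "\<And>R. cring R \<Longrightarrow> F R \<in> carrier R"
  shows "proj R (tuple F) = (if cring R then F R else 0)"
  unfolding proj_def tuple_def using assms by (subst Abs_prod_ring_inverse) auto

lemma proj_closed [simp]: "cring R \<Longrightarrow> proj R u \<in> carrier R"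
  using Rep_prod_ring[of u] by (auto simp: proj_def split: if_splits)

lemma proj_not_cring: "\<not> cring R \<Longrightarrow> proj R u = 0"
  using Rep_prod_ring[of u] by (auto simp: proj_def split: if_splits dest: spec[of _ R])

lemma prod_ring_eqI: "(\<And>R. cring R \<Longrightarrow> proj R u = proj R v) \<Longrightarrow> u = v"
  by (metis Rep_prod_ring_inject proj_def proj_not_cring ext)

text \<open>A nontrivial ring on natural numbers, as a witness that \<open>0\<close> and
  \<open>1\<close> differ in the product.\<close>

lemma cring_two: "cring \<lparr>carrier = {0, 1}, monoid.mult = (*), one = 1, zero = 0,
    add = \<lambda>a b. (a + b) mod (2 :: nat)\<rparr>"
  by (rule cringI; (rule abelian_groupI comm_monoidI)?) auto

instantiation prod_ring :: comm_ring_1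
begin

definition "0 = tuple (\<lambda>R. \<zero>\<^bsub>R\<^esub>)"
definition "1 = tuple (\<lambda>R. \<one>\<^bsub>R\<^esub>)"
definition "u + v = tuple (\<lambda>R. proj R u \<oplus>\<^bsub>R\<^esub> proj R v)"
definition "u * v = tuple (\<lambda>R. proj R u \<otimes>\<^bsub>R\<^esub> proj R v)"
definition "- u = tuple (\<lambda>R. \<ominus>\<^bsub>R\<^esub> proj R u)"
definition "u - v = u + - (v :: prod_ring)"

lemma proj_ops:
  assumes "cring R"
  shows "proj R 0 = \<zero>\<^bsub>R\<^esub>" "proj R 1 = \<one>\<^bsub>R\<^esub>" "proj R (u + v) = proj R u \<oplus>\<^bsub>R\<^esub> proj R v"
    "proj R (u * v) = proj R u \<otimes>\<^bsub>R\<^esub> proj R v" "proj R (- u) = \<ominus>\<^bsub>R\<^esub> proj R u"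
proof -
  have c: "\<zero>\<^bsub>S\<^esub> \<in> carrier S" "\<one>\<^bsub>S\<^esub> \<in> carrier S" "proj S u \<oplus>\<^bsub>S\<^esub> proj S v \<in> carrier S"
    "proj S u \<otimes>\<^bsub>S\<^esub> proj S v \<in> carrier S" "\<ominus>\<^bsub>S\<^esub> proj S u \<in> carrier S"
    if "cring S" for S u v
  proof -
    interpret S: cring S by fact
    show "\<zero>\<^bsub>S\<^esub> \<in> carrier S" "\<one>\<^bsub>S\<^esub> \<in> carrier S" "proj S u \<oplus>\<^bsub>S\<^esub> proj S v \<in> carrier S"
      "proj S u \<otimes>\<^bsub>S\<^esub> proj S v \<in> carrier S" "\<ominus>\<^bsub>S\<^esub> proj S u \<in> carrier S"
      using that by simp_all
  qed
  show "proj R 0 = \<zero>\<^bsub>R\<^esub>" "proj R 1 = \<one>\<^bsub>R\<^esub>" "proj R (u + v) = proj R u \<oplus>\<^bsub>R\<^esub> proj R v"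
    "proj R (u * v) = proj R u \<otimes>\<^bsub>R\<^esub> proj R v" "proj R (- u) = \<ominus>\<^bsub>R\<^esub> proj R u"
    unfolding zero_prod_ring_def one_prod_ring_def plus_prod_ring_def times_prod_ring_def
      uminus_prod_ring_def
    using assms by (simp_all add: proj_tuple c)
qed

instance
proof
  fix u v w :: prod_ring
  show "u * v * w = u * (v * w)"
    by (rule prod_ring_eqI) (simp add: proj_ops cring.cring_simprules(11))
  show "u * v = v * u"
    by (rule prod_ring_eqI) (simp add: proj_ops cring.cring_simprules(14))
  show "1 * u = u"
    by (rule prod_ring_eqI) (simp add: proj_ops cring.cring_simprules(12))
  show "u + v + w = u + (v + w)"
    by (rule prod_ring_eqI) (simp add: proj_ops cring.cring_simprules(7))
  show "u + v = v + u"
    by (rule prod_ring_eqI) (simp add: proj_ops cring.cring_simprules(10))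
  show "0 + u = u"
    by (rule prod_ring_eqI) (simp add: proj_ops cring.cring_simprules(8))
  show "- u + u = 0"
    by (rule prod_ring_eqI) (simp add: proj_ops cring.cring_simprules(9))
  show "u - v = u + - v"
    by (rule minus_prod_ring_def)
  show "(u + v) * w = u * w + v * w"
    by (rule prod_ring_eqI) (simp add: proj_ops cring.cring_simprules(13))
  show "(0 :: prod_ring) \<noteq> 1"
    using proj_ops(1,2)[OF cring_two] by auto
qed

end

definition emb :: "nat ring \<Rightarrow> nat \<Rightarrow> prod_ring" where
  "emb R a = tuple (\<lambda>S. if S = R then a else \<zero>\<^bsub>S\<^esub>)"

lemma proj_emb:
  assumes "cring R" "a \<in> carrier R"
  shows "proj S (emb R a) = (if cring S then if S = R then a else \<zero>\<^bsub>S\<^esub> else 0)"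
  unfolding emb_def using assms by (subst proj_tuple) (auto intro: cring.cring_simprules(2))

lemma proj_emb_same [simp]: "cring R \<Longrightarrow> a \<in> carrier R \<Longrightarrow> proj R (emb R a) = a"
  by (simp add: proj_emb)

lemma emb_hom:
  assumes "cring R" "a \<in> carrier R" "b \<in> carrier R"
  shows "emb R (a \<oplus>\<^bsub>R\<^esub> b) = emb R a + emb R b" "emb R (a \<otimes>\<^bsub>R\<^esub> b) = emb R a * emb R b"
    "emb R (\<ominus>\<^bsub>R\<^esub> a) = - emb R a" "emb R \<zero>\<^bsub>R\<^esub> = 0"
  using assms by (auto intro!: prod_ring_eqI simp: proj_emb proj_ops cring.cring_simprules)

lemma emb_inject: "cring R \<Longrightarrow> a \<in> carrier R \<Longrightarrow> b \<in> carrier R \<Longrightarrow> emb R a = emb R b \<longleftrightarrow> a = b"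
  by (metis proj_emb_same)

text \<open>The unit \<open>e\<close> of the field \<open>K\<close> need not be the unit of the ambient ring.\<close>

locale finite_subfield =
  fixes K :: "'u :: comm_ring_1 set" and e :: 'u
  assumes zero_K [simp]: "0 \<in> K"
    and add_K [simp]: "a \<in> K \<Longrightarrow> b \<in> K \<Longrightarrow> a + b \<in> K"
    and mult_K [simp]: "a \<in> K \<Longrightarrow> b \<in> K \<Longrightarrow> a * b \<in> K"
    and uminus_K [simp]: "a \<in> K \<Longrightarrow> - a \<in> K"
    and e_K [simp]: "e \<in> K"
    and e_neq_0 [simp]: "e \<noteq> 0"
    and e_mult: "a \<in> K \<Longrightarrow> e * a = a"
    and inverse_ex: "a \<in> K \<Longrightarrow> a \<noteq> 0 \<Longrightarrow> \<exists>b\<in>K. b * a = e"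
    and finite_K [simp]: "finite K"
    and odd_card: "odd (card K)"
begin

lemma mult_e: "a \<in> K \<Longrightarrow> a * e = a"
  by (metis e_mult mult.commute)

lemma diff_K [simp]: "a \<in> K \<Longrightarrow> b \<in> K \<Longrightarrow> a - b \<in> K"
  using add_K[of a "- b"] by simp

lemma sum_K [simp]: "(\<And>i. i \<in> S \<Longrightarrow> h i \<in> K) \<Longrightarrow> sum h S \<in> K"
  by (induction S rule: infinite_finite_induct) auto

lemma mult_eq_0_K:
  assumes "a \<in> K" "b \<in> K" "a * b = 0" "a \<noteq> 0"
  shows "b = 0"
proof -
  obtain c where "c \<in> K" "c * a = e" using inverse_ex assms by blast
  then have "b = c * a * b" using e_mult[OF assms(2)] by simp
  also have "\<dots> = 0" using assms(3) by (simp add: mult.assoc)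
  finally show ?thesis .
qed

text \<open>Translation by \<open>e\<close> permutes \<open>K\<close>, so summing over
  \<open>K\<close> shows that \<open>card K\<close> times \<open>e\<close> is zero; as
  \<open>card K\<close> is odd, \<open>e + e = 0\<close> would leave \<open>e = 0\<close>.\<close>

lemma two_e_neq_0: "e + e \<noteq> 0"
proof
  assume two: "e + e = 0"
  have "(\<Sum>k\<in>K. k + e) = (\<Sum>k\<in>(\<lambda>k. k + e) ` K. k)"
    by (subst sum.reindex) (auto simp: inj_on_def)
  also have "(\<lambda>k. k + e) ` K = K"
    by (rule card_subset_eq) (auto simp: card_image inj_on_def)
  finally have "of_nat (card K) * e = 0" by (simp add: sum.distrib)
  moreover obtain j where "card K = 2 * j + 1" using odd_card by (elim oddE)
  moreover have "of_nat (2 * j) * e = of_nat j * (e + e)" by (simp add: algebra_simps)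
  ultimately show False using two by (simp add: distrib_right)
qed

lemma double_eq_0: "a \<in> K \<Longrightarrow> a + a = 0 \<Longrightarrow> a = 0"
  using mult_eq_0_K[of "e + e" a] two_e_neq_0 add_K[OF e_K e_K] e_mult[of a]
  by (metis distrib_right)

lemma card_K_ge_3: "3 \<le> card K"
proof -
  have "card {0, e} \<le> card K" by (rule card_mono) auto
  then have "2 \<le> card K" using e_neq_0 by (simp del: e_neq_0) 
  with odd_card show ?thesis by (cases "card K = 2") auto
qed

end

lemma finite_subfield_emb:
  assumes "field R" "carrier R = {..<q}" "odd q"
  shows "finite_subfield (emb R ` carrier R) (emb R \<one>\<^bsub>R\<^esub>)" "card (emb R ` carrier R) = q"
proof -
  interpret R: field R by fact
  have c: "cring R" by (rule R.is_cring)
  note hom = emb_hom[OF c, symmetric]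
  show q: "card (emb R ` carrier R) = q"
    using assms(2) by (subst card_image) (auto simp: inj_on_def emb_inject[OF c])
  show "finite_subfield (emb R ` carrier R) (emb R \<one>\<^bsub>R\<^esub>)"
  proof
    show "0 \<in> emb R ` carrier R" using hom(4)[of _ _] R.zero_closed by (metis image_eqI emb_hom(4)
        c)
  next
    fix a b assume "a \<in> emb R ` carrier R" "b \<in> emb R ` carrier R"
    then show "a + b \<in> emb R ` carrier R" "a * b \<in> emb R ` carrier R"
      by (auto simp: hom)
  next
    fix a assume a: "a \<in> emb R ` carrier R"
    then show "- a \<in> emb R ` carrier R" "emb R \<one>\<^bsub>R\<^esub> * a = a" by (auto simp: hom)
    assume "a \<noteq> 0"
    with a obtain x where "a = emb R x" "x \<in> carrier R" "x \<noteq> \<zero>\<^bsub>R\<^esub>"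
      using emb_hom(4)[OF c] by auto
    moreover from this have "inv\<^bsub>R\<^esub> x \<in> carrier R" "inv\<^bsub>R\<^esub> x \<otimes>\<^bsub>R\<^esub> x = \<one>\<^bsub>R\<^esub>"
      using R.field_Units by auto
    ultimately show "\<exists>b\<in>emb R ` carrier R. b * a = emb R \<one>\<^bsub>R\<^esub>"
      by (metis hom(2) imageI)
  next
    show "emb R \<one>\<^bsub>R\<^esub> \<noteq> 0"
      using emb_hom(4)[OF c] by (metis R.one_closed R.one_not_zero R.zero_closed emb_inject[OF c])
  qed (use assms q in auto)
qed

section \<open>Most cubic forms have few adjoints\<close>

text \<open>\<open>tau c i j k\<close> is the value of the polarisation of the form with coefficients \<open>c\<close> at the unit
  vectors \<open>i\<close>, \<open>j\<close>, \<open>k\<close>.\<close>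

definition mult3 :: "nat \<Rightarrow> nat \<Rightarrow> nat \<Rightarrow> 'u :: comm_ring_1" where
  "mult3 i j k = (if i = j \<and> j = k then 6 else if i = j \<or> j = k \<or> i = k then 2 else 1)"

definition tau :: "(nat multiset \<Rightarrow> 'u) \<Rightarrow> nat \<Rightarrow> nat \<Rightarrow> nat \<Rightarrow> 'u :: comm_ring_1" where
  "tau c i j k = mult3 i j k * c {#i, j, k#}"

lemma tau_perm: "tau c i j k = tau c i k j" "tau c i j k = tau c j i k"
  unfolding tau_def mult3_def by (auto simp: add_mset_commute)

lemma tau_add: "tau (\<lambda>m. c m + d m) i j k = tau c i j k + tau d i j k"
  by (simp add: tau_def distrib_left)

text \<open>The entry \<open>(j, k)\<close> of the matrix \<open>T_i A + D T_i\<close>, where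
  \<open>T_i\<close> is the slice of \<open>tau c\<close> at \<open>i\<close>.\<close>

definition adj_eq ::
    "nat \<Rightarrow> (nat multiset \<Rightarrow> 'u) \<Rightarrow> (nat \<times> nat \<Rightarrow> 'u) \<Rightarrow> (nat \<times> nat \<Rightarrow> 'u) \<Rightarrow> nat \<Rightarrow> nat \<Rightarrow> nat \<Rightarrow> 'u ::
        comm_ring_1" where
  "adj_eq n c A D i j k = (\<Sum>p<n. A (p, k) * tau c i j p) + (\<Sum>p<n. D (j, p) * tau c i p k)"

lemma adj_eq_add: "adj_eq n (\<lambda>m. c m + d m) A D i j k = adj_eq n c A D i j k + adj_eq n d A D i j k"
  by (simp add: adj_eq_def tau_add distrib_left sum.distrib)

definition mtransp :: "(nat \<times> nat \<Rightarrow> 'u) \<Rightarrow> nat \<times> nat \<Rightarrow> 'u" where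
  "mtransp A = (\<lambda>(i, j). A (j, i))"

text \<open>The slices are symmetric, so transposing \<open>T_i A + D T_i = 0\<close> exchanges the
  roles of \<open>A\<close> and \<open>D\<close>. Every bound obtained from \<open>A\<close> thereby
  applies to the transpose of \<open>D\<close>.\<close>

lemma adj_eq_transp: "adj_eq n c (mtransp D) (mtransp A) i j k = adj_eq n c A D i k j"
  by (simp add: adj_eq_def mtransp_def tau_perm(1)[of c i j] tau_perm(1)[of c i _ k] add.commute)

lemma mtransp_mtransp [simp]: "mtransp (mtransp A) = A"
  by (auto simp: mtransp_def)

definition monomials3 :: "nat \<Rightarrow> nat multiset set" where
  "monomials3 n = {m. size m = 3 \<and> set_mset m \<subseteq> {..<n}}"

lemma finite_monomials3 [simp]: "finite (monomials3 n)"
proof -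
  have "monomials3 n \<subseteq> mset ` {xs. set xs \<subseteq> {..<n} \<and> length xs = 3}"
  proof
    fix m assume "m \<in> monomials3 n"
    moreover obtain xs where "mset xs = m" using ex_mset by blast
    ultimately show "m \<in> mset ` {xs. set xs \<subseteq> {..<n} \<and> length xs = 3}"
      by (auto simp: monomials3_def)
  qed
  then show ?thesis by (rule finite_subset) (simp add: finite_lists_length_eq)
qed

lemma sum_delta3:
  assumes "finite A" "finite B" "finite C" "a \<in> A" "b \<in> B" "c \<in> C"
  shows "(\<Sum>i\<in>A. \<Sum>j\<in>B. \<Sum>k\<in>C. if a = i \<and> b = j \<and> c = k then h i j k else 0) = (h a b c :: 'u ::
      comm_monoid_add)"
proof -
  have "(\<Sum>i\<in>A. \<Sum>j\<in>B. \<Sum>k\<in>C. if a = i \<and> b = j \<and> c = k then h i j k else 0)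
      = (\<Sum>i\<in>A. if a = i then \<Sum>j\<in>B. if b = j then \<Sum>k\<in>C. if c = k then h i j k else 0 else 0 else 0)"
    by (intro sum.cong refl) (auto intro!: sum.cong sum.neutral)
  then show ?thesis using assms by (simp add: sum.delta)
qed

context finite_subfield
begin

definition q :: nat where "q = card K"

lemma q_ge_3: "3 \<le> q"
  unfolding q_def by (rule card_K_ge_3)

definition mats :: "nat \<Rightarrow> (nat \<times> nat \<Rightarrow> 'u) set" where
  "mats n = {..<n} \<times> {..<n} \<rightarrow>\<^sub>E K"

lemma finite_mats [simp]: "finite (mats n)"
  unfolding mats_def by (intro finite_PiE) auto

lemma mats_K [simp]: "A \<in> mats n \<Longrightarrow> i < n \<Longrightarrow> j < n \<Longrightarrow> A (i, j) \<in> K"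
  by (auto simp: mats_def)

lemma mtransp_mats: "A \<in> mats n \<Longrightarrow> mtransp A \<in> mats n"
  by (auto simp: mats_def mtransp_def PiE_def extensional_def)

definition cubics :: "nat \<Rightarrow> (nat multiset \<Rightarrow> 'u) set" where
  "cubics n = {c. (\<forall>m. c m \<in> K) \<and> (\<forall>m. m \<notin> monomials3 n \<longrightarrow> c m = 0)}"

lemma finite_cubics [simp]: "finite (cubics n)"
proof -
  have "cubics n \<subseteq> {c. \<forall>m. (m \<in> monomials3 n \<longrightarrow> c m \<in> K) \<and> (m \<notin> monomials3 n \<longrightarrow> c m = 0)}"
    by (auto simp: cubics_def)
  then show ?thesis by (rule finite_subset) (rule finite_set_of_finite_funs; simp)
qed

definition adjoints :: "nat \<Rightarrow> nat \<Rightarrow> (nat multiset \<Rightarrow> 'u) \<Rightarrow> ((nat \<times> nat \<Rightarrow> 'u) \<times> (nat \<times> nat \<Rightarrow> 'u))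
    set" where
  "adjoints n r c = {(A, D). A \<in> mats n \<and> D \<in> mats n \<and>
     (\<forall>i<r. \<forall>j<n. \<forall>k<n. adj_eq n c A D i j k = 0)}"

lemma finite_adjoints [simp]: "finite (adjoints n r c)"
  by (rule finite_subset[of _ "mats n \<times> mats n"]) (auto simp: adjoints_def)

lemma adjoints_transp: "(A, D) \<in> adjoints n r c \<longleftrightarrow> (mtransp D, mtransp A) \<in> adjoints n r c"
proof -
  have "A \<in> mats n \<longleftrightarrow> mtransp A \<in> mats n" for A
    by (metis mtransp_mats mtransp_mtransp)
  then show ?thesis unfolding adjoints_def mem_Collect_eq prod.case adj_eq_transp by blast
qed

text \<open>\<open>C\<close> inverts the submatrix of \<open>A\<close> with rows \<open>I\<close> and columns \<open>J\<close>. Only disjoint index sets are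
  considered, so that nothing is said about the diagonal: diagonal matrices are too few to
  matter.\<close>

definition pivot_minor ::
    "nat \<Rightarrow> nat \<Rightarrow> (nat \<times> nat \<Rightarrow> 'u) \<Rightarrow> nat set \<Rightarrow> nat set \<Rightarrow> (nat \<times> nat \<Rightarrow> 'u) \<Rightarrow> bool" where
  "pivot_minor r n A I J C \<longleftrightarrow> I \<subseteq> {r..<n} \<and> J \<subseteq> {r..<n} \<and> I \<inter> J = {} \<and> card I = card J \<and>
     C \<in> J \<times> I \<rightarrow>\<^sub>E K \<and> (\<forall>k\<in>J. \<forall>j\<in>J. (\<Sum>p\<in>I. C (k, p) * A (p, j)) = (if k = j then e else 0))"

text \<open>The coefficients of \<open>x_i x_l x_p\<close> are chosen so that multiplication by the
  minor of \<open>A\<close> cancels \<open>C\<close> and leaves the free parameters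
  \<open>\<alpha>\<close>. The ranges of \<open>i\<close>, \<open>l\<close> and \<open>p\<close>
  will be disjoint, so that every monomial has three different variables and no factor 2 or 6 enters
  through \<open>tau\<close>.\<close>

definition perturbation ::
    "nat \<Rightarrow> nat set \<Rightarrow> nat set \<Rightarrow> nat set \<Rightarrow> (nat \<times> nat \<Rightarrow> 'u) \<Rightarrow> (nat \<times> nat \<times> nat \<Rightarrow> 'u) \<Rightarrow> nat multiset
        \<Rightarrow> 'u" where
  "perturbation r I J L C \<alpha> m = (\<Sum>i<r. \<Sum>l\<in>L. \<Sum>p\<in>I.
     if m = {#i, l, p#} then \<Sum>k\<in>J. C (k, p) * \<alpha> (i, k, l) else 0)"

section \<open>Forms that share a given adjoint pair\<close>

context
  fixes r n I J L C A \<alpha>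
  assumes piv: "pivot_minor r n A I J C" and A: "A \<in> mats n" and L: "L = {r..<n} - (I \<union> J)"
    and \<alpha>: "\<alpha> \<in> {..<r} \<times> J \<times> L \<rightarrow>\<^sub>E K"
begin

lemma index_facts:
  "finite I" "finite J" "finite L" "I \<inter> L = {}" "J \<inter> L = {}" "I \<inter> J = {}"
  "\<And>x. x \<in> I \<Longrightarrow> r \<le> x \<and> x < n" "\<And>x. x \<in> J \<Longrightarrow> r \<le> x \<and> x < n" "\<And>x. x \<in> L \<Longrightarrow> r \<le> x \<and> x < n"
  using piv L by (auto simp: pivot_minor_def dest: finite_subset)

lemma perturbation_cubics: "r \<le> n \<Longrightarrow> perturbation r I J L C \<alpha> \<in> cubics n"
  unfolding cubics_def
proof (intro CollectI conjI allI impI)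
  fix m assume "r \<le> n"
  show "perturbation r I J L C \<alpha> m \<in> K"
    unfolding perturbation_def using piv \<alpha>
    by (auto simp: pivot_minor_def intro!: sum_K mult_K)
  show "perturbation r I J L C \<alpha> m = 0" if "m \<notin> monomials3 n"
    unfolding perturbation_def
  proof (intro sum.neutral ballI)
    fix i l p assume "i \<in> {..<r}" "l \<in> L" "p \<in> I"
    then have "{#i, l, p#} \<in> monomials3 n" using index_facts(7,9) \<open>r \<le> n\<close>
      by (force simp: monomials3_def)
    with that show "(if m = {#i, l, p#} then \<Sum>k\<in>J. C (k, p) * \<alpha> (i, k, l) else 0) = 0" by auto
  qed
qed

text \<open>The three index ranges are pairwise disjoint, so a monomial determines its triple and a
  single summand survives.\<close>

lemma perturbation_eq:
  assumes "i < r" "l \<in> L" "p \<in> I"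
  shows "perturbation r I J L C \<alpha> {#i, l, p#} = (\<Sum>k\<in>J. C (k, p) * \<alpha> (i, k, l))"
proof -
  have uniq: "{#i, l, p#} = {#i', l', p'#} \<longleftrightarrow> i = i' \<and> l = l' \<and> p = p'"
    if "i' \<in> {..<r}" "l' \<in> L" "p' \<in> I" for i' l' p'
  proof
    assume "{#i, l, p#} = {#i', l', p'#}"
    then have "set_mset {#i, l, p#} = set_mset {#i', l', p'#}" by (rule arg_cong)
    then have s: "i' \<in> {i, l, p}" "l' \<in> {i, l, p}" "p' \<in> {i, l, p}" by auto
    have "i' \<noteq> l" "i' \<noteq> p" "l' \<noteq> i" "l' \<noteq> p" "p' \<noteq> i" "p' \<noteq> l"
      using assms that index_facts(4,7,9) by force+
    with s show "i = i' \<and> l = l' \<and> p = p'" by simp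
  qed simp
  have "perturbation r I J L C \<alpha> {#i, l, p#} = (\<Sum>i'<r. \<Sum>l'\<in>L. \<Sum>p'\<in>I.
      if i = i' \<and> l = l' \<and> p = p' then \<Sum>k\<in>J. C (k, p') * \<alpha> (i', k, l') else 0)"
    unfolding perturbation_def by (intro sum.cong refl) (simp add: uniq)
  also have "\<dots> = (\<Sum>k\<in>J. C (k, p) * \<alpha> (i, k, l))"
    using assms index_facts(1,3) by (intro sum_delta3) auto
  finally show ?thesis .
qed

text \<open>Every perturbed monomial contains a variable from \<open>I\<close> and none from
  \<open>J\<close>.\<close>

lemma perturbation_eq_0:
  assumes "set_mset m \<inter> I = {} \<or> j \<in># m \<and> j \<in> J"
  shows "perturbation r I J L C \<alpha> m = 0"
  unfolding perturbation_def
proof (intro sum.neutral ballI)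
  fix i l p assume "i \<in> {..<r}" "l \<in> L" "p \<in> I"
  then have "m \<noteq> {#i, l, p#}" using assms index_facts by force
  then show "(if m = {#i, l, p#} then \<Sum>k\<in>J. C (k, p) * \<alpha> (i, k, l) else 0) = 0" by simp
qed

text \<open>In the part with \<open>A\<close>, the sum of \<open>C (k, p) * A (p, j)\<close> over
  \<open>p\<close> in \<open>I\<close> is an entry of the identity matrix and singles out
  \<open>\<alpha> (i, j, l)\<close>. The part with \<open>D\<close> vanishes because
  \<open>j\<close> lies in \<open>J\<close>, whose variables are not perturbed.\<close>

lemma adj_eq_perturbation:
  assumes "i < r" "l \<in> L" "j \<in> J"
  shows "adj_eq n (perturbation r I J L C \<alpha>) A D i l j = \<alpha> (i, j, l)"
proof -
  let ?c = "perturbation r I J L C \<alpha>"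
  have t1: "tau ?c i l p = (if p \<in> I then \<Sum>k\<in>J. C (k, p) * \<alpha> (i, k, l) else 0)" for p
  proof (cases "p \<in> I")
    case True
    then have "i \<noteq> l" "l \<noteq> p" "i \<noteq> p" using assms index_facts by fastforce+
    then show ?thesis using True assms by (simp add: tau_def mult3_def perturbation_eq)
  next
    case False
    have "{i, l, p} \<inter> I = {}" using False assms index_facts by fastforce
    then show ?thesis using False by (simp add: tau_def perturbation_eq_0)
  qed
  have t2: "tau ?c i p j = 0" for p
    using assms by (simp add: tau_def perturbation_eq_0[of _ j])
  have "adj_eq n ?c A D i l j = (\<Sum>p<n. if p \<in> I then A (p, j) * (\<Sum>k\<in>J. C (k, p) * \<alpha> (i, k, l))
      else 0)"
    by (auto simp: adj_eq_def t1 t2 intro!: sum.cong)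
  also have "\<dots> = (\<Sum>p\<in>I. A (p, j) * (\<Sum>k\<in>J. C (k, p) * \<alpha> (i, k, l)))"
    using index_facts by (subst sum.inter_restrict[symmetric]) (auto intro!: sum.cong)
  also have "\<dots> = (\<Sum>k\<in>J. \<alpha> (i, k, l) * (\<Sum>p\<in>I. C (k, p) * A (p, j)))"
    unfolding sum_distrib_left by (subst sum.swap) (simp add: mult_ac)
  also have "\<dots> = (\<Sum>k\<in>J. if k = j then \<alpha> (i, k, l) * e else 0)"
    using piv assms by (intro sum.cong refl) (auto simp: pivot_minor_def)
  also have "\<dots> = \<alpha> (i, j, l)"
    using assms index_facts(2) mult_e[of "\<alpha> (i, j, l)"] PiE_mem[OF \<alpha>, of "(i, j, l)"]
    by (simp add: sum.delta)
  finally show ?thesis .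
qed

end

text \<open>Adding a perturbation to a form changes its adjoint equations by the parameter \<open>\<alpha>\<close>, hence
  the translates of the space of solutions by all perturbations are disjoint.\<close>

lemma card_adjoint_cubics:
  assumes piv: "pivot_minor r n A I J C" and A: "A \<in> mats n" and "r \<le> n"
  defines "L \<equiv> {r..<n} - (I \<union> J)"
  shows "card {c \<in> cubics n. (A, D) \<in> adjoints n r c} * q ^ (r * (card J * card L)) \<le> card (cubics
      n)"
proof -
  let ?H = "{c \<in> cubics n. (A, D) \<in> adjoints n r c}"
  let ?P = "{..<r} \<times> J \<times> L \<rightarrow>\<^sub>E K"
  let ?h = "\<lambda>(c, \<alpha>) m. c m + perturbation r I J L C \<alpha> m"
  have L: "L = {r..<n} - (I \<union> J)" by (simp add: L_def)
  have J: "J \<subseteq> {r..<n}" "finite J" "finite L" "L \<subseteq> {r..<n}"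
    using piv L by (auto simp: pivot_minor_def dest: finite_subset)
  have "inj_on ?h (?H \<times> ?P)"
  proof (intro inj_onI, clarify)
    fix c \<alpha> c' \<alpha>'
    assume c: "c \<in> cubics n" "(A, D) \<in> adjoints n r c" "\<alpha> \<in> ?P"
      and c': "c' \<in> cubics n" "(A, D) \<in> adjoints n r c'" "\<alpha>' \<in> ?P"
      and eq: "(\<lambda>m. c m + perturbation r I J L C \<alpha> m) = (\<lambda>m. c' m + perturbation r I J L C \<alpha>' m)"
    have "\<alpha> (i, j, l) = \<alpha>' (i, j, l)" if "i < r" "j \<in> J" "l \<in> L" for i j l
    proof -
      have "l < n" "j < n" using that J by auto
      then have "adj_eq n c A D i l j = 0" "adj_eq n c' A D i l j = 0"
        using c c' that by (auto simp: adjoints_def)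
      then show ?thesis
        using adj_eq_add[of n c "perturbation r I J L C \<alpha>" A D i l j]
          adj_eq_add[of n c' "perturbation r I J L C \<alpha>'" A D i l j] eq
          adj_eq_perturbation[OF piv A L c(3) that(1,3,2)]
          adj_eq_perturbation[OF piv A L c'(3) that(1,3,2)]
        by simp
    qed
    then have "\<alpha> = \<alpha>'"
      using c(3) c'(3) by (intro PiE_ext) auto
    with eq show "c = c' \<and> \<alpha> = \<alpha>'" by (auto simp: fun_eq_iff)
  qed
  moreover have "?h ` (?H \<times> ?P) \<subseteq> cubics n"
    using perturbation_cubics[OF piv A L _ \<open>r \<le> n\<close>] by (auto simp: cubics_def)
  ultimately have "card (?H \<times> ?P) \<le> card (cubics n)"
    by (rule card_inj_on_le) simp
  moreover have "card ?P = q ^ (r * (card J * card L))"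
    using J by (simp add: card_funcsetE card_cartesian_product q_def)
  ultimately show ?thesis by (simp add: card_cartesian_product)
qed

text \<open>Bordering of an invertible matrix: the last hypothesis says that the Schur complement at
  \<open>(i, j)\<close> is nonzero, so the minor enlarged by row \<open>i\<close> and column
  \<open>j\<close> is again invertible. As \<open>i\<close> and \<open>j\<close> differ and lie
  outside both sets, the enlarged sets remain disjoint.\<close>

lemma pivot_minor_extend:
  assumes piv: "pivot_minor r n A I J C" and A: "A \<in> mats n"
    and ij: "i \<in> {r..<n} - (I \<union> J)" "j \<in> {r..<n} - (I \<union> J)" "i \<noteq> j"
    and neq: "A (i, j) \<noteq> (\<Sum>k\<in>J. A (i, k) * (\<Sum>p\<in>I. C (k, p) * A (p, j)))"
  shows "\<exists>C'. pivot_minor r n A (insert i I) (insert j J) C'"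
proof -
  have fin: "finite I" "finite J" and IJ: "I \<subseteq> {r..<n}" "J \<subseteq> {r..<n}" "I \<inter> J = {}" "card I = card J"
    and inv: "\<And>k j. k \<in> J \<Longrightarrow> j \<in> J \<Longrightarrow> (\<Sum>p\<in>I. C (k, p) * A (p, j)) = (if k = j then e else 0)"
    using piv by (auto simp: pivot_minor_def dest: finite_subset)
  have AK: "A (a, b) \<in> K" if "a \<in> insert i I" "b \<in> insert j J" for a b
    using that ij IJ A by (intro mats_K) auto
  have CK: "C (k, p) \<in> K" if "k \<in> J" "p \<in> I" for k p
    using piv that by (auto simp: pivot_minor_def)
  define z where "z k = (\<Sum>p\<in>I. C (k, p) * A (p, j))" for k
  define s where "s = A (i, j) - (\<Sum>k\<in>J. A (i, k) * z k)"
  have zK: "z k \<in> K" if "k \<in> J" for k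
    unfolding z_def using that AK CK by (auto intro!: sum_K mult_K)
  have "s \<in> K" "s \<noteq> 0"
    using neq AK zK by (auto simp: s_def z_def intro!: diff_K sum_K mult_K)
  then obtain s' where s': "s' \<in> K" "s' * s = e" using inverse_ex by blast
  \<comment> \<open>The row of the new inverse that belongs to column \<open>j\<close>. The other
    rows are the old ones, padded by 0 and corrected by \<open>z k\<close> times this row, so that
    their product with column \<open>j\<close> becomes zero.\<close>
  define \<zeta> where "\<zeta> p = (if p = i then s' else - s' * (\<Sum>k\<in>J. A (i, k) * C (k, p)))" for p
  have \<zeta>K: "\<zeta> p \<in> K" if "p \<in> insert i I" for p
    unfolding \<zeta>_def using that s' AK CK by (auto intro!: mult_K sum_K)
  have i: "i \<notin> I" "j \<notin> J" "j \<notin> I" "i \<notin> J" using ij by auto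
  have \<zeta>sum: "(\<Sum>p\<in>insert i I. \<zeta> p * A (p, b)) = s' * (A (i, b) - (\<Sum>k\<in>J. A (i, k) * (\<Sum>p\<in>I. C (k, p)
      * A (p, b))))" for b
  proof -
    have "(\<Sum>p\<in>I. \<zeta> p * A (p, b)) = (\<Sum>p\<in>I. - s' * (\<Sum>k\<in>J. A (i, k) * C (k, p) * A (p, b)))"
      using i by (intro sum.cong refl) (auto simp: \<zeta>_def sum_distrib_right mult.assoc)
    also have "\<dots> = - s' * (\<Sum>k\<in>J. A (i, k) * (\<Sum>p\<in>I. C (k, p) * A (p, b)))"
      unfolding sum_distrib_left[symmetric] by (subst sum.swap) (simp add: sum_distrib_left
          mult.assoc)
    finally show ?thesis using i fin by (simp add: \<zeta>_def algebra_simps)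
  qed
  have \<zeta>J: "(\<Sum>p\<in>insert i I. \<zeta> p * A (p, b)) = 0" if "b \<in> J" for b
  proof -
    have "(\<Sum>k\<in>J. A (i, k) * (\<Sum>p\<in>I. C (k, p) * A (p, b))) = (\<Sum>k\<in>J. if k = b then A (i, b) * e else
        0)"
      using that by (intro sum.cong refl) (simp add: inv)
    also have "\<dots> = A (i, b)" using that fin AK mult_e by (simp add: sum.delta)
    finally show ?thesis unfolding \<zeta>sum by simp
  qed
  have \<zeta>j: "(\<Sum>p\<in>insert i I. \<zeta> p * A (p, j)) = e"
    unfolding \<zeta>sum using s' by (simp add: s_def z_def)
  define C0 where "C0 k p = (if k = j then \<zeta> p else (if p = i then 0 else C (k, p)) - z k * \<zeta> p)"
      for k p
  define C' where "C' = (\<lambda>(k, p). if k \<in> insert j J \<and> p \<in> insert i I then C0 k p else undefined)"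
  have C'K: "C' \<in> insert j J \<times> insert i I \<rightarrow>\<^sub>E K"
    unfolding C'_def C0_def using \<zeta>K zK CK by (auto simp: PiE_def extensional_def)
  have "(\<Sum>p\<in>insert i I. C' (k, p) * A (p, b)) = (if k = b then e else 0)"
    if k: "k \<in> insert j J" and b: "b \<in> insert j J" for k b
  proof (cases "k = j")
    case True
    have "(\<Sum>p\<in>insert i I. C' (k, p) * A (p, b)) = (\<Sum>p\<in>insert i I. \<zeta> p * A (p, b))"
      using True by (intro sum.cong refl) (auto simp: C'_def C0_def)
    then show ?thesis using True \<zeta>J \<zeta>j b i by auto
  next
    case False
    then have kJ: "k \<in> J" using k by simp
    have "(\<Sum>p\<in>insert i I. C' (k, p) * A (p, b))
        = (\<Sum>p\<in>insert i I. (if p = i then 0 else C (k, p)) * A (p, b) - z k * (\<zeta> p * A (p, b)))"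
      using kJ False by (intro sum.cong refl) (auto simp: C'_def C0_def algebra_simps)
    also have "\<dots> = (\<Sum>p\<in>insert i I. (if p = i then 0 else C (k, p)) * A (p, b))
        - z k * (\<Sum>p\<in>insert i I. \<zeta> p * A (p, b))"
      by (simp add: sum_subtractf sum_distrib_left)
    also have "(\<Sum>p\<in>insert i I. (if p = i then 0 else C (k, p)) * A (p, b)) = (\<Sum>p\<in>I. C (k, p) * A
        (p, b))"
      using fin i by (auto intro!: sum.cong)
    also have "(\<Sum>p\<in>I. C (k, p) * A (p, b)) - z k * (\<Sum>p\<in>insert i I. \<zeta> p * A (p, b)) = (if k = b
        then e else 0)"
    proof (cases "b = j")
      case True
      then show ?thesis using \<zeta>j zK[OF kJ] mult_e False by (simp add: z_def)
    next
      case False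
      then show ?thesis using \<zeta>J b inv kJ by simp
    qed
    finally show ?thesis .
  qed
  then have "pivot_minor r n A (insert i I) (insert j J) C'"
    unfolding pivot_minor_def using C'K IJ ij i fin by auto
  then show ?thesis by blast
qed

text \<open>If \<open>C\<close> inverts the minor, this says that its Schur complement has only
  zeros off the diagonal.\<close>

definition closed_minor ::
    "nat \<Rightarrow> nat \<Rightarrow> (nat \<times> nat \<Rightarrow> 'u) \<Rightarrow> nat set \<Rightarrow> nat set \<Rightarrow> (nat \<times> nat \<Rightarrow> 'u) \<Rightarrow> bool" where
  "closed_minor r n A I J C \<longleftrightarrow> (\<forall>i\<in>{r..<n} - (I \<union> J). \<forall>j\<in>{r..<n} - (I \<union> J). i \<noteq> j \<longrightarrow>
     A (i, j) = (\<Sum>k\<in>J. A (i, k) * (\<Sum>p\<in>I. C (k, p) * A (p, j))))"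

text \<open>For the largest order within the bound, either one more row and column would violate the
  bound, or maximality rules out every extension by \<open>pivot_minor_extend\<close>.\<close>

lemma pivot_minor_exists:
  assumes A: "A \<in> mats n"
  shows "\<exists>I J C. pivot_minor r n A I J C \<and> 4 * card J \<le> n - r \<and>
    (n - r < 4 * card J + 4 \<or> closed_minor r n A I J C)"
proof -
  define Q where "Q t \<longleftrightarrow> (\<exists>I J C. pivot_minor r n A I J C \<and> card J = t \<and> 4 * t \<le> n - r)" for t
  have "Q 0"
    unfolding Q_def pivot_minor_def by (intro exI[of _ "{}"] exI[of _ "\<lambda>_. undefined"]) auto
  have bound: "t \<le> n" if "Q t" for t using that by (auto simp: Q_def)
  define t where "t = Greatest Q"
  have "Q t" unfolding t_def using \<open>Q 0\<close> bound by (rule GreatestI_nat)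
  then obtain I J C where IJC: "pivot_minor r n A I J C" "card J = t" "4 * t \<le> n - r"
    by (auto simp: Q_def)
  have "closed_minor r n A I J C" if "\<not> n - r < 4 * t + 4"
  proof (rule ccontr)
    assume "\<not> closed_minor r n A I J C"
    then obtain i j where ij: "i \<in> {r..<n} - (I \<union> J)" "j \<in> {r..<n} - (I \<union> J)" "i \<noteq> j"
      "A (i, j) \<noteq> (\<Sum>k\<in>J. A (i, k) * (\<Sum>p\<in>I. C (k, p) * A (p, j)))"
      unfolding closed_minor_def by blast
    from pivot_minor_extend[OF IJC(1) A ij] obtain C' where
      "pivot_minor r n A (insert i I) (insert j J) C'" by blast
    moreover have "card (insert j J) = Suc t"
      using ij IJC by (auto simp: pivot_minor_def card_insert_if dest: finite_subset)
    ultimately have "Q (Suc t)" unfolding Q_def using that by (intro exI conjI) auto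
    then have "Suc t \<le> t" unfolding t_def using bound by (rule Greatest_le_nat)
    then show False by simp
  qed
  with IJC show ?thesis by blast
qed

text \<open>For given \<open>C\<close>, such a matrix is determined by its entries outside the
  off-diagonal part of \<open>L \<times> L\<close>. These lie in \<open>r + 2 t\<close> rows, in as
  many columns, and on the diagonal, which accounts for the summand 1.\<close>

lemma card_closed_minor:
  assumes I: "I \<subseteq> {r..<n}" "J \<subseteq> {r..<n}" "I \<inter> J = {}" "card I = t" "card J = t"
  shows "card {A \<in> mats n. closed_minor r n A I J C} \<le> q ^ (n * (2 * r + 4 * t + 1))"
proof -
  define L where "L = {r..<n} - (I \<union> J)"
  define S where "S = {..<n} \<times> {..<n} - {(i, j). i \<in> L \<and> j \<in> L \<and> i \<noteq> j}"
  have fin: "finite I" "finite J" "finite L" using I by (auto simp: L_def dest: finite_subset)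
  have "inj_on (\<lambda>A. restrict A S) {A \<in> mats n. closed_minor r n A I J C}"
  proof (rule inj_onI, clarify)
    fix A B assume A: "A \<in> mats n" "closed_minor r n A I J C" and B: "B \<in> mats n" "closed_minor r
        n B I J C"
      and eq: "restrict A S = restrict B S"
    have S: "A x = B x" if "x \<in> S" for x using eq that by (metis restrict_apply')
    show "A = B"
    proof
      fix x :: "nat \<times> nat"
      obtain i j where x: "x = (i, j)" by fastforce
      consider "x \<in> S" | "x \<notin> {..<n} \<times> {..<n}" | "i \<in> L" "j \<in> L" "i \<noteq> j"
        unfolding S_def x by auto
      then show "A x = B x"
      proof cases
        case 1 then show ?thesis by (rule S)
      next
        case 2 then show ?thesis using A(1) B(1) unfolding mats_def by (metis PiE_arb)
      next
        case 3
        have "(i, k) \<in> S" if "k \<in> J" for k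
          using 3 that I by (auto simp: S_def L_def)
        moreover have "(p, j) \<in> S" if "p \<in> I" for p
          using 3 that I by (auto simp: S_def L_def)
        ultimately have "(\<Sum>k\<in>J. A (i, k) * (\<Sum>p\<in>I. C (k, p) * A (p, j)))
            = (\<Sum>k\<in>J. B (i, k) * (\<Sum>p\<in>I. C (k, p) * B (p, j)))"
          by (intro sum.cong refl arg_cong2[where f = "(*)"]) (auto intro: S)
        then show ?thesis using 3 A(2) B(2) by (simp add: closed_minor_def L_def x)
      qed
    qed
  qed
  moreover have "(\<lambda>A. restrict A S) ` {A \<in> mats n. closed_minor r n A I J C} \<subseteq> S \<rightarrow>\<^sub>E K"
  proof (rule image_subsetI)
    fix A assume "A \<in> {A \<in> mats n. closed_minor r n A I J C}"
    then have "A x \<in> K" if "x \<in> S" for x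
      using that mats_K[of A n "fst x" "snd x"] by (auto simp: S_def)
    then show "restrict A S \<in> S \<rightarrow>\<^sub>E K" by simp
  qed
  moreover have "finite S" by (simp add: S_def)
  ultimately have "card {A \<in> mats n. closed_minor r n A I J C} \<le> q ^ card S"
    using card_inj_on_le[of "\<lambda>A. restrict A S" "{A \<in> mats n. closed_minor r n A I J C}" "S \<rightarrow>\<^sub>E K"]
    by (simp add: finite_PiE card_funcsetE q_def)
  moreover have "card S \<le> n * (2 * r + 4 * t + 1)"
  proof -
    have L_card: "card ({..<n} - L) \<le> r + 2 * t"
    proof -
      have "{..<n} - L \<subseteq> {..<r} \<union> (I \<union> J)" by (auto simp: L_def)
      then have "card ({..<n} - L) \<le> card ({..<r} \<union> (I \<union> J))" using fin by (intro card_mono) auto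
      also have "\<dots> \<le> r + (t + t)" using I(4,5)
        by (metis card_Un_le card_lessThan add_left_mono order.trans)
      finally show ?thesis by simp
    qed
    have "S \<subseteq> ({..<n} - L) \<times> {..<n} \<union> {..<n} \<times> ({..<n} - L) \<union> (\<lambda>i. (i, i)) ` {..<n}"
      by (auto simp: S_def)
    then have "card S \<le> card (({..<n} - L) \<times> {..<n} \<union> {..<n} \<times> ({..<n} - L) \<union> (\<lambda>i. (i, i)) `
        {..<n})"
      by (intro card_mono) auto
    also have "\<dots> \<le> card ({..<n} - L) * n + n * card ({..<n} - L) + n"
      by (intro order.trans[OF card_Un_le] add_mono) (auto simp: card_cartesian_product intro:
          order.trans[OF card_image_le])
    also have "\<dots> \<le> (r + 2 * t) * n + n * (r + 2 * t) + n"
      using L_card by (intro add_mono mult_mono) auto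
    finally show ?thesis by (simp add: algebra_simps)
  qed
  ultimately show ?thesis
    using q_ge_3 power_increasing[of "card S" "n * (2 * r + 4 * t + 1)" q] by linarith
qed

section \<open>Counting matrices by the order of a largest minor\<close>

definition minor_size :: "nat \<Rightarrow> nat \<Rightarrow> (nat \<times> nat \<Rightarrow> 'u) \<Rightarrow> nat" where
  "minor_size r n A = (SOME t. \<exists>I J C. pivot_minor r n A I J C \<and> card J = t \<and> 4 * t \<le> n - r \<and>
    (n - r < 4 * t + 4 \<or> closed_minor r n A I J C))"

lemma minor_size:
  assumes "A \<in> mats n"
  shows "\<exists>I J C. pivot_minor r n A I J C \<and> card J = minor_size r n A \<and> 4 * minor_size r n A \<le> n -
      r \<and>
    (n - r < 4 * minor_size r n A + 4 \<or> closed_minor r n A I J C)"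
proof -
  have "\<exists>t I J C. pivot_minor r n A I J C \<and> card J = t \<and> 4 * t \<le> n - r \<and>
      (n - r < 4 * t + 4 \<or> closed_minor r n A I J C)"
    using pivot_minor_exists[OF assms, of r] by metis
  then show ?thesis unfolding minor_size_def by (rule someI_ex)
qed

text \<open>A union bound over \<open>I\<close>, \<open>J\<close> and \<open>C\<close>: there are at
  most \<open>2^n <= q^n\<close> choices for each index set and \<open>q^(t t) <= q^(n t)\<close>
  for \<open>C\<close>, which adds \<open>t + 2\<close> to the factor \<open>2 r + 4 t + 1\<close>
  of \<open>n\<close> in the exponent. If the bound on \<open>t\<close> is attained, the number
  \<open>q^(n n)\<close> of all matrices is already small enough.\<close>

lemma card_minor_size:
  "card {A \<in> mats n. minor_size r n A = t} \<le> q ^ (n * (2 * r + 5 * t + 3))"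
proof (cases "n - r < 4 * t + 4 \<or> n < t")
  case True
  have "card {A \<in> mats n. minor_size r n A = t} \<le> card (mats n)" by (intro card_mono) auto
  also have "\<dots> = q ^ (n * n)" by (simp add: mats_def card_funcsetE card_cartesian_product q_def)
  also have "\<dots> \<le> q ^ (n * (2 * r + 5 * t + 3))"
    using True q_ge_3 by (intro power_increasing mult_left_mono) auto
  finally show ?thesis .
next
  case False
  let ?T = "{I. I \<subseteq> {r..<n} \<and> card I = t}"
  let ?X = "\<lambda>I J C. {A \<in> mats n. closed_minor r n A I J C}"
  let ?D = "SIGMA I:?T. SIGMA J:{J \<in> ?T. I \<inter> J = {}}. J \<times> I \<rightarrow>\<^sub>E K"
  have *: "{A \<in> mats n. minor_size r n A = t} \<subseteq> (\<Union>(I, J, C)\<in>?D. ?X I J C)"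
  proof
    fix A assume "A \<in> {A \<in> mats n. minor_size r n A = t}"
    then have A: "A \<in> mats n" "t = minor_size r n A" by auto
    from minor_size[OF A(1), of r] obtain I J C where IJC: "pivot_minor r n A I J C" "card J = t"
      "n - r < 4 * t + 4 \<or> closed_minor r n A I J C" unfolding A(2) by blast
    with False have "closed_minor r n A I J C" by simp
    with IJC A show "A \<in> (\<Union>(I, J, C)\<in>?D. ?X I J C)"
      by (auto simp: pivot_minor_def intro!: bexI[of _ "(I, J, C)"])
  qed
  have finT: "finite ?T" by (rule finite_subset[of _ "Pow {r..<n}"]) auto
  have cardT: "card ?T \<le> 2 ^ n"
  proof -
    have "card ?T \<le> card (Pow {r..<n})" by (intro card_mono) auto
    also have "\<dots> \<le> 2 ^ n" by (simp add: card_Pow power_increasing)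
    finally show ?thesis .
  qed
  have finD: "finite ?D"
    using finT by (intro finite_SigmaI finite_PiE) (auto dest: finite_subset)
  have cardD: "card ?D \<le> 2 ^ n * (2 ^ n * q ^ (n * t))"
  proof -
    have "card ?D = (\<Sum>I\<in>?T. card (SIGMA J:{J \<in> ?T. I \<inter> J = {}}. J \<times> I \<rightarrow>\<^sub>E K))"
      using finT by (intro card_SigmaI) (auto intro!: finite_SigmaI finite_PiE dest: finite_subset)
    also have "\<dots> \<le> (\<Sum>I\<in>?T. 2 ^ n * q ^ (n * t))"
    proof (intro sum_mono)
      fix I assume I: "I \<in> ?T"
      have "card (SIGMA J:{J \<in> ?T. I \<inter> J = {}}. J \<times> I \<rightarrow>\<^sub>E K) = (\<Sum>J\<in>{J \<in> ?T. I \<inter> J = {}}. card (J \<times>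
          I \<rightarrow>\<^sub>E K))"
        using finT I by (intro card_SigmaI) (auto intro!: finite_PiE dest: finite_subset)
      also have "\<dots> \<le> (\<Sum>J\<in>{J \<in> ?T. I \<inter> J = {}}. q ^ (n * t))"
      proof (intro sum_mono)
        fix J assume J: "J \<in> {J \<in> ?T. I \<inter> J = {}}"
        then have "card (J \<times> I \<rightarrow>\<^sub>E K) = q ^ (t * t)"
          using I by (subst card_funcsetE) (auto simp: q_def card_cartesian_product dest:
              finite_subset)
        also have "\<dots> \<le> q ^ (n * t)" using False q_ge_3 by (intro power_increasing mult_right_mono)
            auto
        finally show "card (J \<times> I \<rightarrow>\<^sub>E K) \<le> q ^ (n * t)" .
      qed
      also have "\<dots> = card {J \<in> ?T. I \<inter> J = {}} * q ^ (n * t)" by simp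
      also have "card {J \<in> ?T. I \<inter> J = {}} \<le> 2 ^ n"
        by (rule order.trans[OF card_mono[OF finT] cardT]) auto
      finally show "card (SIGMA J:{J \<in> ?T. I \<inter> J = {}}. J \<times> I \<rightarrow>\<^sub>E K) \<le> 2 ^ n * q ^ (n * t)"
        by simp
    qed
    also have "\<dots> = card ?T * (2 ^ n * q ^ (n * t))" by simp
    also have "\<dots> \<le> 2 ^ n * (2 ^ n * q ^ (n * t))" using cardT by (rule mult_right_mono) simp
    finally show ?thesis .
  qed
  from * finD have "card {A \<in> mats n. minor_size r n A = t} \<le> card (\<Union>(I, J, C)\<in>?D. ?X I J C)"
    by (intro card_mono) (auto intro!: finite_UN_I)
  also have "\<dots> \<le> (\<Sum>(I, J, C)\<in>?D. card (?X I J C))"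
    using card_UN_le[OF finD, of "\<lambda>(I, J, C). ?X I J C"] by (simp add: case_prod_unfold)
  also have "\<dots> \<le> (\<Sum>x\<in>?D. q ^ (n * (2 * r + 4 * t + 1)))"
  proof (intro sum_mono, clarify)
    fix I J C assume "I \<subseteq> {r..<n}" "t = card I" "J \<subseteq> {r..<n}" "card J = card I" "I \<inter> J = {}"
    then show "card (?X I J C) \<le> q ^ (n * (2 * r + 4 * card I + 1))"
      by (intro card_closed_minor) auto
  qed
  also have "\<dots> = card ?D * q ^ (n * (2 * r + 4 * t + 1))" by simp
  also have "\<dots> \<le> q ^ n * (q ^ n * q ^ (n * t)) * q ^ (n * (2 * r + 4 * t + 1))"
  proof (rule mult_right_mono)
    have "(2 :: nat) ^ n * (2 ^ n * q ^ (n * t)) \<le> q ^ n * (q ^ n * q ^ (n * t))"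
      using q_ge_3 by (intro mult_mono power_mono) auto
    with cardD show "card ?D \<le> q ^ n * (q ^ n * q ^ (n * t))" by (rule order.trans)
  qed simp
  also have "\<dots> = q ^ (n + (n + n * t) + n * (2 * r + 4 * t + 1))"
    by (simp only: power_add)
  also have "n + (n + n * t) + n * (2 * r + 4 * t + 1) = n * (2 * r + 5 * t + 3)"
    by (simp add: algebra_simps)
  finally show ?thesis .
qed

text \<open>The weight cancels the growth of the number of matrices with \<open>t\<close>, so each
  of the \<open>n + 1\<close> possible orders contributes at most the same power of
  \<open>q\<close>.\<close>

lemma sum_minor_size:
  "(\<Sum>A\<in>mats n. 1 / real q ^ (5 * n * minor_size r n A)) \<le> real (n + 1) * real q ^ (n * (2 * r + 3))"
proof -
  have q0: "real q > 0" using q_ge_3 by simp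
  have le: "minor_size r n A \<in> {..n}" if "A \<in> mats n" for A
    using minor_size[OF that, of r] by auto
  have "(\<Sum>A\<in>mats n. 1 / real q ^ (5 * n * minor_size r n A))
      = (\<Sum>t\<in>{..n}. \<Sum>A\<in>{A \<in> mats n. minor_size r n A = t}. 1 / real q ^ (5 * n * minor_size r n A))"
    using le by (intro sum.group[symmetric]) auto
  also have "\<dots> = (\<Sum>t\<in>{..n}. card {A \<in> mats n. minor_size r n A = t} * (1 / real q ^ (5 * n * t)))"
    by (intro sum.cong refl) simp
  also have "\<dots> \<le> (\<Sum>t\<in>{..n}. real q ^ (n * (2 * r + 3)))"
  proof (intro sum_mono)
    fix t
    have "real (card {A \<in> mats n. minor_size r n A = t}) \<le> real (q ^ (n * (2 * r + 5 * t + 3)))"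
      using card_minor_size by (rule of_nat_mono)
    also have "\<dots> = real q ^ (n * (2 * r + 3)) * real q ^ (5 * n * t)"
      unfolding of_nat_power power_add[symmetric] by (simp add: algebra_simps)
    finally show "card {A \<in> mats n. minor_size r n A = t} * (1 / real q ^ (5 * n * t)) \<le> real q ^
        (n * (2 * r + 3))"
      using q0 by (simp add: field_simps)
  qed
  finally show ?thesis by simp
qed

text \<open>The set \<open>{40..<n} - (I \<union> J)\<close> has \<open>n - 40 - 2 t\<close>
  elements, and this is at least \<open>n / 4\<close> because \<open>4 t <= n - 40\<close> and
  \<open>80 <= n\<close>. The factor 40 of the parameter \<open>r\<close> turns the quarter into
  \<open>10 n\<close>.\<close>

lemma card_adjoint_cubics_minor_size:
  assumes n: "80 \<le> n" and A: "A \<in> mats n"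
  shows "card {c \<in> cubics n. (A, D) \<in> adjoints n 40 c} * q ^ (10 * n * minor_size 40 n A) \<le> card
      (cubics n)"
proof -
  define t where "t = minor_size 40 n A"
  from minor_size[OF A, of 40] obtain I J C where
    IJC: "pivot_minor 40 n A I J C" "card J = t" "4 * t \<le> n - 40"
    unfolding t_def by blast
  then have "finite I" "finite J" "I \<union> J \<subseteq> {40..<n}" "I \<inter> J = {}" "card I = t"
    by (auto simp: pivot_minor_def dest: finite_subset)
  then have "card ({40..<n} - (I \<union> J)) = n - 40 - 2 * t"
    using IJC by (subst card_Diff_subset) (auto simp: card_Un_disjoint)
  moreover have "10 * n * t \<le> 40 * (t * (n - 40 - 2 * t))"
  proof -
    have "t * n \<le> t * (4 * (n - 40 - 2 * t))" using IJC n by (intro mult_left_mono) auto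
    then show ?thesis by (simp add: algebra_simps)
  qed
  ultimately have "q ^ (10 * n * t) \<le> q ^ (40 * (card J * card ({40..<n} - (I \<union> J))))"
    using q_ge_3 IJC by (intro power_increasing) auto
  then have "card {c \<in> cubics n. (A, D) \<in> adjoints n 40 c} * q ^ (10 * n * t)
     \<le> card {c \<in> cubics n. (A, D) \<in> adjoints n 40 c} * q ^ (40 * (card J * card ({40..<n} - (I \<union>
         J))))"
    by (rule mult_left_mono) simp
  also have "\<dots> \<le> card (cubics n)"
    using n by (intro card_adjoint_cubics[OF IJC(1) A]) auto
  finally show ?thesis by (simp add: t_def)
qed

text \<open>Double counting over forms and pairs. The larger of the two exponents available for a
  pair is at least their mean, and this mean is a sum of a term in \<open>A\<close> and a term in
  \<open>D\<close>, so the double sum splits into a product of two copies of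
  \<open>sum_minor_size\<close>. Here \<open>83 = 2 * 40 + 3\<close>, and the two factors
  \<open>n + 1 <= q^n\<close> raise \<open>2 * 83\<close> to 168.\<close>

lemma sum_card_adjoints:
  assumes n: "80 \<le> n"
  shows "(\<Sum>c\<in>cubics n. card (adjoints n 40 c)) \<le> card (cubics n) * q ^ (168 * n)"
proof -
  let ?s = "minor_size 40 n"
  let ?H = "\<lambda>A D. {c \<in> cubics n. (A, D) \<in> adjoints n 40 c}"
  have q0: "real q > 0" using q_ge_3 by simp
  have H: "real (card (?H A D)) \<le> card (cubics n) * (1 / real q ^ (5 * n * ?s A)) * (1 / real q ^
      (5 * n * ?s (mtransp D)))"
    if "A \<in> mats n" "D \<in> mats n" for A D
  proof -
    let ?a = "5 * n * ?s A" and ?b = "5 * n * ?s (mtransp D)"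
    have eq: "?H A D = ?H (mtransp D) (mtransp A)" using adjoints_transp by blast
    have "card (?H A D) * q ^ (10 * n * ?s A) \<le> card (cubics n)"
      by (rule card_adjoint_cubics_minor_size[OF n that(1)])
    moreover have "card (?H A D) * q ^ (10 * n * ?s (mtransp D)) \<le> card (cubics n)"
      unfolding eq by (rule card_adjoint_cubics_minor_size[OF n mtransp_mats[OF that(2)]])
    moreover have "?a + ?b \<le> 10 * n * ?s A \<or> ?a + ?b \<le> 10 * n * ?s (mtransp D)"
      by (cases "?a \<le> ?b") (auto simp: algebra_simps)
    then have "q ^ (?a + ?b) \<le> q ^ (10 * n * ?s A) \<or> q ^ (?a + ?b) \<le> q ^ (10 * n * ?s (mtransp D))"
      using q_ge_3 by (auto intro: power_increasing)
    ultimately have "card (?H A D) * q ^ (?a + ?b) \<le> card (cubics n)"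
      by (meson mult_left_mono order.trans zero_le)
    then have "real (card (?H A D) * q ^ (?a + ?b)) \<le> real (card (cubics n))" by (rule of_nat_mono)
    then show ?thesis using q0 by (simp add: field_simps power_add)
  qed
  have "(\<Sum>c\<in>cubics n. card (adjoints n 40 c)) = (\<Sum>c\<in>cubics n. \<Sum>AD\<in>mats n \<times> mats n. if AD \<in>
      adjoints n 40 c then 1 else 0)"
    by (intro sum.cong refl, subst sum.inter_filter[symmetric])
      (auto simp: adjoints_def intro!: arg_cong[where f = card])
  also have "\<dots> = (\<Sum>AD\<in>mats n \<times> mats n. card (?H (fst AD) (snd AD)))"
    by (subst sum.swap, intro sum.cong refl, subst sum.inter_filter[symmetric]) auto
  also have "\<dots> = (\<Sum>A\<in>mats n. \<Sum>D\<in>mats n. card (?H A D))"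
    by (simp add: sum.cartesian_product case_prod_unfold)
  finally have "real (\<Sum>c\<in>cubics n. card (adjoints n 40 c)) = (\<Sum>A\<in>mats n. \<Sum>D\<in>mats n. real (card (?H
      A D)))"
    by simp
  also have "\<dots> \<le> (\<Sum>A\<in>mats n. \<Sum>D\<in>mats n. card (cubics n) * (1 / real q ^ (5 * n * ?s A)) * (1 /
      real q ^ (5 * n * ?s (mtransp D))))"
    by (intro sum_mono H)
  also have "\<dots> = card (cubics n) * (\<Sum>A\<in>mats n. 1 / real q ^ (5 * n * ?s A)) * (\<Sum>D\<in>mats n. 1 / real
      q ^ (5 * n * ?s (mtransp D)))"
    unfolding sum_distrib_left sum_distrib_right by (rule sum.swap)
  also have "(\<Sum>D\<in>mats n. 1 / real q ^ (5 * n * ?s (mtransp D))) = (\<Sum>D\<in>mats n. 1 / real q ^ (5 * n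
      * ?s D))"
    by (intro sum.reindex_bij_witness[of _ mtransp mtransp]) (auto simp: mtransp_mats)
  also have "card (cubics n) * (\<Sum>A\<in>mats n. 1 / real q ^ (5 * n * ?s A)) * (\<Sum>D\<in>mats n. 1 / real q ^
      (5 * n * ?s D))
      \<le> card (cubics n) * (real (n + 1) * real q ^ (n * 83)) * (real (n + 1) * real q ^ (n * 83))"
    using sum_minor_size[of n 40] by (intro mult_mono mult_left_mono) (auto intro!: sum_nonneg
        mult_nonneg_nonneg)
  also have "\<dots> = real (card (cubics n) * ((n + 1) * q ^ (n * 83)) * ((n + 1) * q ^ (n * 83)))"
    by (simp only: of_nat_mult of_nat_power)
  finally have "(\<Sum>c\<in>cubics n. card (adjoints n 40 c)) \<le> card (cubics n) * ((n + 1) * q ^ (n * 83))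
      * ((n + 1) * q ^ (n * 83))"
    by linarith
  also have "\<dots> \<le> card (cubics n) * (q ^ n * q ^ (n * 83)) * (q ^ n * q ^ (n * 83))"
  proof -
    have "n + 1 \<le> 2 ^ n" by (metis Suc_eq_plus1 Suc_leI less_exp)
    also have "\<dots> \<le> q ^ n" using q_ge_3 by (intro power_mono) auto
    finally show ?thesis by (intro mult_mono mult_left_mono) auto
  qed
  also have "\<dots> = card (cubics n) * q ^ (168 * n)"
    unfolding mult.assoc power_add[symmetric] by (simp add: algebra_simps)
  finally show ?thesis .
qed

text \<open>Markov's inequality: the threshold exceeds the bound \<open>q^(168 n)\<close> on the
  mean by the factor \<open>q^n\<close>.\<close>

lemma card_many_adjoints:
  assumes "80 \<le> n"
  shows "card {c \<in> cubics n. card (adjoints n 40 c) > q ^ (169 * n)} * q ^ n \<le> card (cubics n)"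
proof -
  let ?B = "{c \<in> cubics n. card (adjoints n 40 c) > q ^ (169 * n)}"
  have "card ?B * q ^ (169 * n) = (\<Sum>c\<in>?B. q ^ (169 * n))" by simp
  also have "\<dots> \<le> (\<Sum>c\<in>?B. card (adjoints n 40 c))" by (intro sum_mono) auto
  also have "\<dots> \<le> (\<Sum>c\<in>cubics n. card (adjoints n 40 c))" by (intro sum_mono2) auto
  also have "\<dots> \<le> card (cubics n) * q ^ (168 * n)" by (rule sum_card_adjoints[OF assms])
  finally have "card ?B * q ^ n * q ^ (168 * n) \<le> card (cubics n) * q ^ (168 * n)"
    by (simp add: mult.assoc flip: power_add)
  then show ?thesis using q_ge_3 by simp
qed

end

section \<open>The program and its running time\<close>

text \<open>A precondition for total correctness: the existential quantifier asserts termination,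
  and evaluation is deterministic, so the result found is the only one.\<close>

definition wp :: "program \<Rightarrow> val list \<Rightarrow> expr \<Rightarrow> (val \<Rightarrow> nat \<Rightarrow> bool) \<Rightarrow> bool" where
  "wp P xs ex Q \<longleftrightarrow> (\<exists>v k. evaluates P xs ex v k \<and> Q v k)"

definition wp_list :: "program \<Rightarrow> val list \<Rightarrow> expr list \<Rightarrow> (val list \<Rightarrow> nat \<Rightarrow> bool) \<Rightarrow> bool" where
  "wp_list P xs es Q \<longleftrightarrow> (\<exists>vs k. evaluates_list P xs es vs k \<and> Q vs k)"

definition wp_call :: "program \<Rightarrow> nat \<Rightarrow> val list \<Rightarrow> (val \<Rightarrow> nat \<Rightarrow> bool) \<Rightarrow> bool" where
  "wp_call P i xs Q \<longleftrightarrow> i < length P \<and> wp P xs (P ! i) Q"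

text \<open>As rewrite rules these execute a body symbolically and accumulate its cost. Rewriting
  stops at \<open>wp_call\<close>, where \<open>wp_callI\<close> inserts the specification of the
  called function or, for a recursive call, the induction hypothesis.\<close>

lemma wp_simps [simp]:
  "wp P xs (Var i) Q \<longleftrightarrow> i < length xs \<and> Q (xs ! i) 1"
  "wp P xs Empty Q \<longleftrightarrow> Q NIL 1"
  "wp P xs (Pair a b) Q \<longleftrightarrow> wp P xs a (\<lambda>v k. wp P xs b (\<lambda>w l. Q (CONS v w) (1 + k + l)))"
  "wp P xs (Hd a) Q \<longleftrightarrow> wp P xs a (\<lambda>v k. Q (hd_val v) (1 + k))"
  "wp P xs (Tl a) Q \<longleftrightarrow> wp P xs a (\<lambda>v k. Q (tl_val v) (1 + k))"
  "wp P xs (Cond c a b) Q \<longleftrightarrow> wp P xs c (\<lambda>v k. if v = NIL then wp P xs b (\<lambda>w l. Q w (1 + k + l))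
     else wp P xs a (\<lambda>w l. Q w (1 + k + l)))"
  "wp P xs (Call i es) Q \<longleftrightarrow> wp_list P xs es (\<lambda>vs k. wp_call P i vs (\<lambda>v l. Q v (1 + k + l)))"
  "wp_list P xs [] R \<longleftrightarrow> R [] 0"
  "wp_list P xs (a # es) R \<longleftrightarrow> wp P xs a (\<lambda>v k. wp_list P xs es (\<lambda>vs l. R (v # vs) (k + l)))"
  unfolding wp_def wp_list_def wp_call_def
  by (fastforce intro: evaluates_evaluates_list.intros
      elim: evaluates_VarE evaluates_EmptyE evaluates_PairE evaluates_HdE evaluates_TlE
          evaluates_CondE
        evaluates_CallE evaluates_NilE evaluates_ConsE split: if_splits)+

fun unary :: "nat \<Rightarrow> expr" where
  "unary 0 = Empty"
| "unary (Suc k) = Pair Empty (unary k)"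

abbreviation (input) "fn_main \<equiv> 0 :: nat"
abbreviation (input) "fn_elems \<equiv> 1 :: nat"
abbreviation (input) "fn_eq \<equiv> 2 :: nat"
abbreviation (input) "fn_find \<equiv> 3 :: nat"
abbreviation (input) "fn_scale \<equiv> 4 :: nat"
abbreviation (input) "fn_vadd \<equiv> 5 :: nat"
abbreviation (input) "fn_dot \<equiv> 6 :: nat"
abbreviation (input) "fn_app \<equiv> 7 :: nat"
abbreviation (input) "fn_duo \<equiv> 8 :: nat"
abbreviation (input) "fn_tri \<equiv> 9 :: nat"
abbreviation (input) "fn_feval \<equiv> 10 :: nat"
abbreviation (input) "fn_polar \<equiv> 11 :: nat"
abbreviation (input) "fn_trow \<equiv> 12 :: nat"
abbreviation (input) "fn_kron \<equiv> 13 :: nat"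
abbreviation (input) "fn_eqk \<equiv> 14 :: nat"
abbreviation (input) "fn_eqj \<equiv> 15 :: nat"
abbreviation (input) "fn_eqi \<equiv> 16 :: nat"
abbreviation (input) "fn_elim \<equiv> 17 :: nat"
abbreviation (input) "fn_step \<equiv> 18 :: nat"
abbreviation (input) "fn_kern \<equiv> 19 :: nat"
abbreviation (input) "fn_zeros \<equiv> 20 :: nat"
abbreviation (input) "fn_mapc \<equiv> 21 :: nat"
abbreviation (input) "fn_units \<equiv> 22 :: nat"
abbreviation (input) "fn_extl \<equiv> 23 :: nat"
abbreviation (input) "fn_ext \<equiv> 24 :: nat"
abbreviation (input) "fn_pw \<equiv> 25 :: nat"
abbreviation (input) "fn_rep \<equiv> 26 :: nat"
abbreviation (input) "fn_linc \<equiv> 27 :: nat"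
abbreviation (input) "fn_drop \<equiv> 28 :: nat"
abbreviation (input) "fn_apply \<equiv> 29 :: nat"
abbreviation (input) "fn_chk \<equiv> 30 :: nat"
abbreviation (input) "fn_check \<equiv> 31 :: nat"
abbreviation (input) "fn_cands \<equiv> 32 :: nat"
abbreviation (input) "fn_tryt \<equiv> 33 :: nat"
abbreviation (input) "fn_tups \<equiv> 34 :: nat"
abbreviation (input) "fn_nth \<equiv> 35 :: nat"
abbreviation (input) "fn_main1 \<equiv> 36 :: nat"
abbreviation (input) "fn_main2 \<equiv> 37 :: nat"
abbreviation (input) "fn_main3 \<equiv> 38 :: nat"

text \<open>Most functions receive as argument \<open>0\<close> the list of the field elements, the two tables and
  the names of zero and one.\<close>

abbreviation (input) "elements E \<equiv> Hd E"
abbreviation (input) "add_table E \<equiv> Hd (Tl E)"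
abbreviation (input) "mult_table E \<equiv> Hd (Tl (Tl E))"
abbreviation (input) "zero_name E \<equiv> Hd (Tl (Tl (Tl E)))"
abbreviation (input) "one_name E \<equiv> Hd (Tl (Tl (Tl (Tl E))))"
abbreviation (input) "field_add E a b \<equiv> Call fn_nth [Call fn_nth [add_table E, a], b]"
abbreviation (input) "field_mult E a b \<equiv> Call fn_nth [Call fn_nth [mult_table E, a], b]"
abbreviation (input) "field_neg E a \<equiv> Call fn_find [elements E, add_table E, a, zero_name E]"

section \<open>Source code of the isomorphism test\<close>

definition body_main :: expr where
  "body_main =
    Call fn_main1 [Var 0, Call fn_elems [Var 1], Var 2, Var 3, Var 4, Var 5]"

definition body_elems :: expr where
  "body_elems =
    Cond (Var 0) (Pair (Tl (Var 0)) (Call fn_elems [Tl (Var 0)])) Empty"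

definition body_eq :: expr where
  "body_eq =
    Cond (Var 0)
      (Cond (Var 1)
        (Cond (Call fn_eq [Hd (Var 0), Hd (Var 1)]) (Call fn_eq [Tl (Var 0), Tl (Var 1)]) Empty)
        Empty)
      (Cond (Var 1) Empty (Pair Empty Empty))"

text \<open>Exhaustive search for a solution of an equation in an operation table. Since the input
  does not say which elements are zero and one, these too are found in this way, as are
  negatives.\<close>

definition body_find :: expr where
  "body_find =
    Cond (Var 0)
      (Cond
        (Call fn_eq [Call fn_nth [Call fn_nth [Var 1, Hd (Var 0)], Var 2], Var 3])
        (Hd (Var 0))
        (Call fn_find [Tl (Var 0), Var 1, Var 2, Var 3]))
      Empty"

definition body_scale :: expr where
  "body_scale =
    Cond (Var 2)
      (Pair
        (field_mult (Var 0) (Var 1) (Hd (Var 2)))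
        (Call fn_scale [Var 0, Var 1, Tl (Var 2)]))
      Empty"

definition body_vadd :: expr where
  "body_vadd =
    Cond (Var 1)
      (Cond (Var 2)
        (Pair
          (field_add (Var 0) (Hd (Var 1)) (Hd (Var 2)))
          (Call fn_vadd [Var 0, Tl (Var 1), Tl (Var 2)]))
        Empty)
      Empty"

definition body_dot :: expr where
  "body_dot =
    Cond (Var 1)
      (Cond (Var 2)
        (field_add (Var 0)
          (field_mult (Var 0) (Hd (Var 1)) (Hd (Var 2)))
          (Call fn_dot [Var 0, Tl (Var 1), Tl (Var 2)]))
        (zero_name (Var 0)))
      (zero_name (Var 0))"

definition body_app :: expr where
  "body_app =
    Cond (Var 0) (Pair (Hd (Var 0)) (Call fn_app [Tl (Var 0), Var 1])) (Var 1)"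

definition body_duo :: expr where
  "body_duo =
    Cond (Var 1)
      (Call fn_app [Call fn_scale [Var 0, Hd (Var 1), Var 1], Call fn_duo [Var 0, Tl (Var 1)]])
      Empty"

definition body_tri :: expr where
  "body_tri =
    Cond (Var 1)
      (Call fn_app [Call fn_scale [Var 0, Hd (Var 1), Call fn_duo [Var 0, Var 1]],
        Call fn_tri [Var 0, Tl (Var 1)]])
      Empty"

definition body_feval :: expr where
  "body_feval =
    Call fn_dot [Var 0, Var 1, Call fn_tri [Var 0, Var 2]]"

text \<open>Inclusion and exclusion over the sums of the three arguments, so that the polarisation
  is obtained from values of the form alone.\<close>

definition body_polar :: expr where
  "body_polar =
    field_add (Var 0)
      (field_add (Var 0)
        (field_add (Var 0)
          (Call fn_feval [Var 0, Var 1,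
            Call fn_vadd [Var 0, Call fn_vadd [Var 0, Var 2, Var 3], Var 4]])
          (Call fn_feval [Var 0, Var 1, Var 2]))
        (field_add (Var 0)
          (Call fn_feval [Var 0, Var 1, Var 3])
          (Call fn_feval [Var 0, Var 1, Var 4])))
      (field_neg (Var 0)
        (field_add (Var 0)
          (field_add (Var 0)
            (Call fn_feval [Var 0, Var 1, Call fn_vadd [Var 0, Var 2, Var 3]])
            (Call fn_feval [Var 0, Var 1, Call fn_vadd [Var 0, Var 2, Var 4]]))
          (Call fn_feval [Var 0, Var 1, Call fn_vadd [Var 0, Var 3, Var 4]])))"

definition body_trow :: expr where
  "body_trow =
    Cond (Var 4)
      (Pair
        (Call fn_polar [Var 0, Var 1, Var 2, Var 3, Hd (Var 4)])
        (Call fn_trow [Var 0, Var 1, Var 2, Var 3, Tl (Var 4)]))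
      Empty"

definition body_kron :: expr where
  "body_kron =
    Cond (Var 1)
      (Call fn_app [Call fn_scale [Var 0, Hd (Var 1), Var 2],
        Call fn_kron [Var 0, Tl (Var 1), Var 2]])
      Empty"

text \<open>The linear system has one equation for each vector \<open>w\<close> and each pair of unit vectors \<open>ej\<close>,
  \<open>ek\<close>; the functions \<open>eqi\<close>, \<open>eqj\<close> and \<open>eqk\<close> loop over these in turn.\<close>

definition body_eqk :: expr where
  "body_eqk =
    Cond (Var 5)
      (Pair
        (Call fn_app [Call fn_kron [Var 0, Hd (Var 5), Var 4],
          Call fn_kron [Var 0, Var 3, Call fn_trow [Var 0, Var 1, Var 2, Hd (Var 5), Var 6]]])
        (Call fn_eqk [Var 0, Var 1, Var 2, Var 3, Var 4, Tl (Var 5), Var 6]))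
      Empty"

definition body_eqj :: expr where
  "body_eqj =
    Cond (Var 5)
      (Call fn_app [
        Call fn_eqk [Var 0, Var 1, Var 3, Hd (Var 5),
          Call fn_trow [Var 0, Var 2, Var 4, Hd (Var 5), Var 6], Var 6, Var 6],
        Call fn_eqj [Var 0, Var 1, Var 2, Var 3, Var 4, Tl (Var 5), Var 6]])
      Empty"

definition body_eqi :: expr where
  "body_eqi =
    Cond (Var 3)
      (Cond (Var 4)
        (Call fn_app [Call fn_eqj [Var 0, Var 1, Var 2, Hd (Var 3), Hd (Var 4), Var 5, Var 5],
          Call fn_eqi [Var 0, Var 1, Var 2, Tl (Var 3), Tl (Var 4), Var 5]])
        Empty)
      Empty"

text \<open>Cross-multiplied elimination: a vector is scaled by the pivot value before a multiple of
  the pivot vector is subtracted, which avoids inverses in the field.\<close>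

definition body_elim :: expr where
  "body_elim =
    Cond (Var 4)
      (Pair
        (Call fn_vadd [Var 0, Call fn_scale [Var 0, Var 3, Hd (Var 4)],
          Call fn_scale [Var 0, field_neg (Var 0) (Call fn_dot [Var 0, Var 1, Hd (Var 4)]),
            Var 2]])
        (Call fn_elim [Var 0, Var 1, Var 2, Var 3, Tl (Var 4)]))
      Empty"

text \<open>Cuts the span of a list down to the kernel of one linear form. Vectors are kept up to
  the first one outside the kernel; this one serves as pivot for the rest and is dropped.\<close>

definition body_step :: expr where
  "body_step =
    Cond (Var 2)
      (Cond
        (Call fn_eq [Call fn_dot [Var 0, Var 1, Hd (Var 2)], zero_name (Var 0)])
        (Pair (Hd (Var 2)) (Call fn_step [Var 0, Var 1, Tl (Var 2)]))
        (Call fn_elim [Var 0, Var 1, Hd (Var 2), Call fn_dot [Var 0, Var 1, Hd (Var 2)],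
          Tl (Var 2)]))
      Empty"

definition body_kern :: expr where
  "body_kern =
    Cond (Var 1)
      (Call fn_kern [Var 0, Tl (Var 1), Call fn_step [Var 0, Hd (Var 1), Var 2]])
      (Var 2)"

definition body_zeros :: expr where
  "body_zeros =
    Cond (Var 1) (Pair (zero_name (Var 0)) (Call fn_zeros [Var 0, Tl (Var 1)])) Empty"

definition body_mapc :: expr where
  "body_mapc =
    Cond (Var 1) (Pair (Pair (Var 0) (Hd (Var 1))) (Call fn_mapc [Var 0, Tl (Var 1)])) Empty"

definition body_units :: expr where
  "body_units =
    Cond (Var 1)
      (Pair
        (Pair (one_name (Var 0)) (Call fn_zeros [Var 0, Tl (Var 1)]))
        (Call fn_mapc [zero_name (Var 0), Call fn_units [Var 0, Tl (Var 1)]]))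
      Empty"

definition body_extl :: expr where
  "body_extl =
    Cond (Var 0) (Pair (Pair (Hd (Var 0)) (Var 1)) (Call fn_extl [Tl (Var 0), Var 1])) Empty"

definition body_ext :: expr where
  "body_ext =
    Cond (Var 1)
      (Call fn_app [Call fn_extl [Var 0, Hd (Var 1)], Call fn_ext [Var 0, Tl (Var 1)]])
      Empty"

definition body_pw :: expr where
  "body_pw =
    Cond (Var 0) (Call fn_ext [Var 1, Call fn_pw [Tl (Var 0), Var 1]]) (Pair Empty Empty)"

definition body_rep :: expr where
  "body_rep =
    Cond (Var 0) (Call fn_app [Var 1, Call fn_rep [Tl (Var 0), Var 1]]) Empty"

definition body_linc :: expr where
  "body_linc =
    Cond (Var 1)
      (Cond (Var 2)
        (Call fn_linc [Var 0, Tl (Var 1), Tl (Var 2),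
          Call fn_vadd [Var 0, Var 3, Call fn_scale [Var 0, Hd (Var 1), Hd (Var 2)]]])
        (Var 3))
      (Var 3)"

definition body_drop :: expr where
  "body_drop =
    Cond (Var 0) (Call fn_drop [Tl (Var 0), Tl (Var 1)]) (Var 1)"

text \<open>The product of the matrix with columns stored consecutively in \<open>u\<close> and a vector; \<open>vadd\<close>
  truncates to the length of the accumulator, so that the columns need not be cut out.\<close>

definition body_apply :: expr where
  "body_apply =
    Cond (Var 1)
      (Call fn_apply [Var 0, Tl (Var 1), Call fn_drop [Var 3, Var 2],
        Call fn_vadd [Var 0, Var 3, Call fn_scale [Var 0, Hd (Var 1), Var 2]]])
      (Var 3)"

text \<open>Besides the equality of values, the matrix is required to send no nonzero vector to
  zero. Over all points this amounts to invertibility and replaces a determinant.\<close>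

definition body_chk :: expr where
  "body_chk =
    Cond
      (Call fn_eq [Call fn_feval [Var 0, Var 1, Var 3], Call fn_feval [Var 0, Var 2, Var 4]])
      (Cond (Call fn_eq [Var 4, Var 5]) (Call fn_eq [Var 3, Var 5]) (Pair Empty Empty))
      Empty"

definition body_check :: expr where
  "body_check =
    Cond (Var 4)
      (Cond
        (Call fn_chk [Var 0, Var 1, Var 2, Hd (Var 4),
          Call fn_apply [Var 0, Hd (Var 4), Var 3, Var 5], Var 5])
        (Call fn_check [Var 0, Var 1, Var 2, Var 3, Tl (Var 4), Var 5])
        Empty)
      (Pair Empty Empty)"

definition body_cands :: expr where
  "body_cands =
    Cond (Var 5)
      (Cond
        (Call fn_check [Var 0, Var 1, Var 2, Call fn_linc [Var 0, Hd (Var 5), Var 6, Var 7],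
          Var 3, Var 4])
        (Pair Empty Empty)
        (Call fn_cands [Var 0, Var 1, Var 2, Var 3, Var 4, Tl (Var 5), Var 6, Var 7]))
      Empty"

definition body_tryt :: expr where
  "body_tryt =
    Call fn_cands [Var 0, Var 1, Var 2, Var 3, Var 5, Var 4,
      Call fn_kern [Var 0, Var 6, Call fn_units [Var 0, Hd (Var 6)]],
      Call fn_zeros [Var 0, Hd (Var 6)]]"

definition body_tups :: expr where
  "body_tups =
    Cond (Var 7)
      (Cond
        (Call fn_tryt [Var 0, Var 1, Var 2, Var 4, Var 5, Var 6,
          Call fn_eqi [Var 0, Var 1, Var 2, Var 3, Hd (Var 7), Var 3]])
        (Pair Empty Empty)
        (Call fn_tups [Var 0, Var 1, Var 2, Var 3, Var 4, Var 5, Var 6, Tl (Var 7)]))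
      Empty"

definition body_nth :: expr where
  "body_nth =
    Cond (Var 1) (Call fn_nth [Tl (Var 0), Tl (Var 1)]) (Hd (Var 0))"

text \<open>With \<open>x\<close> the element named 0, the zero of the field is the solution of
  \<open>s + x = x\<close>.\<close>

definition body_main1 :: expr where
  "body_main1 =
    Call fn_main2 [Var 0, Var 1, Var 2, Var 3, Var 4, Var 5,
      Call fn_find [Var 1, Var 2, Empty, Empty]]"

text \<open>The one of the field is the solution of \<open>s * x = x\<close> for a nonzero
  \<open>x\<close>. The element named 0 serves as \<open>x\<close> unless it is zero; then the
  element named 1 does.\<close>

definition body_main2 :: expr where
  "body_main2 =
    Call fn_main3 [
      Pair (Var 1)
        (Pair (Var 2)
          (Pair (Var 3)
            (Pair (Var 6)
              (Pair
                (Call fn_find [Var 1, Var 3, Cond (Var 6) Empty (Pair Empty Empty),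
                  Cond (Var 6) Empty (Pair Empty Empty)])
                Empty)))), Var 0, Var 4, Var 5]"

text \<open>All points, all coefficient vectors of length \<open>169 n\<close> and all 40-tuples of
  points are listed before the search begins; the lengths of these lists are the exponential
  quantities below the bound \<open>M\<close> of the analysis.\<close>

definition body_main3 :: expr where
  "body_main3 =
    Call fn_tups [Var 0, Var 2, Var 3, Call fn_units [Var 0, Var 1],
      Call fn_pw [Var 1, elements (Var 0)],
      Call fn_pw [Call fn_rep [unary 169, Var 1], elements (Var 0)],
      Call fn_zeros [Var 0, Var 1],
      Call fn_pw [unary 40, Call fn_pw [Var 1, elements (Var 0)]]]"

definition iso_program :: program where
  "iso_program =
   [body_main, body_elems, body_eq, body_find, body_scale, body_vadd, body_dot, body_app,
    body_duo, body_tri, body_feval, body_polar, body_trow, body_kron, body_eqk, body_eqj,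
    body_eqi, body_elim, body_step, body_kern, body_zeros, body_mapc, body_units, body_extl,
    body_ext, body_pw, body_rep, body_linc, body_drop, body_apply, body_chk, body_check,
    body_cands, body_tryt, body_tups, body_nth, body_main1, body_main2, body_main3]"

lemma length_iso_program: "length iso_program = 39"
  by (simp add: iso_program_def)

lemma nth_iso_program:
  "iso_program ! fn_main = body_main"
  "iso_program ! fn_elems = body_elems"
  "iso_program ! fn_eq = body_eq"
  "iso_program ! fn_find = body_find"
  "iso_program ! fn_scale = body_scale"
  "iso_program ! fn_vadd = body_vadd"
  "iso_program ! fn_dot = body_dot"
  "iso_program ! fn_app = body_app"
  "iso_program ! fn_duo = body_duo"
  "iso_program ! fn_tri = body_tri"
  "iso_program ! fn_feval = body_feval"
  "iso_program ! fn_polar = body_polar"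
  "iso_program ! fn_trow = body_trow"
  "iso_program ! fn_kron = body_kron"
  "iso_program ! fn_eqk = body_eqk"
  "iso_program ! fn_eqj = body_eqj"
  "iso_program ! fn_eqi = body_eqi"
  "iso_program ! fn_elim = body_elim"
  "iso_program ! fn_step = body_step"
  "iso_program ! fn_kern = body_kern"
  "iso_program ! fn_zeros = body_zeros"
  "iso_program ! fn_mapc = body_mapc"
  "iso_program ! fn_units = body_units"
  "iso_program ! fn_extl = body_extl"
  "iso_program ! fn_ext = body_ext"
  "iso_program ! fn_pw = body_pw"
  "iso_program ! fn_rep = body_rep"
  "iso_program ! fn_linc = body_linc"
  "iso_program ! fn_drop = body_drop"
  "iso_program ! fn_apply = body_apply"
  "iso_program ! fn_chk = body_chk"
  "iso_program ! fn_check = body_check"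
  "iso_program ! fn_cands = body_cands"
  "iso_program ! fn_tryt = body_tryt"
  "iso_program ! fn_tups = body_tups"
  "iso_program ! fn_nth = body_nth"
  "iso_program ! fn_main1 = body_main1"
  "iso_program ! fn_main2 = body_main2"
  "iso_program ! fn_main3 = body_main3"
  by (simp_all add: iso_program_def)

section \<open>Specifications with cost bounds: functions on plain data\<close>

definition computes :: "nat \<Rightarrow> val list \<Rightarrow> val \<Rightarrow> nat \<Rightarrow> bool" where
  "computes i vs v T \<longleftrightarrow> wp_call iso_program i vs (\<lambda>w k. w = v \<and> k \<le> T)"

lemma wp_callI: "computes i vs v T \<Longrightarrow> (\<And>k. k \<le> T \<Longrightarrow> Q v k) \<Longrightarrow> wp_call iso_program i vs Q"
  unfolding computes_def wp_call_def wp_def by blast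

lemma computesI:
  "wp iso_program vs (iso_program ! i) (\<lambda>w k. w = v \<and> k \<le> T) \<Longrightarrow> i < 39 \<Longrightarrow> computes i vs v T"
  by (simp add: computes_def wp_call_def length_iso_program)

lemma computes_mono: "computes i vs v T \<Longrightarrow> T \<le> T' \<Longrightarrow> computes i vs v T'"
  unfolding computes_def wp_call_def wp_def by (blast intro: order.trans)

definition encl :: "('a \<Rightarrow> val) \<Rightarrow> 'a list \<Rightarrow> val" where
  "encl c xs = enc_list (map c xs)"

lemma encl_simps [simp]: "encl c [] = NIL" "encl c (x # xs) = CONS (c x) (encl c xs)"
  by (simp_all add: encl_def)

lemma encl_eq_NIL [simp]: "encl c xs = NIL \<longleftrightarrow> xs = []"
  by (cases xs) simp_all

lemma enc_nat_eq_NIL [simp]: "enc_nat k = NIL \<longleftrightarrow> k = 0"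
  by (cases k) simp_all

lemma enc_nat_inject [simp]: "enc_nat a = enc_nat b \<longleftrightarrow> a = b"
proof (induction a arbitrary: b)
  case (Suc a) then show ?case by (cases b) simp_all
qed (metis enc_nat_eq_NIL enc_nat.simps(1))

lemma encl_inject: "inj_on c (set xs \<union> set ys) \<Longrightarrow> encl c xs = encl c ys \<longleftrightarrow> xs = ys"
proof (induction xs arbitrary: ys)
  case (Cons x xs)
  show ?case
  proof (cases ys)
    case (Cons y ys')
    then show ?thesis using Cons.IH[of ys'] Cons.prems by (auto simp: inj_on_def)
  qed simp
qed (metis encl_simps(1) encl_eq_NIL)

lemma enc_nat_encl: "enc_nat k = encl (\<lambda>_. NIL) (replicate k ())"
  by (induction k) simp_all

lemma tl_enc_nat [simp]: "tl_val (enc_nat k) = enc_nat (k - 1)"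
  by (cases k) simp_all

fun vsize :: "val \<Rightarrow> nat" where
  "vsize NIL = 1"
| "vsize (CONS v w) = 1 + vsize v + vsize w"

lemma vsize_enc_nat [simp]: "vsize (enc_nat k) = 2 * k + 1"
  by (induction k) simp_all

lemma vsize_encl: "(\<And>x. x \<in> set xs \<Longrightarrow> vsize (c x) \<le> B) \<Longrightarrow> vsize (encl c xs) \<le> 1 + length xs * (B + 1)"
  by (induction xs) force+

lemma computes_nth: "i < length vs \<Longrightarrow> computes fn_nth [enc_list vs, enc_nat i] (vs ! i) (10 * (i +
    1))"
proof (induction vs arbitrary: i)
  case (Cons v vs)
  show ?case
  proof (cases i)
    case 0
    then show ?thesis by (intro computesI) (simp_all add: nth_iso_program body_nth_def)
  next
    case (Suc j)
    show ?thesis using Cons.prems unfolding Suc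
      by (intro computesI) (auto simp: nth_iso_program body_nth_def intro!: wp_callI[OF Cons.IH[of
          j]])
  qed
qed simp

definition tt :: "bool \<Rightarrow> val" where
  "tt b = (if b then CONS NIL NIL else NIL)"

lemma tt_simps [simp]: "tt b = NIL \<longleftrightarrow> \<not> b" "tt True = CONS NIL NIL" "tt False = NIL"
  by (auto simp: tt_def)

text \<open>Both trees are descended at once, so the cost is bounded by the size of the first one,
  whatever the second one is.\<close>

lemma computes_eq: "computes fn_eq [v, w] (tt (v = w)) (20 * vsize v)"
proof (induction v arbitrary: w)
  case NIL
  show ?case by (cases w; intro computesI) (simp_all add: nth_iso_program body_eq_def)
next
  case (CONS v1 v2)
  show ?case
    by (cases w; intro computesI) (auto simp: nth_iso_program body_eq_def
        intro!: wp_callI[OF CONS.IH(1)] wp_callI[OF CONS.IH(2)])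
qed

lemma computes_app: "computes fn_app [encl c xs, encl c ys] (encl c (xs @ ys)) (20 * (length xs +
    1))"
proof (induction xs)
  case (Cons x xs)
  show ?case
    by (intro computesI) (auto simp: nth_iso_program body_app_def intro!: wp_callI[OF Cons.IH])
qed (intro computesI; simp add: nth_iso_program body_app_def)

section \<open>The computation on lists of ring elements\<close>

definition vaddL :: "'u :: comm_ring_1 list \<Rightarrow> 'u list \<Rightarrow> 'u list" where
  "vaddL u v = map2 (+) u v"

definition scaleL :: "'u :: comm_ring_1 \<Rightarrow> 'u list \<Rightarrow> 'u list" where
  "scaleL c v = map ((*) c) v"

definition dotL :: "'u :: comm_ring_1 list \<Rightarrow> 'u list \<Rightarrow> 'u" where
  "dotL u v = sum_list (map2 (*) u v)"

lemma listops_simps [simp]: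
  "vaddL [] v = []" "vaddL u [] = []" "vaddL (a # u) (b # v) = (a + b) # vaddL u v"
  "scaleL c [] = []" "scaleL c (a # u) = c * a # scaleL c u"
  "dotL [] v = 0" "dotL u [] = 0" "dotL (a # u) (b # v) = a * b + dotL u v"
  "length (vaddL u v) = min (length u) (length v)" "length (scaleL c v) = length v"
  by (simp_all add: vaddL_def scaleL_def dotL_def)

fun duoL :: "'u :: comm_ring_1 list \<Rightarrow> 'u list" where
  "duoL [] = []"
| "duoL (y # ys) = scaleL y (y # ys) @ duoL ys"

fun triL :: "'u :: comm_ring_1 list \<Rightarrow> 'u list" where
  "triL [] = []"
| "triL (x # xs) = scaleL x (duoL (x # xs)) @ triL xs"

lemma length_duoL: "length (duoL v) \<le> length v * length v"
  by (induction v) auto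

definition evalL :: "'u :: comm_ring_1 list \<Rightarrow> 'u list \<Rightarrow> 'u" where
  "evalL h x = dotL h (triL x)"

definition polarL :: "'u :: comm_ring_1 list \<Rightarrow> 'u list \<Rightarrow> 'u list \<Rightarrow> 'u list \<Rightarrow> 'u" where
  "polarL h x y z = evalL h (vaddL (vaddL x y) z) + evalL h x + (evalL h y + evalL h z)
     + - (evalL h (vaddL x y) + evalL h (vaddL x z) + evalL h (vaddL y z))"

definition kronL :: "'u :: comm_ring_1 list \<Rightarrow> 'u list \<Rightarrow> 'u list" where
  "kronL u v = concat (map (\<lambda>a. scaleL a v) u)"

lemma length_kronL [simp]: "length (kronL u v) = length u * length v"
  by (induction u) (auto simp: kronL_def)

text \<open>Rows of the linear system. \<open>kronL\<close> of a unit vector and a list places the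
  list in the block selected by the unit vector: the first half of a row addresses the unknown
  vector \<open>a_k\<close>, the second half the unknown vector \<open>b_j\<close>.\<close>

definition eqkL where
  "eqkL f x ej crow Ks Es = map (\<lambda>ek. kronL ek crow @ kronL ej (map (polarL f x ek) Es)) Ks"

definition eqjL where
  "eqjL f g x w Js Es = concat (map (\<lambda>ej. eqkL f x ej (map (polarL g w ej) Es) Es Es) Js)"

definition eqiL where
  "eqiL f g xs ws Es = concat (map (\<lambda>(x, w). eqjL f g x w Es Es) (zip xs ws))"

definition elimL :: "'u :: comm_ring_1 list \<Rightarrow> 'u list \<Rightarrow> 'u \<Rightarrow> 'u list list \<Rightarrow> 'u list list" where
  "elimL l p s cs = map (\<lambda>c. vaddL (scaleL s c) (scaleL (- dotL l c) p)) cs"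

definition unitsL :: "'u :: comm_ring_1 \<Rightarrow> nat \<Rightarrow> 'u list list" where
  "unitsL a k = map (\<lambda>i. map (\<lambda>j. if j = i then a else 0) [0..<k]) [0..<k]"

lemma unitsL_0 [simp]: "unitsL a 0 = []"
  by (simp add: unitsL_def)

lemma unitsL_Suc: "unitsL a (Suc k) = (a # replicate k 0) # map ((#) 0) (unitsL a k)"
  unfolding unitsL_def
  by (simp add: upt_conv_Cons map_Suc_upt[symmetric] map_replicate_const comp_def del: upt_Suc)

fun lincombL :: "'u :: comm_ring_1 list \<Rightarrow> 'u list list \<Rightarrow> 'u list \<Rightarrow> 'u list" where
  "lincombL (c # cs) (b # bs) acc = lincombL cs bs (vaddL acc (scaleL c b))"
| "lincombL _ _ acc = acc"

fun applyL :: "'u :: comm_ring_1 list \<Rightarrow> 'u list \<Rightarrow> 'u list \<Rightarrow> 'u list" where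
  "applyL [] u acc = acc"
| "applyL (x # xs) u acc = applyL xs (drop (length acc) u) (vaddL acc (scaleL x u))"

text \<open>The zero test is a parameter because the program compares names, that is, projections to
  \<open>R\<close>. On the embedded field this agrees with equality to zero in the product
  ring.\<close>

fun stepL :: "('u \<Rightarrow> bool) \<Rightarrow> 'u :: comm_ring_1 list \<Rightarrow> 'u list list \<Rightarrow> 'u list list" where
  "stepL Z l [] = []"
| "stepL Z l (c # cs) = (if Z (dotL l c) then c # stepL Z l cs else elimL l c (dotL l c) cs)"

fun kernL :: "('u \<Rightarrow> bool) \<Rightarrow> 'u :: comm_ring_1 list list \<Rightarrow> 'u list list \<Rightarrow> 'u list list" where
  "kernL Z [] bs = bs"
| "kernL Z (l # ls) bs = kernL Z ls (stepL Z l bs)"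

lemma length_elimL: "c \<in> set (elimL l p s cs) \<Longrightarrow> length p = N \<Longrightarrow> \<forall>c\<in>set cs. length c = N \<Longrightarrow> length c
    = N"
  by (auto simp: elimL_def)

lemma length_stepL:
  "\<forall>c\<in>set bs. length c = N \<Longrightarrow> \<forall>c\<in>set (stepL Z l bs). length c = N"
  "length (stepL Z l bs) \<le> length bs"
  by (induction bs) (auto simp: length_elimL, auto simp: elimL_def)

text \<open>\<open>M\<close> exceeds the length of all lists that occur in the computation; running times are bounded
  by powers of \<open>M\<close>.\<close>

locale iso_run =
  fixes R :: "nat ring" and q n M :: nat
  assumes field_R: "field R" and carrier_R: "carrier R = {..<q}" and q_less_M: "q < M"
    and M_ge: "1000 \<le> M" and n_less_M: "200 * (n + 1) ^ 3 < M"
begin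

lemma cring_R: "cring R"
  using field_R by (simp add: field_def domain_def)

lemma M_pow_ge: "1 \<le> d \<Longrightarrow> M \<le> M ^ d"
  using M_ge self_le_power[of M d] by simp

lemma M_pow_le: "a \<le> b \<Longrightarrow> M ^ a \<le> M ^ b"
  using M_ge by (intro power_increasing) auto

definition el :: "prod_ring \<Rightarrow> val" where
  "el a = enc_nat (proj R a)"

abbreviation ev :: "prod_ring list \<Rightarrow> val" where
  "ev \<equiv> encl el"

abbreviation em :: "prod_ring list list \<Rightarrow> val" where
  "em \<equiv> encl ev"

text \<open>In descending order, since \<open>fn_elems\<close> counts down from
  \<open>q\<close>.\<close>

definition els :: "prod_ring list" where
  "els = map (emb R) (rev [0..<q])"

definition env :: val where
  "env = CONS (ev els) (CONS (enc_table q (add R)) (CONS (enc_table q (monoid.mult R))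
     (CONS (el 0) (CONS (el (emb R \<one>\<^bsub>R\<^esub>)) NIL))))"

lemma env_simps [simp]:
  "hd_val env = ev els" "hd_val (tl_val env) = enc_table q (add R)"
  "hd_val (tl_val (tl_val env)) = enc_table q (monoid.mult R)"
  "hd_val (tl_val (tl_val (tl_val env))) = el 0"
  "hd_val (tl_val (tl_val (tl_val (tl_val env)))) = el (emb R \<one>\<^bsub>R\<^esub>)"
  by (simp_all add: env_def)

lemma proj_less: "proj R a < q"
  using proj_closed[OF cring_R, of a] by (simp add: carrier_R)

definition table_row :: "(nat \<Rightarrow> nat \<Rightarrow> nat) \<Rightarrow> nat \<Rightarrow> val" where
  "table_row h a = enc_list (map (\<lambda>b. enc_nat (h a b)) [0..<q])"

lemma computes_table_row:
  assumes "a < q"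
  shows "computes fn_nth [enc_table q h, enc_nat a] (table_row h a) (M ^ 2)"
proof -
  have "computes fn_nth [enc_table q h, enc_nat a] (table_row h a) (10 * (a + 1))"
    using computes_nth[of a "map (\<lambda>a. table_row h a) [0..<q]"] assms
    by (simp add: enc_table_def table_row_def)
  then show ?thesis
    by (rule computes_mono) (use assms q_less_M M_ge mult_mono[of 10 M "a + 1" M] in \<open>simp add:
        power2_eq_square\<close>)
qed

lemma computes_table_entry:
  assumes "b < q"
  shows "computes fn_nth [table_row h a, enc_nat b] (enc_nat (h a b)) (M ^ 2)"
proof -
  have "computes fn_nth [table_row h a, enc_nat b] (enc_nat (h a b)) (10 * (b + 1))"
    using computes_nth[of b "map (\<lambda>b. enc_nat (h a b)) [0..<q]"] assms
    by (simp add: table_row_def)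
  then show ?thesis
    by (rule computes_mono) (use assms q_less_M M_ge mult_mono[of 10 M "b + 1" M] in \<open>simp add:
        power2_eq_square\<close>)
qed

lemma computes_row: "computes fn_nth [enc_table q h, el a] (table_row h (proj R a)) (M ^ 2)"
  unfolding el_def by (rule computes_table_row[OF proj_less])

lemma computes_add: "computes fn_nth [table_row (add R) (proj R a), el b] (el (a + b)) (M ^ 2)"
  unfolding el_def proj_ops(3)[OF cring_R] by (rule computes_table_entry[OF proj_less])

lemma computes_mult: "computes fn_nth [table_row (monoid.mult R) (proj R a), el b] (el (a * b)) (M
    ^ 2)"
  unfolding el_def proj_ops(4)[OF cring_R] by (rule computes_table_entry[OF proj_less])

lemmas computes_field = wp_callI[OF computes_row] wp_callI[OF computes_add] wp_callI[OF
    computes_mult]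

text \<open>\<open>900\<close> times the cost of the most expensive call is a crude bound for one pass through a
  loop.\<close>

lemma loop_bound: "computes i vs v ((l + 1) * (900 * M ^ d)) \<Longrightarrow> l < M \<Longrightarrow> computes i vs v (M ^ (d +
    2))"
proof (rule computes_mono)
  assume "l < M"
  then have "(l + 1) * (900 * M ^ d) \<le> M * (M * M ^ d)"
    using M_ge by (intro mult_mono) auto
  then show "(l + 1) * (900 * M ^ d) \<le> M ^ (d + 2)" by simp
qed

lemma computes_raise: "computes i vs v (M ^ a) \<Longrightarrow> a \<le> d \<Longrightarrow> computes i vs v (M ^ d)"
  by (rule computes_mono[OF _ M_pow_le])

text \<open>The counterpart of \<open>loop_bound\<close> for functions without recursion: the
  exponent grows by one only.\<close>

lemma computes_const: "computes i vs v (900 * M ^ d) \<Longrightarrow> computes i vs v (M ^ (d + 1))"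
  by (erule computes_mono) (use M_ge mult_mono[of 900 M "M ^ d" "M ^ d"] in simp)

section \<open>Arithmetic in the field, vectors and values of forms\<close>

lemma computes_scale: "length v < M \<Longrightarrow> computes fn_scale [env, el c, ev v] (ev (scaleL c v)) (M ^ 4)"
proof -
  have "computes fn_scale [env, el c, ev v] (ev (scaleL c v)) ((length v + 1) * (900 * M ^ 2))"
  proof (induction v)
    case (Cons a v)
    show ?case using M_ge M_pow_ge[of 2]
      by (intro computesI) (auto simp: nth_iso_program body_scale_def intro!: wp_callI[OF Cons.IH]
          computes_field)
  qed (use M_ge M_pow_ge[of 2] in \<open>intro computesI; simp add: nth_iso_program body_scale_def\<close>)
  then show "length v < M \<Longrightarrow> ?thesis" using loop_bound[of _ _ _ _ 2] by simp
qed

lemma computes_vadd: "length u < M \<Longrightarrow> computes fn_vadd [env, ev u, ev v] (ev (vaddL u v)) (M ^ 4)"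
proof -
  have "computes fn_vadd [env, ev u, ev v] (ev (vaddL u v)) ((length u + 1) * (900 * M ^ 2))"
  proof (induction u arbitrary: v)
    case (Cons a u)
    show ?case using M_ge M_pow_ge[of 2]
      by (cases v; intro computesI) (auto simp: nth_iso_program body_vadd_def intro!: wp_callI[OF
          Cons.IH] computes_field)
  qed (use M_ge M_pow_ge[of 2] in \<open>intro computesI; simp add: nth_iso_program body_vadd_def\<close>)
  then show "length u < M \<Longrightarrow> ?thesis" using loop_bound[of _ _ _ _ 2] by simp
qed

lemma computes_dot: "length u < M \<Longrightarrow> computes fn_dot [env, ev u, ev v] (el (dotL u v)) (M ^ 4)"
proof -
  have "computes fn_dot [env, ev u, ev v] (el (dotL u v)) ((length u + 1) * (900 * M ^ 2))"
  proof (induction u arbitrary: v)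
    case (Cons a u)
    show ?case using M_ge M_pow_ge[of 2]
      by (cases v; intro computesI) (auto simp: nth_iso_program body_dot_def intro!: wp_callI[OF
          Cons.IH] computes_field)
  qed (use M_ge M_pow_ge[of 2] in \<open>intro computesI; simp add: nth_iso_program body_dot_def\<close>)
  then show "length u < M \<Longrightarrow> ?thesis" using loop_bound[of _ _ _ _ 2] by simp
qed

text \<open>These are the polynomial lengths that occur: points, equations for one vector
  \<open>w\<close>, unknowns, coefficients of a form, all equations, and coefficient vectors of
  candidates.\<close>

lemma n_bounds: "n < M" "n * n < M" "2 * (n * n) < M" "n * n * n < M" "40 * (n * n) < M" "169 * n
    < M"
proof -
  have "(n + 1) ^ 3 = n * n * n + 3 * (n * n) + 3 * n + 1"
    by (simp add: power3_eq_cube algebra_simps)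
  moreover have "n \<le> n * n" "n * n \<le> n * n * n" by (cases n; simp)+
  ultimately show "n < M" "n * n < M" "2 * (n * n) < M" "n * n * n < M" "40 * (n * n) < M" "169 *
      n < M"
    using n_less_M by linarith+
qed

lemma computes_eq_el: "computes fn_eq [el a, v] (tt (el a = v)) (M ^ 2)"
proof (rule computes_mono[OF computes_eq])
  have "20 * (2 * proj R a + 1) \<le> 60 * M" using proj_less[of a] q_less_M by simp
  also have "\<dots> \<le> M * M" using M_ge by (intro mult_mono) auto
  finally show "20 * vsize (el a) \<le> M ^ 2" by (simp add: el_def power2_eq_square)
qed

lemma computes_eq_ev: "length x \<le> n \<Longrightarrow> computes fn_eq [ev x, v] (tt (ev x = v)) (M ^ 3)"
proof (rule computes_mono[OF computes_eq])
  assume x: "length x \<le> n"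
  have "vsize (el a) \<le> 2 * M" for a using proj_less[of a] q_less_M by (simp add: el_def)
  then have "vsize (ev x) \<le> 1 + length x * (2 * M + 1)" by (intro vsize_encl) auto
  also have "\<dots> \<le> 1 + M * (3 * M)" using x n_bounds(1) M_ge by (intro add_mono mult_mono) auto
  also have "\<dots> \<le> M * (4 * M)" using M_ge by (simp add: algebra_simps)
  finally have "20 * vsize (ev x) \<le> 80 * (M * M)" by simp
  also have "\<dots> \<le> M * (M * M)" using M_ge by (intro mult_mono) auto
  finally show "20 * vsize (ev x) \<le> M ^ 3" by (simp add: power3_eq_cube)
qed

lemma small_loop: "computes i vs v (20 * (l + 1)) \<Longrightarrow> l < M \<Longrightarrow> computes i vs v (M ^ 2)"
  by (erule computes_mono) (use M_ge mult_mono[of 20 M "l + 1" M] in \<open>simp add: power2_eq_square\<close>)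

lemma computes_append: "length xs < M \<Longrightarrow> computes fn_app [encl c xs, encl c ys] (encl c (xs @ ys))
    (M ^ 2)"
  by (rule small_loop[OF computes_app])

text \<open>The program returns the first hit; uniqueness of the solution makes it independent of
  the order of \<open>ss\<close>.\<close>

lemma computes_find:
  assumes h: "\<And>s. s < q \<Longrightarrow> h s a < q" and a: "a < q"
    and ss: "set ss \<subseteq> {..<q}" "length ss < M" "s \<in> set ss" "h s a = b"
    and uniq: "\<And>s'. s' \<in> set ss \<Longrightarrow> h s' a = b \<Longrightarrow> s' = s"
  shows "computes fn_find [encl enc_nat ss, enc_table q h, enc_nat a, enc_nat b] (enc_nat s) (M ^
      4)"
    (is "computes ?i ?vs ?v _")
proof -
  have eq: "computes fn_eq [enc_nat (h s a), v] (tt (enc_nat (h s a) = v)) (M ^ 2)" if "s < q" for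
      s v
    using computes_eq_el[of "emb R (h s a)" v] h[OF that] by (simp add: el_def cring_R carrier_R)
  have "computes ?i ?vs ?v ((length ss + 1) * (900 * M ^ 2))"
    using ss(1,3) uniq
  proof (induction ss)
    case (Cons s' ss)
    have IH: "computes fn_find [encl enc_nat ss, enc_table q h, enc_nat a, enc_nat b] (enc_nat s)
        ((length ss + 1) * (900 * M ^ 2))"
      if "s' \<noteq> s" using Cons that by auto
    have *: "h s' a = b \<longleftrightarrow> s' = s" using Cons.prems(3)[of s'] ss(4) by auto
    show ?case using M_ge M_pow_ge[of 2] Cons.prems(1) a *
      by (cases "s' = s"; intro computesI) (auto simp: nth_iso_program body_find_def
          intro!: wp_callI[OF IH] wp_callI[OF computes_table_row] wp_callI[OF
              computes_table_entry] wp_callI[OF eq])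
  qed simp
  then show ?thesis using loop_bound[of _ _ _ _ 2] ss(2) by simp
qed

lemma ev_els: "ev els = encl enc_nat (rev [0..<q])"
  unfolding encl_def els_def by (auto simp: el_def cring_R carrier_R intro!: arg_cong[where f =
      enc_list])

lemma computes_neg: "computes fn_find [ev els, enc_table q (add R), el a, el 0] (el (- a)) (M ^ 4)"
proof -
  interpret cring R by (rule cring_R)
  show ?thesis
    unfolding ev_els unfolding el_def
  proof (rule computes_find)
    show "proj R (- a) \<oplus>\<^bsub>R\<^esub> proj R a = proj R 0"
      by (simp flip: proj_ops(3)[OF cring_R])
    fix s assume "s \<in> set (rev [0..<q])" "s \<oplus>\<^bsub>R\<^esub> proj R a = proj R 0"
    then show "s = proj R (- a)"
      using minus_equality[of "s" "proj R a"] proj_closed[OF cring_R] by (simp add: proj_ops[OF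
          cring_R] carrier_R)
  qed (use q_less_M proj_less a_closed in \<open>auto simp: carrier_R\<close>)
qed

lemma computes_duo: "length v \<le> n \<Longrightarrow> computes fn_duo [env, ev v] (ev (duoL v)) (M ^ 6)"
proof -
  assume len: "length v \<le> n"
  then have "computes fn_duo [env, ev v] (ev (duoL v)) ((length v + 1) * (900 * M ^ 4))"
  proof (induction v)
    case (Cons a v)
    have 1: "computes fn_scale [env, el a, CONS (el a) (ev v)] (ev (scaleL a (a # v))) (M ^ 4)"
      using computes_scale[of "a # v" a] Cons.prems n_bounds(1) by simp
    show ?case using M_ge M_pow_ge[of 4] Cons.prems n_bounds(1)
      by (intro computesI) (auto simp: nth_iso_program body_duo_def simp del: listops_simps(5)
          intro!: wp_callI[OF Cons.IH] wp_callI[OF 1] wp_callI[OF computes_raise[where d = 4, OF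
              computes_append]])
  qed (use M_ge M_pow_ge[of 4] in \<open>intro computesI; simp add: nth_iso_program body_duo_def\<close>)
  then show ?thesis using loop_bound[of _ _ _ _ 4] len n_bounds(1) by simp
qed

lemma length_duoL_less: "length v \<le> n \<Longrightarrow> length (duoL v) < M"
  using length_duoL[of v] mult_mono[of "length v" n "length v" n] n_bounds(2) by simp

lemma computes_tri: "length v \<le> n \<Longrightarrow> computes fn_tri [env, ev v] (ev (triL v)) (M ^ 8)"
proof -
  assume len: "length v \<le> n"
  then have "computes fn_tri [env, ev v] (ev (triL v)) ((length v + 1) * (900 * M ^ 6))"
  proof (induction v)
    case (Cons a v)
    have 1: "computes fn_duo [env, CONS (el a) (ev v)] (ev (duoL (a # v))) (M ^ 6)"
      using computes_duo[of "a # v"] Cons.prems by simp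
    note up = computes_raise[where d = 6]
    show ?case using M_ge M_pow_ge[of 6] Cons.prems length_duoL_less[OF Cons.prems]
      by (intro computesI) (auto simp: nth_iso_program body_tri_def simp del: duoL.simps
          intro!: wp_callI[OF Cons.IH] wp_callI[OF 1] wp_callI[OF up[OF computes_append]]
              wp_callI[OF up[OF computes_scale]])
  qed (use M_ge M_pow_ge[of 6] in \<open>intro computesI; simp add: nth_iso_program body_tri_def\<close>)
  then show ?thesis using loop_bound[of _ _ _ _ 6] len n_bounds(1) by simp
qed

lemma computes_feval:
  assumes "length h < M" "length x \<le> n"
  shows "computes fn_feval [env, ev h, ev x] (el (evalL h x)) (M ^ 9)"
    (is "computes ?i ?vs ?v _")
proof -
  have "computes ?i ?vs ?v (900 * M ^ 8)"
    using M_ge M_pow_ge[of 8] assms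
    by (intro computesI) (auto simp: nth_iso_program body_feval_def evalL_def
        intro!: wp_callI[OF computes_raise[where d = 8, OF computes_dot]] wp_callI[OF computes_tri])
  from computes_const[OF this] show ?thesis by simp
qed

lemma computes_polar:
  assumes "length h < M" "length x = n" "length y = n" "length z = n"
  shows "computes fn_polar [env, ev h, ev x, ev y, ev z] (el (polarL h x y z)) (M ^ 10)"
    (is "computes ?i ?vs ?v _")
proof -
  note up = computes_raise[where d = 9]
  have "computes ?i ?vs ?v (900 * M ^ 9)"
    using M_ge M_pow_ge[of 9] assms n_bounds(1)
    by (intro computesI) (auto simp: nth_iso_program body_polar_def polarL_def
        intro!: wp_callI[OF computes_feval] wp_callI[OF up[OF computes_vadd]] wp_callI[OF up[OF
            computes_neg]]
          wp_callI[OF up[OF computes_row]] wp_callI[OF up[OF computes_add]])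
  from computes_const[OF this] show ?thesis by simp
qed

section \<open>Setting up the linear system\<close>

lemma computes_trow:
  assumes "length h < M" "length x = n" "length y = n" "\<forall>z\<in>set Es. length z = n" "length Es < M"
  shows "computes fn_trow [env, ev h, ev x, ev y, em Es] (ev (map (polarL h x y) Es)) (M ^ 12)"
    (is "computes ?i ?vs ?v _")
proof -
  have "computes ?i ?vs ?v ((length Es + 1) * (900 * M ^ 10))"
    using assms(4)
  proof (induction Es)
    case (Cons z Es)
    show ?case using M_ge M_pow_ge[of 10] Cons.prems assms(1-3)
      by (intro computesI) (auto simp: nth_iso_program body_trow_def
          intro!: wp_callI[OF Cons.IH] wp_callI[OF computes_polar])
  qed (use M_ge M_pow_ge[of 10] in \<open>intro computesI; simp add: nth_iso_program body_trow_def\<close>)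
  then show ?thesis using loop_bound[of _ _ _ _ 10] assms(5) by simp
qed

lemma computes_kron:
  assumes "length u < M" "length v < M"
  shows "computes fn_kron [env, ev u, ev v] (ev (kronL u v)) (M ^ 6)"
    (is "computes ?i ?vs ?v _")
proof -
  have "computes ?i ?vs ?v ((length u + 1) * (900 * M ^ 4))"
  proof (induction u)
    case (Cons a u)
    show ?case using M_ge M_pow_ge[of 4] assms(2)
      by (intro computesI) (auto simp: nth_iso_program body_kron_def kronL_def
          intro!: wp_callI[OF Cons.IH[unfolded kronL_def]] wp_callI[OF computes_scale]
            wp_callI[OF computes_raise[where d = 4, OF computes_append]])
  qed (use M_ge M_pow_ge[of 4] in \<open>intro computesI; simp add: nth_iso_program body_kron_def
      kronL_def\<close>)
  then show ?thesis using loop_bound[of _ _ _ _ 4] assms(1) by simp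
qed

lemma computes_eqk:
  assumes "length f < M" "length x = n" "length ej = n" "length crow = n" "\<forall>z\<in>set Es. length z =
      n" "length Es = n"
    "\<forall>z\<in>set Ks. length z = n" "length Ks < M"
  shows "computes fn_eqk [env, ev f, ev x, ev ej, ev crow, em Ks, em Es] (em (eqkL f x ej crow Ks
      Es)) (M ^ 14)"
    (is "computes ?i ?vs ?v _")
proof -
  note up = computes_raise[where d = 12]
  have "computes ?i ?vs ?v ((length Ks + 1) * (900 * M ^ 12))"
    using assms(7)
  proof (induction Ks)
    case (Cons z Ks)
    show ?case using M_ge M_pow_ge[of 12] Cons.prems assms(1-6) n_bounds(1,2)
      by (intro computesI) (auto simp: nth_iso_program body_eqk_def eqkL_def
          intro!: wp_callI[OF Cons.IH[unfolded eqkL_def]] wp_callI[OF computes_trow] wp_callI[OF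
              up[OF computes_kron]]
            wp_callI[OF up[OF computes_append]])
  qed (use M_ge M_pow_ge[of 12] in \<open>intro computesI; simp add: nth_iso_program body_eqk_def
      eqkL_def\<close>)
  then show ?thesis using loop_bound[of _ _ _ _ 12] assms(8) by simp
qed

lemma computes_eqj:
  assumes "length f < M" "length g < M" "length x = n" "length w = n" "\<forall>z\<in>set Es. length z = n"
      "length Es = n"
    "\<forall>z\<in>set Js. length z = n" "length Js < M"
  shows "computes fn_eqj [env, ev f, ev g, ev x, ev w, em Js, em Es] (em (eqjL f g x w Js Es)) (M
      ^ 16)"
    (is "computes ?i ?vs ?v _")
proof -
  note up = computes_raise[where d = 14]
  have "computes ?i ?vs ?v ((length Js + 1) * (900 * M ^ 14))"
    using assms(7)
  proof (induction Js)
    case (Cons z Js)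
    have len: "length (eqkL f x ej crow Es Es) < M" for ej crow
      using assms(6) n_bounds(1) by (simp add: eqkL_def)
    show ?case using M_ge M_pow_ge[of 14] Cons.prems assms(1-6) n_bounds(1,2) len
      by (intro computesI) (auto simp: nth_iso_program body_eqj_def eqjL_def
          intro!: wp_callI[OF Cons.IH[unfolded eqjL_def]] wp_callI[OF computes_eqk] wp_callI[OF
              up[OF computes_trow]]
            wp_callI[OF up[OF computes_append]])
  qed (use M_ge M_pow_ge[of 14] in \<open>intro computesI; simp add: nth_iso_program body_eqj_def
      eqjL_def\<close>)
  then show ?thesis using loop_bound[of _ _ _ _ 14] assms(8) by simp
qed

lemma length_eqjL: "length (eqjL f g x w Js Es) = length Js * length Es"
  by (induction Js) (auto simp: eqjL_def eqkL_def)

lemma computes_eqi: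
  assumes "length f < M" "length g < M" "\<forall>z\<in>set Es. length z = n" "length Es = n"
    "\<forall>z\<in>set xs. length z = n" "\<forall>z\<in>set ws. length z = n" "length xs < M"
  shows "computes fn_eqi [env, ev f, ev g, em xs, em ws, em Es] (em (eqiL f g xs ws Es)) (M ^ 18)"
    (is "computes ?i ?vs ?v _")
proof -
  note up = computes_raise[where d = 16]
  have "computes ?i ?vs ?v ((length xs + 1) * (900 * M ^ 16))"
    using assms(5,6)
  proof (induction xs arbitrary: ws)
    case (Cons x xs)
    show ?case
    proof (cases ws)
      case Nil
      then show ?thesis using M_ge M_pow_ge[of 16]
        by (intro computesI) (simp_all add: nth_iso_program body_eqi_def eqiL_def)
    next
      case (Cons w ws')
      have IH: "computes fn_eqi [env, ev f, ev g, em xs, em ws', em Es] (em (eqiL f g xs ws' Es))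
          ((length xs + 1) * (900 * M ^ 16))"
        using Cons.IH[of ws'] Cons.prems Cons by simp
      have len: "length (eqjL f g x w Es Es) < M"
        using assms(4) n_bounds(2) by (simp add: length_eqjL)
      show ?thesis using M_ge M_pow_ge[of 16] Cons.prems assms(1-4) n_bounds(1,2) len Cons
        by (intro computesI) (auto simp: nth_iso_program body_eqi_def eqiL_def
            intro!: wp_callI[OF IH[unfolded eqiL_def]] wp_callI[OF computes_eqj]
              wp_callI[OF up[OF computes_append]])
    qed
  qed (use M_ge M_pow_ge[of 16] in \<open>intro computesI; simp add: nth_iso_program body_eqi_def
      eqiL_def\<close>)
  then show ?thesis using loop_bound[of _ _ _ _ 16] assms(7) by simp
qed

section \<open>Solving the linear system\<close>

lemma computes_elim:
  assumes "length l < M" "length p < M" "\<forall>c\<in>set cs. length c < M" "length cs < M"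
  shows "computes fn_elim [env, ev l, ev p, el s, em cs] (em (elimL l p s cs)) (M ^ 6)"
    (is "computes ?i ?vs ?v _")
proof -
  have "computes ?i ?vs ?v ((length cs + 1) * (900 * M ^ 4))"
    using assms(3)
  proof (induction cs)
    case (Cons c cs)
    show ?case using M_ge M_pow_ge[of 4] Cons.prems assms(1,2)
      by (intro computesI) (auto simp: nth_iso_program body_elim_def elimL_def
          intro!: wp_callI[OF Cons.IH[unfolded elimL_def]] wp_callI[OF computes_vadd] wp_callI[OF
              computes_scale]
            wp_callI[OF computes_dot] wp_callI[OF computes_neg])
  qed (use M_ge M_pow_ge[of 4] in \<open>intro computesI; simp add: nth_iso_program body_elim_def
      elimL_def\<close>)
  then show ?thesis using loop_bound[of _ _ _ _ 4] assms(4) by simp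
qed

abbreviation (input) is_zero :: "prod_ring \<Rightarrow> bool" where
  "is_zero a \<equiv> el a = el 0"

lemma computes_step:
  assumes "length l < M" "\<forall>c\<in>set bs. length c < M" "length bs < M"
  shows "computes fn_step [env, ev l, em bs] (em (stepL is_zero l bs)) (M ^ 8)"
    (is "computes ?i ?vs ?v _")
proof -
  note up = computes_raise[where d = 6]
  have "computes ?i ?vs ?v ((length bs + 1) * (900 * M ^ 6))"
    using assms(2,3)
  proof (induction bs)
    case (Cons b bs)
    show ?case using M_ge M_pow_ge[of 6] Cons.prems assms(1)
      by (intro computesI) (auto simp: nth_iso_program body_step_def
          intro!: wp_callI[OF Cons.IH] wp_callI[OF computes_elim] wp_callI[OF up[OF computes_dot]]
            wp_callI[OF up[OF computes_eq_el]])
  qed (use M_ge M_pow_ge[of 6] in \<open>intro computesI; simp add: nth_iso_program body_step_def\<close>)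
  then show ?thesis using loop_bound[of _ _ _ _ 6] assms(3) by simp
qed

lemma computes_kern:
  assumes "\<forall>l\<in>set ls. length l < M" "\<forall>c\<in>set bs. length c = N" "N < M" "length bs < M" "length ls <
      M"
  shows "computes fn_kern [env, em ls, em bs] (em (kernL is_zero ls bs)) (M ^ 10)"
    (is "computes ?i ?vs ?v _")
proof -
  have "computes ?i ?vs ?v ((length ls + 1) * (900 * M ^ 8))"
    using assms(1,2,4)
  proof (induction ls arbitrary: bs)
    case (Cons l ls)
    have "computes fn_kern [env, em ls, em (stepL is_zero l bs)] (em (kernL is_zero ls (stepL
        is_zero l bs))) ((length ls + 1) * (900 * M ^ 8))"
      using Cons.prems length_stepL(1)[of bs N] le_less_trans[OF length_stepL(2)]
      by (intro Cons.IH) auto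
    then show ?case using M_ge M_pow_ge[of 8] Cons.prems assms(3)
      by (intro computesI) (auto simp: nth_iso_program body_kern_def
          intro!: wp_callI[of fn_kern] wp_callI[OF computes_step])
  qed (use M_ge M_pow_ge[of 8] in \<open>intro computesI; simp add: nth_iso_program body_kern_def\<close>)
  then show ?thesis using loop_bound[of _ _ _ _ 8] assms(5) by simp
qed

lemma computes_zeros: "length xs < M \<Longrightarrow> computes fn_zeros [env, encl c xs] (ev (replicate (length
    xs) 0)) (M ^ 2)"
proof (rule small_loop)
  show "computes fn_zeros [env, encl c xs] (ev (replicate (length xs) 0)) (20 * (length xs + 1))"
  proof (induction xs)
    case (Cons x xs)
    show ?case
      by (intro computesI) (auto simp: nth_iso_program body_zeros_def intro!: wp_callI[OF Cons.IH])
  qed (intro computesI; simp add: nth_iso_program body_zeros_def)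
qed

lemma computes_mapc: "length xs < M \<Longrightarrow> computes fn_mapc [c a, encl (encl c) xs] (encl (encl c) (map
    ((#) a) xs)) (M ^ 2)"
proof (rule small_loop)
  show "computes fn_mapc [c a, encl (encl c) xs] (encl (encl c) (map ((#) a) xs)) (20 * (length xs
      + 1))"
  proof (induction xs)
    case (Cons x xs)
    show ?case
      by (intro computesI) (auto simp: nth_iso_program body_mapc_def intro!: wp_callI[OF Cons.IH])
  qed (intro computesI; simp add: nth_iso_program body_mapc_def)
qed

lemma length_unitsL [simp]: "length (unitsL a k) = k"
  by (simp add: unitsL_def)

lemma computes_units:
  assumes "length xs < M"
  shows "computes fn_units [env, encl c xs] (em (unitsL (emb R \<one>\<^bsub>R\<^esub>) (length xs))) (M ^ 4)"
    (is "computes ?i ?vs ?v _")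
proof -
  have "computes ?i ?vs ?v ((length xs + 1) * (900 * M ^ 2))"
    using assms
  proof (induction xs)
    case (Cons x xs)
    show ?case using M_ge M_pow_ge[of 2] Cons.prems
      by (intro computesI) (auto simp: nth_iso_program body_units_def unitsL_Suc
          intro!: wp_callI[OF Cons.IH] wp_callI[OF computes_zeros] wp_callI[OF computes_mapc])
  qed (use M_ge M_pow_ge[of 2] in \<open>intro computesI; simp add: nth_iso_program body_units_def\<close>)
  then show ?thesis using loop_bound[of _ _ _ _ 2] assms by simp
qed

section \<open>Enumeration of tuples, combinations and matrix products\<close>

lemma computes_extl: "length L < M \<Longrightarrow> computes fn_extl [encl c L, encl c ys] (encl (encl c) (map
    (\<lambda>y. y # ys) L)) (M ^ 2)"
proof (rule small_loop)
  show "computes fn_extl [encl c L, encl c ys] (encl (encl c) (map (\<lambda>y. y # ys) L)) (20 * (length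
      L + 1))"
  proof (induction L)
    case (Cons x L)
    show ?case
      by (intro computesI) (auto simp: nth_iso_program body_extl_def intro!: wp_callI[OF Cons.IH])
  qed (intro computesI; simp add: nth_iso_program body_extl_def)
qed

lemma computes_ext:
  assumes "length L < M" "length Ys < M"
  shows "computes fn_ext [encl c L, encl (encl c) Ys] (encl (encl c) (concat (map (\<lambda>ys. map (\<lambda>y. y
      # ys) L) Ys))) (M ^ 4)"
    (is "computes ?i ?vs ?v _")
proof -
  have "computes ?i ?vs ?v ((length Ys + 1) * (900 * M ^ 2))"
  proof (induction Ys)
    case (Cons y Ys)
    show ?case using M_ge M_pow_ge[of 2] assms(1)
      by (intro computesI) (auto simp: nth_iso_program body_ext_def
          intro!: wp_callI[OF Cons.IH] wp_callI[OF computes_extl] wp_callI[OF computes_append])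
  qed (use M_ge M_pow_ge[of 2] in \<open>intro computesI; simp add: nth_iso_program body_ext_def\<close>)
  then show ?thesis using loop_bound[of _ _ _ _ 2] assms(2) by simp
qed

lemma computes_pw:
  assumes "length L \<noteq> 0" "length L < M" "k < M" "length L ^ k < M"
  shows "computes fn_pw [enc_nat k, encl c L] (encl (encl c) (List.n_lists k L)) (M ^ 6)"
    (is "computes ?i ?vs ?v _")
proof -
  have "computes ?i ?vs ?v ((k + 1) * (900 * M ^ 4))"
    using assms(4)
  proof (induction k)
    case (Suc k)
    have less: "length L ^ k < M"
      using Suc.prems assms(1) by (intro le_less_trans[OF power_increasing[of k "Suc k"]]) (auto
          simp: Suc_le_eq)
    have IH: "computes fn_pw [enc_nat k, encl c L] (encl (encl c) (List.n_lists k L)) ((k + 1) *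
        (900 * M ^ 4))"
      using Suc.IH[OF less] .
    show ?case using M_ge M_pow_ge[of 4] assms(2) less
      by (intro computesI) (auto simp: nth_iso_program body_pw_def length_n_lists
          intro!: wp_callI[OF IH] wp_callI[OF computes_ext])
  qed (use M_ge M_pow_ge[of 4] in \<open>intro computesI; simp add: nth_iso_program body_pw_def\<close>)
  then show ?thesis using loop_bound[of _ _ _ _ 4] assms(3) by simp
qed

lemma computes_rep:
  assumes "k < M" "m < M"
  shows "computes fn_rep [enc_nat k, enc_nat m] (enc_nat (k * m)) (M ^ 4)"
    (is "computes ?i ?vs ?v _")
proof -
  have app: "computes fn_app [enc_nat m, enc_nat j] (enc_nat (m + j)) (M ^ 2)" for j
    using computes_append[of "replicate m ()" "\<lambda>_. NIL" "replicate j ()"] assms(2)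
    by (simp add: enc_nat_encl replicate_add)
  have "computes ?i ?vs ?v ((k + 1) * (900 * M ^ 2))"
  proof (induction k)
    case (Suc k)
    show ?case using M_ge M_pow_ge[of 2]
      by (intro computesI) (auto simp: nth_iso_program body_rep_def
          intro!: wp_callI[OF Suc.IH] wp_callI[OF app])
  qed (use M_ge M_pow_ge[of 2] in \<open>intro computesI; simp add: nth_iso_program body_rep_def\<close>)
  then show ?thesis using loop_bound[of _ _ _ _ 2] assms(1) by simp
qed

lemma computes_linc:
  assumes "\<forall>b\<in>set bs. length b < M" "length acc < M" "length cs < M"
  shows "computes fn_linc [env, ev cs, em bs, ev acc] (ev (lincombL cs bs acc)) (M ^ 6)"
    (is "computes ?i ?vs ?v _")
proof -
  have "computes ?i ?vs ?v ((length cs + 1) * (900 * M ^ 4))"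
    using assms(1,2)
  proof (induction cs arbitrary: bs acc)
    case (Cons c cs)
    show ?case
    proof (cases bs)
      case Nil
      then show ?thesis using M_ge M_pow_ge[of 4]
        by (intro computesI) (simp_all add: nth_iso_program body_linc_def)
    next
      case (Cons b bs')
      have IH: "computes fn_linc [env, ev cs, em bs', ev (vaddL acc (scaleL c b))]
          (ev (lincombL cs bs' (vaddL acc (scaleL c b)))) ((length cs + 1) * (900 * M ^ 4))"
        using Cons.prems Cons by (intro Cons.IH) auto
      show ?thesis using M_ge M_pow_ge[of 4] Cons.prems Cons
        by (intro computesI) (auto simp: nth_iso_program body_linc_def
            intro!: wp_callI[OF IH] wp_callI[OF computes_vadd] wp_callI[OF computes_scale])
    qed
  qed (use M_ge M_pow_ge[of 4] in \<open>intro computesI; simp add: nth_iso_program body_linc_def\<close>)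
  then show ?thesis using loop_bound[of _ _ _ _ 4] assms(3) by simp
qed

lemma tl_encl: "tl_val (encl c xs) = encl c (tl xs)"
  by (cases xs) simp_all

lemma computes_drop: "length xs < M \<Longrightarrow> computes fn_drop [encl c xs, encl d u] (encl d (drop (length
    xs) u)) (M ^ 2)"
proof (rule small_loop)
  show "computes fn_drop [encl c xs, encl d u] (encl d (drop (length xs) u)) (20 * (length xs + 1))"
  proof (induction xs arbitrary: u)
    case (Cons x xs)
    show ?case
      by (intro computesI) (auto simp: nth_iso_program body_drop_def tl_encl drop_Suc intro!:
          wp_callI[OF Cons.IH])
  qed (intro computesI; simp add: nth_iso_program body_drop_def)
qed

lemma computes_apply:
  assumes "length u < M" "length acc < M" "length xs < M"
  shows "computes fn_apply [env, ev xs, ev u, ev acc] (ev (applyL xs u acc)) (M ^ 6)"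
    (is "computes ?i ?vs ?v _")
proof -
  have "computes ?i ?vs ?v ((length xs + 1) * (900 * M ^ 4))"
    using assms(1,2)
  proof (induction xs arbitrary: u acc)
    case (Cons x xs)
    have IH: "computes fn_apply [env, ev xs, ev (drop (length acc) u), ev (vaddL acc (scaleL x u))]
        (ev (applyL xs (drop (length acc) u) (vaddL acc (scaleL x u)))) ((length xs + 1) * (900 *
          M ^ 4))"
      using Cons.prems by (intro Cons.IH) auto
    show ?case using M_ge M_pow_ge[of 4] Cons.prems
      by (intro computesI) (auto simp: nth_iso_program body_apply_def
          intro!: wp_callI[OF IH] wp_callI[OF computes_vadd] wp_callI[OF computes_scale]
            wp_callI[OF computes_raise[where d = 4, OF computes_drop]])
  qed (use M_ge M_pow_ge[of 4] in \<open>intro computesI; simp add: nth_iso_program body_apply_def\<close>)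
  then show ?thesis using loop_bound[of _ _ _ _ 4] assms(3) by simp
qed

section \<open>Testing candidates and the search\<close>

definition chkL where
  "chkL f g x y zv \<longleftrightarrow> el (evalL f x) = el (evalL g y) \<and> (ev y = ev zv \<longrightarrow> ev x = ev zv)"

definition checkL where
  "checkL f g u V zv \<longleftrightarrow> (\<forall>x\<in>set V. chkL f g x (applyL x u zv) zv)"

definition candsL where
  "candsL f g V zv css bs zN \<longleftrightarrow> (\<exists>cs\<in>set css. checkL f g (lincombL cs bs zN) V zv)"

text \<open>The number of unknowns is the length of the first equation. There is none if \<open>n = 0\<close>, and
  then \<^term>\<open>hd_val NIL = NIL\<close> gives the right number.\<close>

definition hd0 :: "prod_ring list list \<Rightarrow> prod_ring list" where
  "hd0 ls = (if ls = [] then [] else hd ls)"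

definition tryL where
  "tryL f g V css zv eqs \<longleftrightarrow> candsL f g V zv css
     (kernL is_zero eqs (unitsL (emb R \<one>\<^bsub>R\<^esub>) (length (hd0 eqs)))) (replicate (length (hd0 eqs)) 0)"

definition tupsL where
  "tupsL f g Es V css zv ts \<longleftrightarrow> (\<exists>ws\<in>set ts. tryL f g V css zv (eqiL f g Es ws Es))"

lemma length_applyL: "length (applyL xs u acc) \<le> length acc"
  by (induction xs u acc rule: applyL.induct) auto

lemma length_lincombL: "length (lincombL cs bs acc) \<le> length acc"
  by (induction cs bs acc rule: lincombL.induct) auto

lemma computes_chk:
  assumes "length f < M" "length g < M" "length x = n" "length y \<le> n"
  shows "computes fn_chk [env, ev f, ev g, ev x, ev y, ev zv] (tt (chkL f g x y zv)) (M ^ 10)"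
    (is "computes ?i ?vs ?v _")
proof -
  note up = computes_raise[where d = 9]
  have "computes ?i ?vs ?v (900 * M ^ 9)"
    using M_ge M_pow_ge[of 9] assms
    by (intro computesI) (auto simp: nth_iso_program body_chk_def chkL_def
        intro!: wp_callI[OF computes_feval] wp_callI[OF up[OF computes_eq_el]] wp_callI[OF up[OF
            computes_eq_ev]])
  from computes_const[OF this] show ?thesis by simp
qed

lemma computes_check:
  assumes "length f < M" "length g < M" "length u < M" "\<forall>x\<in>set V. length x = n" "length V < M"
      "length zv = n"
  shows "computes fn_check [env, ev f, ev g, ev u, em V, ev zv] (tt (checkL f g u V zv)) (M ^ 12)"
    (is "computes ?i ?vs ?v _")
proof -
  note up = computes_raise[where d = 10]
  have "computes ?i ?vs ?v ((length V + 1) * (900 * M ^ 10))"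
    using assms(4)
  proof (induction V)
    case (Cons x V)
    show ?case using M_ge M_pow_ge[of 10] assms(1-3,6) Cons.prems n_bounds(1) length_applyL[of x u
        zv]
      by (intro computesI) (auto simp: nth_iso_program body_check_def
          intro!: wp_callI[OF Cons.IH] wp_callI[OF computes_chk] wp_callI[OF up[OF computes_apply]],
          auto simp: checkL_def)
  qed (use M_ge M_pow_ge[of 10] in \<open>intro computesI; simp add: nth_iso_program body_check_def
      checkL_def\<close>)
  then show ?thesis using loop_bound[of _ _ _ _ 10] assms(5) by simp
qed

lemma computes_cands:
  assumes "length f < M" "length g < M" "\<forall>x\<in>set V. length x = n" "length V < M" "length zv = n"
    "\<forall>b\<in>set bs. length b < M" "length zN < M" "\<forall>cs\<in>set css. length cs < M" "length css < M"
  shows "computes fn_cands [env, ev f, ev g, em V, ev zv, em css, em bs, ev zN] (tt (candsL f g V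
      zv css bs zN)) (M ^ 14)"
    (is "computes ?i ?vs ?v _")
proof -
  note up = computes_raise[where d = 12]
  have "computes ?i ?vs ?v ((length css + 1) * (900 * M ^ 12))"
    using assms(8)
  proof (induction css)
    case (Cons cs css)
    show ?case using M_ge M_pow_ge[of 12] assms(1-7) Cons.prems le_less_trans[OF length_lincombL
        assms(7)]
      by (intro computesI) (auto simp: nth_iso_program body_cands_def
          intro!: wp_callI[OF Cons.IH] wp_callI[OF computes_check] wp_callI[OF up[OF
              computes_linc]],
          auto simp: candsL_def)
  qed (use M_ge M_pow_ge[of 12] in \<open>intro computesI; simp add: nth_iso_program body_cands_def
      candsL_def\<close>)
  then show ?thesis using loop_bound[of _ _ _ _ 12] assms(9) by simp
qed

lemma hd_em: "hd_val (em ls) = ev (hd0 ls)"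
  by (cases ls) (simp_all add: hd0_def)

lemma length_kernL: "\<forall>c\<in>set bs. length c = N \<Longrightarrow> \<forall>c\<in>set (kernL Z ls bs). length c = N"
proof (induction ls arbitrary: bs)
  case (Cons l ls)
  show ?case using Cons.IH[OF length_stepL(1)[OF Cons.prems]] by simp
qed simp

lemma length_unitsL_elem: "\<forall>c\<in>set (unitsL a k). length c = k"
  by (simp add: unitsL_def)

lemma computes_try:
  assumes "length f < M" "length g < M" "\<forall>x\<in>set V. length x = n" "length V < M" "length zv = n"
    "\<forall>cs\<in>set css. length cs < M" "length css < M" "\<forall>l\<in>set ls. length l < M" "length ls < M"
  shows "computes fn_tryt [env, ev f, ev g, em V, em css, ev zv, em ls] (tt (tryL f g V css zv
      ls)) (M ^ 15)"
    (is "computes ?i ?vs ?v _")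
proof -
  note up = computes_raise[where d = 14]
  have hd0: "length (hd0 ls) < M" using assms(8) M_ge by (auto simp: hd0_def)
  have 1: "computes fn_kern [env, em ls, em (unitsL (emb R \<one>\<^bsub>R\<^esub>) (length (hd0 ls)))]
     (em (kernL is_zero ls (unitsL (emb R \<one>\<^bsub>R\<^esub>) (length (hd0 ls))))) (M ^ 10)"
    using assms(8,9) hd0 by (intro computes_kern[of _ _ "length (hd0 ls)"]) (auto simp:
        length_unitsL_elem)
  have 2: "\<forall>b\<in>set (kernL is_zero ls (unitsL (emb R \<one>\<^bsub>R\<^esub>) (length (hd0 ls)))). length b < M"
    using length_kernL[OF length_unitsL_elem] hd0 by metis
  have "computes ?i ?vs ?v (900 * M ^ 14)"
    using M_ge M_pow_ge[of 14] assms hd0 2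
    by (intro computesI) (auto simp: nth_iso_program body_tryt_def tryL_def hd_em
        intro!: wp_callI[OF computes_cands] wp_callI[OF up[OF 1]] wp_callI[OF up[OF computes_units]]
          wp_callI[OF up[OF computes_zeros]])
  from computes_const[OF this] show ?thesis by simp
qed

lemma length_eqiL:
  assumes "\<forall>z\<in>set Es. length z = n" "length Es = n"
  shows "length (eqiL f g Es ws Es) \<le> length ws * (n * n)"
    "\<forall>l\<in>set (eqiL f g Es ws Es). length l = 2 * (n * n)"
proof -
  have "length (eqiL f g xs ws Es) \<le> length ws * (n * n)" for xs
  proof (induction ws arbitrary: xs)
    case (Cons w ws)
    then show ?case using assms(2) by (cases xs) (auto simp: eqiL_def length_eqjL)
  qed (simp add: eqiL_def)
  then show "length (eqiL f g Es ws Es) \<le> length ws * (n * n)" .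
  show "\<forall>l\<in>set (eqiL f g Es ws Es). length l = 2 * (n * n)"
    using assms by (auto simp: eqiL_def eqjL_def eqkL_def)
qed

lemma computes_tups:
  assumes "length f < M" "length g < M" "\<forall>x\<in>set V. length x = n" "length V < M" "length zv = n"
    "\<forall>cs\<in>set css. length cs < M" "length css < M" "\<forall>z\<in>set Es. length z = n" "length Es = n"
    "\<forall>ws\<in>set ts. length ws \<le> 40 \<and> (\<forall>z\<in>set ws. length z = n)" "length ts < M"
  shows "computes fn_tups [env, ev f, ev g, em Es, em V, em css, ev zv, encl em ts] (tt (tupsL f g
      Es V css zv ts)) (M ^ 20)"
    (is "computes ?i ?vs ?v _")
proof -
  note up = computes_raise[where d = 18]
  have "computes ?i ?vs ?v ((length ts + 1) * (900 * M ^ 18))"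
    using assms(10)
  proof (induction ts)
    case (Cons ws ts)
    have "length ws * (n * n) \<le> 40 * (n * n)" using Cons.prems by (intro mult_right_mono) auto
    then have "length (eqiL f g Es ws Es) < M"
      using length_eqiL(1)[OF assms(8,9), of f g ws] n_bounds(5) by linarith
    then show ?case using M_ge M_pow_ge[of 18] assms(1-9) Cons.prems n_bounds(1,3)
        length_eqiL(2)[OF assms(8,9), of f g ws]
      by (intro computesI) (auto simp: nth_iso_program body_tups_def
          intro!: wp_callI[OF Cons.IH] wp_callI[OF up[OF computes_try]] wp_callI[OF computes_eqi],
          auto simp: tupsL_def)
  qed (use M_ge M_pow_ge[of 18] in \<open>intro computesI; simp add: nth_iso_program body_tups_def
      tupsL_def\<close>)
  then show ?thesis using loop_bound[of _ _ _ _ 18] assms(11) by simp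
qed

end

section \<open>Result and cost of the whole program\<close>

lemma wp_unary [simp]: "wp P xs (unary k) Q \<longleftrightarrow> Q (enc_nat k) (2 * k + 1)"
  by (induction k arbitrary: Q) simp_all

lemma computes_elems: "computes fn_elems [enc_nat k] (encl enc_nat (rev [0..<k])) (20 * (k + 1))"
proof (induction k)
  case (Suc k)
  show ?case
    by (intro computesI) (auto simp: nth_iso_program body_elems_def simp del: One_nat_def intro!:
        wp_callI[OF Suc.IH])
qed (intro computesI; simp add: nth_iso_program[simplified] body_elems_def)

definition cubic_coeffs :: "nat \<Rightarrow> (nat multiset \<Rightarrow> 'a) \<Rightarrow> 'a list" where
  "cubic_coeffs n f = [f {#i, j, k#}. i \<leftarrow> [0..<n], j \<leftarrow> [i..<n], k \<leftarrow> [j..<n]]"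

lemma length_cubic_coeffs: "length (cubic_coeffs n f) \<le> n * (n * n)"
proof -
  have "length (cubic_coeffs n f) = (\<Sum>i\<leftarrow>[0..<n]. \<Sum>j\<leftarrow>[i..<n]. n - j)"
    by (simp add: cubic_coeffs_def length_concat comp_def)
  also have "\<dots> \<le> (\<Sum>i\<leftarrow>[0..<n]. n * n)"
  proof (rule sum_list_mono)
    fix i assume "i \<in> set [0..<n]"
    have "(\<Sum>j\<leftarrow>[i..<n]. n - j) \<le> (\<Sum>j\<leftarrow>[i..<n]. n)" by (rule sum_list_mono) simp
    also have "\<dots> = (n - i) * n" by (simp add: sum_list_triv)
    also have "\<dots> \<le> n * n" by (intro mult_right_mono) auto
    finally show "(\<Sum>j\<leftarrow>[i..<n]. n - j) \<le> n * n" .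
  qed
  also have "\<dots> = n * (n * n)" by (simp add: sum_list_triv)
  finally show ?thesis .
qed

lemma cubic_coeffs_map: "map c (cubic_coeffs n f) = cubic_coeffs n (\<lambda>m. c (f m))"
  by (simp add: cubic_coeffs_def map_concat comp_def)

context iso_run
begin

text \<open>The predicate decided by the program, detached from execution and cost; soundness and
  completeness are proved for it.\<close>

definition iso_test :: "prod_ring list \<Rightarrow> prod_ring list \<Rightarrow> bool" where
  "iso_test f g \<longleftrightarrow> tupsL f g (unitsL (emb R \<one>\<^bsub>R\<^esub>) n) (List.n_lists n els) (List.n_lists (169 * n)
      els)
     (replicate n 0) (List.n_lists 40 (List.n_lists n els))"

lemma length_els: "length els = q"
  by (simp add: els_def)

lemma computes_main3:
  assumes "length f < M" "length g < M" and q: "q \<noteq> 0" "q ^ (169 * n) < M" "q ^ (n * 40) < M"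
  shows "computes fn_main3 [env, enc_nat n, ev f, ev g] (tt (iso_test f g)) (M ^ 21)"
proof -
  note up = computes_raise[where d = 20]
  have qn: "q ^ n < M"
  proof -
    have "q ^ n \<le> q ^ (n * 40)" using q by (intro power_increasing) auto
    then show ?thesis using q(3) by simp
  qed
  have 1: "computes fn_units [env, enc_nat n] (em (unitsL (emb R \<one>\<^bsub>R\<^esub>) n)) (M ^ 4)"
    using computes_units[of "replicate n ()" "\<lambda>_. NIL"] n_bounds(1) by (simp add: enc_nat_encl)
  have 2: "computes fn_zeros [env, enc_nat n] (ev (replicate n 0)) (M ^ 2)"
    using computes_zeros[of "replicate n ()" "\<lambda>_. NIL"] n_bounds(1) by (simp add: enc_nat_encl)
  have 3: "computes fn_pw [enc_nat n, ev els] (em (List.n_lists n els)) (M ^ 6)"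
    using q qn q_less_M n_bounds(1) by (intro computes_pw) (auto simp: length_els)
  have 4: "computes fn_pw [enc_nat (169 * n), ev els] (em (List.n_lists (169 * n) els)) (M ^ 6)"
    using q q_less_M n_bounds(6) by (intro computes_pw) (auto simp: length_els)
  have 5: "computes fn_pw [enc_nat 40, em (List.n_lists n els)] (encl em (List.n_lists 40
      (List.n_lists n els))) (M ^ 6)"
    using q qn M_ge by (intro computes_pw) (auto simp: length_els length_n_lists simp flip:
        power_mult)
  have 6: "computes fn_rep [enc_nat 169, enc_nat n] (enc_nat (169 * n)) (M ^ 4)"
    using M_ge n_bounds(1) by (intro computes_rep) auto
  have 7: "computes fn_tups [env, ev f, ev g, em (unitsL (emb R \<one>\<^bsub>R\<^esub>) n), em (List.n_lists n els),
      em (List.n_lists (169 * n) els), ev (replicate n 0), encl em (List.n_lists 40 (List.n_lists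
          n els))]
      (tt (iso_test f g)) (M ^ 20)"
    unfolding iso_test_def using assms(1,2) q qn n_bounds(6)
    by (intro computes_tups) (auto simp: length_n_lists length_els length_unitsL_elem set_n_lists
        simp flip: power_mult)
  have "computes fn_main3 [env, enc_nat n, ev f, ev g] (tt (iso_test f g)) (900 * M ^ 20)"
    using M_ge M_pow_ge[of 20]
    by (intro computesI) (auto simp: nth_iso_program body_main3_def
        intro!: wp_callI[OF up[OF 1]] wp_callI[OF up[OF 2]] wp_callI[OF up[OF 3]] wp_callI[OF
            up[OF 4]]
          wp_callI[OF up[OF 5]] wp_callI[OF up[OF 6]] wp_callI[OF 7])
  from computes_const[OF this] show ?thesis by simp
qed

lemma computes_main:
  assumes fg: "\<And>m. f m \<in> carrier R" "\<And>m. g m \<in> carrier R"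
    and q: "q ^ (169 * n) < M" "q ^ (n * 40) < M"
  shows "computes fn_main (enc_input R q n f g)
    (tt (iso_test (cubic_coeffs n (\<lambda>m. emb R (f m))) (cubic_coeffs n (\<lambda>m. emb R (g m))))) (M ^ 24)"
proof -
  interpret field R by (rule field_R)
  have q0: "0 < q" using one_closed unfolding carrier_R by (cases q) auto
  have enc: "enc_cubic_form n h = ev (cubic_coeffs n (\<lambda>m. emb R (h m)))" if "\<And>m. h m \<in> carrier R"
      for h
  proof -
    have "ev (cubic_coeffs n (\<lambda>m. emb R (h m))) = enc_list (cubic_coeffs n (\<lambda>m. el (emb R (h m))))"
      by (simp add: encl_def cubic_coeffs_map)
    also have "(\<lambda>m. el (emb R (h m))) = (\<lambda>m. enc_nat (h m))"
      using that by (simp add: el_def cring_R)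
    finally show ?thesis by (simp add: enc_cubic_form_def cubic_coeffs_def)
  qed
  have len: "length (cubic_coeffs n h) < M" for h :: "nat multiset \<Rightarrow> prod_ring"
    using length_cubic_coeffs[of n h] n_bounds(4) by (simp add: mult.assoc)
  let ?f = "cubic_coeffs n (\<lambda>m. emb R (f m))" and ?g = "cubic_coeffs n (\<lambda>m. emb R (g m))"
  let ?a = "enc_table q (add R)" and ?m = "enc_table q (monoid.mult R)"
  note up = computes_raise[where d = 21]
  \<comment> \<open>The number 0 is here the name of an arbitrary element; cancelling this element
    in the equation leaves the zero of the ring.\<close>
  have z: "computes fn_find [ev els, ?a, NIL, NIL] (el 0) (M ^ 4)"
  proof -
    have "computes fn_find [ev els, ?a, enc_nat 0, enc_nat 0] (el 0) (M ^ 4)"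
      unfolding ev_els unfolding el_def
    proof (rule computes_find)
      have c0: "0 \<in> carrier R" using q0 by (simp add: carrier_R)
      then show "proj R 0 \<oplus>\<^bsub>R\<^esub> 0 = 0" by (simp add: proj_ops[OF cring_R])
      fix s assume "s \<in> set (rev [0..<q])" "s \<oplus>\<^bsub>R\<^esub> 0 = 0"
      then have s: "s \<in> carrier R" "s \<oplus>\<^bsub>R\<^esub> 0 = 0" by (simp_all add: carrier_R)
      then have "s = s \<oplus>\<^bsub>R\<^esub> 0 \<oplus>\<^bsub>R\<^esub> (\<ominus>\<^bsub>R\<^esub> 0)" using c0 by (simp add: a_assoc r_neg)
      also have "\<dots> = \<zero>\<^bsub>R\<^esub>" using s c0 by (simp add: r_neg)
      finally show "s = proj R 0" by (simp add: proj_ops[OF cring_R])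
    qed (use q0 q_less_M proj_less a_closed in \<open>auto simp: carrier_R\<close>)
    then show ?thesis by simp
  qed
  \<comment> \<open>The nonzero element that the conditional in \<open>body_main2\<close>
    selects.\<close>
  define x :: nat where "x = (if \<zero>\<^bsub>R\<^esub> = 0 then 1 else 0)"
  have x: "x \<in> carrier R" "x \<noteq> \<zero>\<^bsub>R\<^esub>"
  proof -
    have "\<zero>\<^bsub>R\<^esub> < q" "\<one>\<^bsub>R\<^esub> < q" "\<one>\<^bsub>R\<^esub> \<noteq> \<zero>\<^bsub>R\<^esub>"
      using zero_closed one_closed one_not_zero by (auto simp: carrier_R)
    then have "1 < q" by linarith
    then show "x \<in> carrier R" "x \<noteq> \<zero>\<^bsub>R\<^esub>" by (auto simp: x_def carrier_R)
  qed
  have o: "computes fn_find [ev els, ?m, enc_nat x, enc_nat x] (el (emb R \<one>\<^bsub>R\<^esub>)) (M ^ 4)"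
    unfolding ev_els unfolding el_def proj_emb_same[OF cring_R one_closed]
  proof (rule computes_find)
    show "\<one>\<^bsub>R\<^esub> \<otimes>\<^bsub>R\<^esub> x = x" using x by simp
    fix s assume "s \<in> set (rev [0..<q])" "s \<otimes>\<^bsub>R\<^esub> x = x"
    then show "s = \<one>\<^bsub>R\<^esub>"
      using x by (metis carrier_R lessThan_iff atLeastLessThan_upt atLeastLessThan_iff set_rev
          l_one m_rcancel one_closed)
  qed (use x q_less_M m_closed one_closed in \<open>auto simp: carrier_R\<close>)
  have 3: "computes fn_main3 [env, enc_nat n, ev ?f, ev ?g] (tt (iso_test ?f ?g)) (M ^ 21)"
    using q q0 len by (intro computes_main3) auto
  have "computes fn_main2 [enc_nat n, ev els, ?a, ?m, ev ?f, ev ?g, el 0] (tt (iso_test ?f ?g))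
      (900 * M ^ 21)"
  proof -
    have "el 0 = NIL \<longleftrightarrow> \<zero>\<^bsub>R\<^esub> = 0" by (simp add: el_def proj_ops[OF cring_R])
    moreover have "enc_nat x = (if \<zero>\<^bsub>R\<^esub> = 0 then CONS NIL NIL else NIL)" by (simp add: x_def)
    ultimately show ?thesis using M_ge M_pow_ge[of 21] o 3
      by (intro computesI) (auto simp: nth_iso_program body_main2_def env_def
          intro!: wp_callI[OF up[of fn_find]] wp_callI[of fn_main3])
  qed
  from computes_const[OF this]
  have 2: "computes fn_main2 [enc_nat n, ev els, ?a, ?m, ev ?f, ev ?g, el 0] (tt (iso_test ?f ?g))
      (M ^ 22)" by simp
  have "computes fn_main1 [enc_nat n, ev els, ?a, ?m, ev ?f, ev ?g] (tt (iso_test ?f ?g)) (900 * M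
      ^ 22)"
    using M_ge M_pow_ge[of 22]
    by (intro computesI) (auto simp: nth_iso_program body_main1_def
        intro!: wp_callI[OF computes_raise[where d = 22, OF z]] wp_callI[OF 2])
  from computes_const[OF this]
  have 1: "computes fn_main1 [enc_nat n, ev els, ?a, ?m, ev ?f, ev ?g] (tt (iso_test ?f ?g)) (M ^
      23)" by simp
  have 0: "computes fn_elems [enc_nat q] (ev els) (M ^ 2)"
    unfolding ev_els by (rule small_loop[OF computes_elems q_less_M])
  have "computes fn_main (enc_input R q n f g) (tt (iso_test ?f ?g)) (900 * M ^ 23)"
    using M_ge M_pow_ge[of 23]
    by (intro computesI) (auto simp: nth_iso_program body_main_def enc_input_def enc[OF fg(1)]
        enc[OF fg(2)]
        simp del: One_nat_def intro!: wp_callI[OF computes_raise[where d = 23, OF 0]] wp_callI[OF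
            1])
  from computes_const[OF this] show ?thesis by simp
qed

lemma iso_program_correct:
  assumes "\<And>m. f m \<in> carrier R" "\<And>m. g m \<in> carrier R" "q ^ (169 * n) < M" "q ^ (n * 40) < M"
  shows "halts_within iso_program (enc_input R q n f g) (M ^ 24)"
    "accepts iso_program (enc_input R q n f g) \<longleftrightarrow>
      iso_test (cubic_coeffs n (\<lambda>m. emb R (f m))) (cubic_coeffs n (\<lambda>m. emb R (g m)))"
proof -
  let ?t = "iso_test (cubic_coeffs n (\<lambda>m. emb R (f m))) (cubic_coeffs n (\<lambda>m. emb R (g m)))"
  have "computes fn_main (enc_input R q n f g) (tt ?t) (M ^ 24)" by (rule computes_main[OF assms])
  then obtain k where k: "run iso_program (enc_input R q n f g) (tt ?t) k" "k \<le> M ^ 24"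
    by (auto simp: computes_def wp_call_def wp_def run_def)
  then show "halts_within iso_program (enc_input R q n f g) (M ^ 24)"
    by (auto simp: halts_within_def)
  show "accepts iso_program (enc_input R q n f g) \<longleftrightarrow> ?t"
    using k(1) run_deterministic[OF k(1)] unfolding accepts_def by fastforce
qed

end

section \<open>Enumerating the kernel\<close>

lemma nth_vaddL [simp]: "i < length u \<Longrightarrow> i < length v \<Longrightarrow> vaddL u v ! i = u ! i + v ! i"
  by (simp add: vaddL_def)

lemma nth_scaleL [simp]: "i < length v \<Longrightarrow> scaleL c v ! i = c * v ! i"
  by (simp add: scaleL_def)

lemma dotL_sum: "length l = N \<Longrightarrow> length v = N \<Longrightarrow> dotL l v = (\<Sum>i<N. l ! i * v ! i)"
  by (simp add: dotL_def sum_list_sum_nth atLeast0LessThan)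

definition comb :: "nat \<Rightarrow> 'u :: comm_ring_1 list \<Rightarrow> 'u list list \<Rightarrow> 'u list" where
  "comb N cs bs = map (\<lambda>i. \<Sum>k<length bs. cs ! k * bs ! k ! i) [0..<N]"

lemma length_comb [simp]: "length (comb N cs bs) = N"
  by (simp add: comb_def)

lemma nth_comb: "i < N \<Longrightarrow> comb N cs bs ! i = (\<Sum>k<length bs. cs ! k * bs ! k ! i)"
  by (simp add: comb_def)

lemma nth_comb_Cons: "i < N \<Longrightarrow> comb N (a # cs) (c # bs) ! i = a * c ! i + comb N cs bs ! i"
  by (simp add: nth_comb sum.lessThan_Suc_shift del: sum.lessThan_Suc)

lemma lincombL_comb:
  "length bs \<le> length cs \<Longrightarrow> \<forall>b\<in>set bs. length b = N \<Longrightarrow> length acc = N \<Longrightarrow>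
    lincombL cs bs acc = vaddL acc (comb N cs bs)"
proof (induction cs bs acc rule: lincombL.induct)
  case (1 c cs b bs acc)
  then show ?case by (intro nth_equalityI) (auto simp: nth_comb_Cons)
qed (auto intro!: nth_equalityI simp: nth_comb)

context finite_subfield
begin

definition vecs :: "nat \<Rightarrow> 'u list set" where
  "vecs N = {v. set v \<subseteq> K \<and> length v = N}"

lemma finite_vecs [simp]: "finite (vecs N)"
  unfolding vecs_def by (rule finite_lists_length_eq) simp

lemma card_vecs: "card (vecs N) = q ^ N"
  unfolding vecs_def q_def by (rule card_lists_length_eq) simp

lemma vecsI: "length v = N \<Longrightarrow> (\<And>i. i < N \<Longrightarrow> v ! i \<in> K) \<Longrightarrow> v \<in> vecs N"
  by (auto simp: vecs_def in_set_conv_nth)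

lemma vecsD: "v \<in> vecs N \<Longrightarrow> length v = N" "v \<in> vecs N \<Longrightarrow> i < N \<Longrightarrow> v ! i \<in> K"
  by (auto simp: vecs_def)

lemma vaddL_vecs: "u \<in> vecs N \<Longrightarrow> v \<in> vecs N \<Longrightarrow> vaddL u v \<in> vecs N"
  by (intro vecsI) (auto simp: vecsD)

lemma scaleL_vecs: "c \<in> K \<Longrightarrow> v \<in> vecs N \<Longrightarrow> scaleL c v \<in> vecs N"
  by (intro vecsI) (auto simp: vecsD)

lemma dotL_K: "l \<in> vecs N \<Longrightarrow> v \<in> vecs N \<Longrightarrow> dotL l v \<in> K"
  by (auto simp: dotL_sum[of _ N] vecsD intro!: sum_K mult_K)

lemma comb_vecs: "cs \<in> vecs (length bs) \<Longrightarrow> set bs \<subseteq> vecs N \<Longrightarrow> comb N cs bs \<in> vecs N"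
proof (intro vecsI)
  fix i assume cs: "cs \<in> vecs (length bs)" and bs: "set bs \<subseteq> vecs N" and i: "i < N"
  have "cs ! k * bs ! k ! i \<in> K" if "k < length bs" for k
  proof -
    have "bs ! k \<in> vecs N" using bs nth_mem[OF that] by auto
    then show ?thesis by (intro mult_K vecsD(2)[OF cs that] vecsD(2)[OF _ i])
  qed
  then show "comb N cs bs ! i \<in> K" unfolding nth_comb[OF i] by (intro sum_K) simp
qed simp

lemma vecs_Suc: "v \<in> vecs (Suc N) \<longleftrightarrow> (\<exists>a u. v = a # u \<and> a \<in> K \<and> u \<in> vecs N)"
  by (cases v) (auto simp: vecs_def)

definition Span :: "nat \<Rightarrow> 'u list list \<Rightarrow> 'u list set" where
  "Span N bs = (\<lambda>cs. comb N cs bs) ` vecs (length bs)"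

text \<open>Stated as injectivity of the coefficient map, independence turns the length of a basis
  into the cardinality of its span, which is what the bound on the number of solutions is compared
  with.\<close>

definition indep :: "nat \<Rightarrow> 'u list list \<Rightarrow> bool" where
  "indep N bs \<longleftrightarrow> inj_on (\<lambda>cs. comb N cs bs) (vecs (length bs))"

lemma comb_Cons: "length c = N \<Longrightarrow> comb N (a # cs) (c # bs) = vaddL (scaleL a c) (comb N cs bs)"
  by (intro nth_equalityI) (auto simp: nth_comb_Cons)

lemma Span_Cons:
  assumes c: "length c = N"
  shows "v \<in> Span N (c # bs) \<longleftrightarrow> (\<exists>a\<in>K. \<exists>u\<in>Span N bs. v = vaddL (scaleL a c) u)"
proof -
  have "v \<in> Span N (c # bs) \<longleftrightarrow> (\<exists>a\<in>K. \<exists>cs\<in>vecs (length bs). v = comb N (a # cs) (c # bs))"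
    unfolding Span_def image_iff by (simp add: Bex_def vecs_Suc) blast
  then show ?thesis unfolding comb_Cons[OF c] by (simp add: Span_def)
qed

lemma Span_vecs: "set bs \<subseteq> vecs N \<Longrightarrow> Span N bs \<subseteq> vecs N"
  unfolding Span_def by (auto intro: comb_vecs)

lemma Span_scale: "s \<in> K \<Longrightarrow> u \<in> Span N bs \<Longrightarrow> scaleL s u \<in> Span N bs"
proof -
  assume s: "s \<in> K" and "u \<in> Span N bs"
  then obtain cs where cs: "cs \<in> vecs (length bs)" "u = comb N cs bs" by (auto simp: Span_def)
  have "scaleL s u = comb N (scaleL s cs) bs"
    unfolding cs using vecsD(1)[OF cs(1)]
    by (intro nth_equalityI) (auto simp: nth_comb sum_distrib_left mult.assoc)
  then show ?thesis unfolding Span_def using scaleL_vecs[OF s cs(1)] by blast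
qed

lemma indep_Cons:
  assumes c: "length c = N"
  shows "indep N (c # bs) \<longleftrightarrow> indep N bs \<and> (\<forall>a\<in>K. \<forall>a'\<in>K. \<forall>u\<in>Span N bs. \<forall>u'\<in>Span N bs.
    vaddL (scaleL a c) u = vaddL (scaleL a' c) u' \<longrightarrow> a = a' \<and> u = u')" (is "_ \<longleftrightarrow> _ \<and> ?P")
proof
  assume ind: "indep N (c # bs)"
  have *: "a = a' \<and> cs = cs'" if "a \<in> K" "a' \<in> K" "cs \<in> vecs (length bs)" "cs' \<in> vecs (length bs)"
    "vaddL (scaleL a c) (comb N cs bs) = vaddL (scaleL a' c) (comb N cs' bs)" for a a' cs cs'
  proof -
    have "comb N (a # cs) (c # bs) = comb N (a' # cs') (c # bs)"
      unfolding comb_Cons[OF c] by (rule that(5))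
    moreover have "a # cs \<in> vecs (length (c # bs))" "a' # cs' \<in> vecs (length (c # bs))"
      using that(1-4) by (simp_all add: vecs_Suc)
    ultimately have "a # cs = a' # cs'" using ind unfolding indep_def by (blast dest: inj_onD)
    then show ?thesis by simp
  qed
  show "indep N bs \<and> ?P"
  proof
    show "indep N bs" unfolding indep_def by (rule inj_onI) (metis * zero_K)
    show ?P unfolding Span_def using * by blast
  qed
next
  assume "indep N bs \<and> ?P"
  then have inj: "inj_on (\<lambda>cs. comb N cs bs) (vecs (length bs))" and P: ?P by (auto simp: indep_def)
  show "indep N (c # bs)"
    unfolding indep_def
  proof (rule inj_onI)
    fix x y assume "x \<in> vecs (length (c # bs))" "y \<in> vecs (length (c # bs))"
      and eq: "comb N x (c # bs) = comb N y (c # bs)"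
    then obtain a cs a' cs' where xy: "x = a # cs" "y = a' # cs'" "a \<in> K" "a' \<in> K"
      "cs \<in> vecs (length bs)" "cs' \<in> vecs (length bs)" by (auto simp: vecs_Suc)
    have "comb N cs bs \<in> Span N bs" "comb N cs' bs \<in> Span N bs" using xy by (simp_all add: Span_def)
    moreover have "vaddL (scaleL a c) (comb N cs bs) = vaddL (scaleL a' c) (comb N cs' bs)"
      using eq unfolding xy(1,2) comb_Cons[OF c] .
    ultimately have "a = a' \<and> comb N cs bs = comb N cs' bs" using P xy(3,4) by blast
    then show "x = y" using inj_onD[OF inj, of cs cs'] xy by simp
  qed
qed

lemma dotL_comb:
  assumes "length l = N" "set bs \<subseteq> vecs N"
  shows "dotL l (comb N cs bs) = (\<Sum>k<length bs. cs ! k * dotL l (bs ! k))"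
proof -
  have "dotL l (comb N cs bs) = (\<Sum>i<N. \<Sum>k<length bs. cs ! k * (l ! i * bs ! k ! i))"
    using assms by (simp add: dotL_sum[of _ N] nth_comb sum_distrib_left mult_ac)
  also have "\<dots> = (\<Sum>k<length bs. cs ! k * dotL l (bs ! k))"
    unfolding sum_distrib_left
    by (subst sum.swap, intro sum.cong refl)
      (use assms in \<open>auto simp: dotL_sum[of _ N] vecsD(1)[of _ N] subset_iff sum_distrib_left\<close>)
  finally show ?thesis .
qed

lemma dotL_add: "length l = N \<Longrightarrow> length u = N \<Longrightarrow> length v = N \<Longrightarrow> dotL l (vaddL u v) = dotL l u + dotL
    l v"
  by (simp add: dotL_sum[of _ N] distrib_left sum.distrib)

lemma dotL_scale: "length l = N \<Longrightarrow> length v = N \<Longrightarrow> dotL l (scaleL a v) = a * dotL l v"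
  by (simp add: dotL_sum[of _ N] sum_distrib_left mult_ac)

text \<open>The coefficients \<open>d\<close> stay the same: elimination applies the linear map that
  sends \<open>u\<close> to \<open>s u - (l u) c\<close>, and this commutes with taking
  combinations.\<close>

lemma comb_elimL:
  assumes "length l = N" "set bs \<subseteq> vecs N" "length c = N"
  shows "comb N d (elimL l c s bs) = vaddL (scaleL (- dotL l (comb N d bs)) c) (scaleL s (comb N d
      bs))"
proof (rule nth_equalityI)
  fix i assume "i < length (comb N d (elimL l c s bs))"
  then have i: "i < N" by simp
  have len: "length (bs ! k) = N" if "k < length bs" for k
    using assms(2) that nth_mem vecsD(1) by blast
  have "comb N d (elimL l c s bs) ! i = (\<Sum>k<length bs. d ! k * (s * bs ! k ! i + - dotL l (bs ! k)
      * c ! i))"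
    using i assms(3) len by (simp add: nth_comb elimL_def)
  also have "\<dots> = s * comb N d bs ! i + - dotL l (comb N d bs) * c ! i"
    using i by (simp add: nth_comb dotL_comb[OF assms(1,2)] sum_distrib_left sum_distrib_right
        sum_subtractf algebra_simps)
  finally show "comb N d (elimL l c s bs) ! i
      = vaddL (scaleL (- dotL l (comb N d bs)) c) (scaleL s (comb N d bs)) ! i"
    using i assms(3) by (simp add: add.commute)
qed (use assms in simp)

lemma length_elimL_eq [simp]: "length (elimL l c s bs) = length bs"
  by (simp add: elimL_def)

text \<open>At the first vector \<open>c\<close> with \<open>s = dotL l c\<close> nonzero, the map
  that sends \<open>u\<close> to \<open>s u - (l u) c\<close> takes the span of the remaining
  vectors onto the kernel of \<open>l\<close> in the span that includes \<open>c\<close>, and it is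
  injective if the vectors are independent. Vectors in the kernel that precede \<open>c\<close> are
  handled by the induction.\<close>

lemma stepL_correct:
  assumes Z: "\<And>a. a \<in> K \<Longrightarrow> Z a \<longleftrightarrow> a = 0" and l: "l \<in> vecs N" and bs: "set bs \<subseteq> vecs N"
  shows "Span N (stepL Z l bs) = {v \<in> Span N bs. dotL l v = 0} \<and>
    (indep N bs \<longrightarrow> indep N (stepL Z l bs)) \<and> set (stepL Z l bs) \<subseteq> vecs N"
  using bs
proof (induction bs)
  case Nil
  have "dotL l v = 0" if "v \<in> Span N []" for v
    using that vecsD(1)[OF l] by (auto simp: Span_def dotL_sum[of _ N] nth_comb)
  then show ?case by auto
next
  case (Cons c bs)
  then have c: "c \<in> vecs N" and bs: "set bs \<subseteq> vecs N" by auto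
  note lenc = vecsD(1)[OF c] and lenl = vecsD(1)[OF l]
  have lenu: "length u = N" if "u \<in> Span N bs" for u
    using that Span_vecs[OF bs] vecsD(1) by blast
  have IH: "Span N (stepL Z l bs) = {v \<in> Span N bs. dotL l v = 0}"
    "indep N bs \<Longrightarrow> indep N (stepL Z l bs)" "set (stepL Z l bs) \<subseteq> vecs N"
    using Cons.IH[OF bs] by auto
  define s where "s = dotL l c"
  have s: "s \<in> K" unfolding s_def by (rule dotL_K[OF l c])
  have dot: "dotL l (vaddL (scaleL a c) u) = a * s + dotL l u" if "u \<in> Span N bs" for a u
    using lenu[OF that] lenc lenl by (simp add: dotL_add[of _ N] dotL_scale[of _ N] s_def)
  show ?case
  proof (cases "s = 0")
    case True
    then have step: "stepL Z l (c # bs) = c # stepL Z l bs" using Z[OF s] by (simp add: s_def)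
    have "Span N (c # stepL Z l bs) = {v \<in> Span N (c # bs). dotL l v = 0}"
    proof -
      have "dotL l (vaddL (scaleL a c) u) = dotL l u" if "u \<in> Span N bs" for a u
        using dot[OF that] True by simp
      note dot' = this
      show ?thesis
      proof (intro equalityI subsetI)
        fix v assume "v \<in> Span N (c # stepL Z l bs)"
        then obtain a u where v: "a \<in> K" "u \<in> Span N bs" "dotL l u = 0" "v = vaddL (scaleL a c) u"
          unfolding Span_Cons[OF lenc] IH(1) by blast
        then have "v \<in> Span N (c # bs)" unfolding Span_Cons[OF lenc] by blast
        then show "v \<in> {v \<in> Span N (c # bs). dotL l v = 0}" using v dot' by simp
      next
        fix v assume "v \<in> {v \<in> Span N (c # bs). dotL l v = 0}"
        then have "v \<in> Span N (c # bs)" "dotL l v = 0" by auto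
        then obtain a u where v: "a \<in> K" "u \<in> Span N bs" "v = vaddL (scaleL a c) u"
          unfolding Span_Cons[OF lenc] by blast
        then have "u \<in> {v \<in> Span N bs. dotL l v = 0}" using dot' \<open>dotL l v = 0\<close> by simp
        then show "v \<in> Span N (c # stepL Z l bs)" unfolding Span_Cons[OF lenc] IH(1) using v by
            blast
      qed
    qed
    moreover have "indep N (c # stepL Z l bs)" if "indep N (c # bs)"
    proof -
      have "indep N bs" and inj: "\<And>a a' u u'. a \<in> K \<Longrightarrow> a' \<in> K \<Longrightarrow> u \<in> Span N bs \<Longrightarrow> u' \<in> Span N bs \<Longrightarrow>
          vaddL (scaleL a c) u = vaddL (scaleL a' c) u' \<Longrightarrow> a = a' \<and> u = u'"
        using that unfolding indep_Cons[OF lenc] by simp_all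
      then show ?thesis unfolding indep_Cons[OF lenc] IH(1) using IH(2)
        by (intro conjI ballI impI inj) auto
    qed
    ultimately show ?thesis unfolding step using c IH(3) by auto
  next
    case False
    obtain s' where s': "s' \<in> K" "s' * s = e" using inverse_ex[OF s False] by blast
    have step: "stepL Z l (c # bs) = elimL l c s bs" using Z[OF s] False by (simp add: s_def)
    have Span: "Span N (elimL l c s bs) = (\<lambda>u. vaddL (scaleL (- dotL l u) c) (scaleL s u)) ` Span
        N bs"
      unfolding Span_def image_image by (simp add: comb_elimL[OF lenl bs lenc])
    have "Span N (elimL l c s bs) = {v \<in> Span N (c # bs). dotL l v = 0}"
    proof (intro equalityI subsetI)
      fix v assume "v \<in> Span N (elimL l c s bs)"
      then obtain u where u: "u \<in> Span N bs" "v = vaddL (scaleL (- dotL l u) c) (scaleL s u)"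
        unfolding Span by auto
      have "- dotL l u \<in> K" using dotL_K[OF l] Span_vecs[OF bs] u by auto
      moreover have "scaleL s u \<in> Span N bs" by (rule Span_scale[OF s u(1)])
      moreover have "dotL l v = 0"
        unfolding u(2) dot[OF Span_scale[OF s u(1)]] using lenu[OF u(1)] lenl
        by (simp add: dotL_scale[of _ N] mult.commute)
      ultimately show "v \<in> {v \<in> Span N (c # bs). dotL l v = 0}"
        using u(2) by (auto simp: Span_Cons[OF lenc])
    next
      fix v assume "v \<in> {v \<in> Span N (c # bs). dotL l v = 0}"
      then obtain a u where v: "v = vaddL (scaleL a c) u" "a \<in> K" "u \<in> Span N bs" "a * s + dotL l
          u = 0"
        using dot by (auto simp: Span_Cons[OF lenc])
      have lu: "dotL l u = - (a * s)" using v(4) by (simp add: eq_neg_iff_add_eq_0 add.commute)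
      \<comment> \<open>Division by the pivot value yields the preimage: from
        \<open>l u = - a s\<close> it follows that \<open>- l (s' u) = a\<close>, while
        \<open>s (s' u) = u\<close>.\<close>
      have u': "scaleL s' u \<in> Span N bs" by (rule Span_scale[OF s'(1) v(3)])
      have "- dotL l (scaleL s' u) = a * (s' * s)"
        using lenu[OF v(3)] lenl by (simp add: dotL_scale[of _ N] lu mult_ac)
      then have "- dotL l (scaleL s' u) = a" using s' v(2) mult_e by simp
      moreover have "scaleL s (scaleL s' u) = u"
      proof (rule nth_equalityI)
        fix i assume "i < length (scaleL s (scaleL s' u))"
        then have i: "i < N" "i < length u" using lenu[OF v(3)] by auto
        have "u ! i \<in> K" using Span_vecs[OF bs] v(3) vecsD(2) i by blast
        then have "s' * s * u ! i = u ! i" using s' e_mult by simp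
        then show "scaleL s (scaleL s' u) ! i = u ! i" using i by (simp add: mult_ac)
      qed simp
      ultimately show "v \<in> Span N (elimL l c s bs)" unfolding Span v(1) using u' by (intro
          image_eqI) auto
    qed
    moreover have "indep N (elimL l c s bs)" if ind: "indep N (c # bs)"
      unfolding indep_def
    proof (rule inj_onI)
      fix d d' assume d: "d \<in> vecs (length (elimL l c s bs))" "d' \<in> vecs (length (elimL l c s bs))"
        and eq: "comb N d (elimL l c s bs) = comb N d' (elimL l c s bs)"
      let ?u = "comb N d bs" and ?u' = "comb N d' bs"
      have u: "?u \<in> Span N bs" "?u' \<in> Span N bs" using d by (auto simp: Span_def)
      have "- dotL l ?u \<in> K" "- dotL l ?u' \<in> K" using dotL_K[OF l] Span_vecs[OF bs] u by auto
      moreover have "\<And>a a' u u'. a \<in> K \<Longrightarrow> a' \<in> K \<Longrightarrow> u \<in> Span N bs \<Longrightarrow> u' \<in> Span N bs \<Longrightarrow>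
          vaddL (scaleL a c) u = vaddL (scaleL a' c) u' \<Longrightarrow> a = a' \<and> u = u'"
        using ind unfolding indep_Cons[OF lenc] by simp
      ultimately have "scaleL s ?u = scaleL s ?u'"
        using eq Span_scale[OF s u(1)] Span_scale[OF s u(2)] unfolding comb_elimL[OF lenl bs lenc]
            by metis
      have "?u = ?u'"
      proof (rule nth_equalityI)
        fix i assume "i < length ?u"
        then have i: "i < N" by simp
        have "s * ?u ! i = s * ?u' ! i"
          using arg_cong[OF \<open>scaleL s ?u = scaleL s ?u'\<close>, of "\<lambda>v. v ! i"] i by simp
        then have "s' * s * ?u ! i = s' * s * ?u' ! i" by (simp add: mult.assoc)
        moreover have "?u ! i \<in> K" "?u' ! i \<in> K" using Span_vecs[OF bs] u i vecsD(2) by blast+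
        ultimately show "?u ! i = ?u' ! i" using s' e_mult by simp
      qed simp
      moreover have "indep N bs" using ind unfolding indep_Cons[OF lenc] by simp
      ultimately show "d = d'" using d unfolding indep_def by (simp add: inj_onD)
    qed
    moreover have "set (elimL l c s bs) \<subseteq> vecs N"
      using bs s c l by (auto simp: elimL_def intro!: vaddL_vecs scaleL_vecs uminus_K dotL_K)
    ultimately show ?thesis unfolding step by blast
  qed
qed

lemma kernL_correct:
  assumes Z: "\<And>a. a \<in> K \<Longrightarrow> Z a \<longleftrightarrow> a = 0" and "set ls \<subseteq> vecs N" "set bs \<subseteq> vecs N"
  shows "Span N (kernL Z ls bs) = {v \<in> Span N bs. \<forall>l\<in>set ls. dotL l v = 0} \<and>
    (indep N bs \<longrightarrow> indep N (kernL Z ls bs)) \<and> set (kernL Z ls bs) \<subseteq> vecs N"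
  using assms(2,3)
proof (induction ls arbitrary: bs)
  case (Cons l ls)
  then have l: "l \<in> vecs N" "set ls \<subseteq> vecs N" by auto
  note st = stepL_correct[of Z l N bs, OF Z l(1) Cons.prems(2)]
  show ?case using Cons.IH[OF l(2), of "stepL Z l bs"] st by auto
qed simp

lemma unitsL_correct: "Span N (unitsL e N) = vecs N" "indep N (unitsL e N)" "set (unitsL e N) \<subseteq>
    vecs N"
proof -
  have id: "comb N cs (unitsL e N) = cs" if "cs \<in> vecs N" for cs
  proof (rule nth_equalityI)
    fix i assume "i < length (comb N cs (unitsL e N))"
    then have i: "i < N" by simp
    have "comb N cs (unitsL e N) ! i = (\<Sum>k<N. cs ! k * (if i = k then e else 0))"
      using i by (simp add: nth_comb unitsL_def)
    also have "\<dots> = (\<Sum>k<N. if i = k then cs ! k * e else 0)" by (intro sum.cong) auto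
    also have "\<dots> = cs ! i" using i vecsD(2)[OF that i] mult_e by simp
    finally show "comb N cs (unitsL e N) ! i = cs ! i" .
  qed (simp add: vecsD(1)[OF that])
  have len: "length (unitsL e N) = N" by (simp add: unitsL_def)
  show "Span N (unitsL e N) = vecs N" unfolding Span_def len using id by (auto simp: image_iff)
  show "indep N (unitsL e N)" unfolding indep_def len by (rule inj_onI) (simp add: id)
  show "set (unitsL e N) \<subseteq> vecs N" by (auto simp: unitsL_def vecs_def)
qed

text \<open>An independent list that spans at most \<open>q^m\<close> vectors has at most
  \<open>m\<close> members, so every solution is reached by a coefficient vector that is padded with
  zeros to length \<open>m\<close>.\<close>

lemma kernel_enumeration:
  assumes Z: "\<And>a. a \<in> K \<Longrightarrow> Z a \<longleftrightarrow> a = 0" and ls: "set ls \<subseteq> vecs N"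
    and v: "v \<in> vecs N" "\<forall>l\<in>set ls. dotL l v = 0"
    and card: "card {v \<in> vecs N. \<forall>l\<in>set ls. dotL l v = 0} \<le> q ^ m"
  shows "\<exists>cs\<in>vecs m. lincombL cs (kernL Z ls (unitsL e N)) (replicate N 0) = v"
proof -
  define bs where "bs = kernL Z ls (unitsL e N)"
  have bs: "Span N bs = {v \<in> vecs N. \<forall>l\<in>set ls. dotL l v = 0}" "indep N bs" "set bs \<subseteq> vecs N"
    using kernL_correct[of Z ls N "unitsL e N", OF Z ls unitsL_correct(3)] unitsL_correct[of N]
    unfolding bs_def by auto
  have "card (Span N bs) = q ^ length bs"
    using bs(2) unfolding indep_def Span_def by (simp add: card_image card_vecs)
  with card bs(1) have "q ^ length bs \<le> q ^ m" by simp
  then have m: "length bs \<le> m" using q_ge_3 by simp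
  from v bs(1) have "v \<in> Span N bs" by auto
  then obtain cs where cs: "cs \<in> vecs (length bs)" "v = comb N cs bs" by (auto simp: Span_def)
  let ?cs = "cs @ replicate (m - length bs) 0"
  have "?cs \<in> vecs m" using cs m by (auto simp: vecs_def)
  moreover have "lincombL ?cs bs (replicate N 0) = v"
  proof -
    have "lincombL ?cs bs (replicate N 0) = vaddL (replicate N 0) (comb N ?cs bs)"
      using bs(3) vecsD(1)[OF cs(1)] by (intro lincombL_comb) (auto simp: vecs_def)
    also have "\<dots> = comb N cs bs"
      using vecsD(1)[OF cs(1)] by (intro nth_equalityI) (auto simp: nth_comb nth_append)
    finally show ?thesis using cs by simp
  qed
  ultimately show ?thesis unfolding bs_def by blast
qed

lemma lincombL_vecs:
  "set cs \<subseteq> K \<Longrightarrow> set bs \<subseteq> vecs N \<Longrightarrow> acc \<in> vecs N \<Longrightarrow> lincombL cs bs acc \<in> vecs N"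
  by (induction cs bs acc rule: lincombL.induct) (auto simp: vaddL_vecs scaleL_vecs)

lemma kernL_vecs:
  assumes "\<And>a. a \<in> K \<Longrightarrow> Z a \<longleftrightarrow> a = 0" "set ls \<subseteq> vecs N"
  shows "set (kernL Z ls (unitsL e N)) \<subseteq> vecs N"
  using kernL_correct[of Z ls N "unitsL e N"] assms unitsL_correct by blast

end

section \<open>Cubic forms as functions\<close>

text \<open>The coefficient of a monomial is placed at its sorted index triple only, so that sums
  over all triples count it once.\<close>

definition upper :: "(nat multiset \<Rightarrow> 'u) \<Rightarrow> nat \<Rightarrow> nat \<Rightarrow> nat \<Rightarrow> 'u :: comm_ring_1" where
  "upper c i j k = (if i \<le> j \<and> j \<le> k then c {#i, j, k#} else 0)"

definition cform :: "nat \<Rightarrow> (nat multiset \<Rightarrow> 'u) \<Rightarrow> (nat \<Rightarrow> 'u) \<Rightarrow> 'u :: comm_ring_1" where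
  "cform n c x = (\<Sum>i<n. \<Sum>j<n. \<Sum>k<n. upper c i j k * (x i * x j * x k))"

definition polar :: "nat \<Rightarrow> (nat multiset \<Rightarrow> 'u) \<Rightarrow> (nat \<Rightarrow> 'u) \<Rightarrow> (nat \<Rightarrow> 'u) \<Rightarrow> (nat \<Rightarrow> 'u) \<Rightarrow> 'u ::
    comm_ring_1" where
  "polar n c x y z = (\<Sum>i<n. \<Sum>j<n. \<Sum>k<n. upper c i j k *
     (x i * y j * z k + x i * z j * y k + y i * x j * z k + y i * z j * x k + z i * x j * y k + z
       i * y j * x k))"

text \<open>The summands are grouped as in \<open>polarL\<close>, so that the value computed by the
  program is rewritten into \<open>polar\<close> without rearrangement.\<close>

lemma polar_eq:
  "polar n c x y z = cform n c (\<lambda>i. x i + y i + z i) + cform n c x + (cform n c y + cform n c z)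
    + - (cform n c (\<lambda>i. x i + y i) + cform n c (\<lambda>i. x i + z i) + cform n c (\<lambda>i. y i + z i))"
  unfolding polar_def cform_def sum.distrib[symmetric] sum_negf[symmetric]
  by (intro sum.cong refl) (simp add: algebra_simps)

lemma polar_swap: "polar n c x y z = polar n c x z y" "polar n c x y z = polar n c y x z"
  unfolding polar_def by (intro sum.cong refl arg_cong2[where f = "(*)"], simp add: algebra_simps)+

lemma polar_cong:
  assumes "\<And>i. i < n \<Longrightarrow> x i = x' i" "\<And>i. i < n \<Longrightarrow> y i = y' i" "\<And>i. i < n \<Longrightarrow> z i = z' i"
  shows "polar n c x y z = polar n c x' y' z'"
  unfolding polar_def using assms by (intro sum.cong refl) simp

lemma cform_cong: "(\<And>i. i < n \<Longrightarrow> x i = x' i) \<Longrightarrow> cform n c x = cform n c x'"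
  unfolding cform_def by (intro sum.cong refl) simp

lemma polar_sum:
  "polar n c x y (\<lambda>i. \<Sum>p\<in>S. a p * w p i) = (\<Sum>p\<in>S. a p * polar n c x y (w p))"
proof (induction S rule: infinite_finite_induct)
  case (insert p S)
  have lin: "polar n c x y (\<lambda>i. b * z i + z' i) = b * polar n c x y z + polar n c x y z'" for b z z'
    unfolding polar_def sum_distrib_left sum.distrib[symmetric]
    by (intro sum.cong refl) (simp add: algebra_simps)
  show ?case using insert by (simp add: lin)
qed (simp_all add: polar_def)

lemma duoL_map: "duoL (map x [a..<n]) = concat (map (\<lambda>j. map (\<lambda>k. x j * x k) [j..<n]) [a..<n])"
proof (induction "n - a" arbitrary: a)
  case (Suc d)
  then have "a < n" "d = n - Suc a" by auto
  then show ?case using Suc.hyps(1)[of "Suc a"] by (simp add: upt_conv_Cons scaleL_def comp_def)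
qed simp

text \<open>The monomials appear in the same order as the coefficients in the encoding of the input,
  which makes evaluation a scalar product.\<close>

lemma triL_map:
  "triL (map x [a..<n]) = concat (map (\<lambda>i. concat (map (\<lambda>j. map (\<lambda>k. x i * (x j * x k)) [j..<n])
      [i..<n])) [a..<n])"
proof (induction "n - a" arbitrary: a)
  case (Suc d)
  then have a: "a < n" "d = n - Suc a" by auto
  have "triL (map x [a..<n]) = scaleL (x a) (duoL (map x [a..<n])) @ triL (map x [Suc a..<n])"
    using a by (simp add: upt_conv_Cons)
  also have "scaleL (x a) (duoL (map x [a..<n])) = concat (map (\<lambda>j. map (\<lambda>k. x a * (x j * x k))
      [j..<n]) [a..<n])"
    unfolding duoL_map scaleL_def by (simp add: map_concat comp_def)
  finally show ?case using Suc.hyps(1)[OF a(2)] a by (simp add: upt_conv_Cons)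
qed simp

lemma dotL_append: "length u = length v \<Longrightarrow> dotL (u @ u') (v @ v') = dotL u v + dotL u' v'"
  by (simp add: dotL_def)

lemma dotL_concat:
  "(\<And>i. i \<in> set is \<Longrightarrow> length (f i) = length (g i)) \<Longrightarrow>
    dotL (concat (map f is)) (concat (map g is)) = (\<Sum>i\<leftarrow>is. dotL (f i) (g i))"
  by (induction "is") (simp_all add: dotL_append)

lemma dotL_map: "dotL (map f is) (map g is) = (\<Sum>i\<leftarrow>is. f i * g i)"
  by (induction "is") simp_all

lemma sum_list_upt: "(\<Sum>j\<leftarrow>[i..<n]. h j) = (\<Sum>j<n. if i \<le> j then h j else 0)" for h :: "nat \<Rightarrow> 'u ::
    comm_monoid_add"
proof -
  have "(\<Sum>j\<leftarrow>[i..<n]. h j) = sum h {i..<n}" by (simp add: sum_list_distinct_conv_sum_set)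
  also have "{i..<n} = {j \<in> {..<n}. i \<le> j}" by auto
  also have "sum h {j \<in> {..<n}. i \<le> j} = (\<Sum>j<n. if i \<le> j then h j else 0)"
    by (rule sum.inter_filter) simp
  finally show ?thesis .
qed

lemma evalL_cform: "evalL (cubic_coeffs n c) (map x [0..<n]) = cform n c x"
proof -
  have len: "length (concat (map (\<lambda>j. map (\<lambda>k. p j k) [j..<n]) js)) = length (concat (map (\<lambda>j. map
      (\<lambda>k. p' j k) [j..<n]) js))"
    for p p' :: "nat \<Rightarrow> nat \<Rightarrow> 'a" and js
    by (simp add: length_concat comp_def)
  have "evalL (cubic_coeffs n c) (map x [0..<n])
      = (\<Sum>i\<leftarrow>[0..<n]. \<Sum>j\<leftarrow>[i..<n]. \<Sum>k\<leftarrow>[j..<n]. c {#i, j, k#} * (x i * (x j * x k)))"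
    unfolding evalL_def cubic_coeffs_def triL_map
    by (subst dotL_concat, rule len, subst dotL_concat, simp, subst dotL_map, rule refl)
  also have "\<dots> = cform n c x"
    unfolding sum_list_upt cform_def upper_def
    by (intro sum.cong refl) (auto intro!: sum.cong sum.neutral simp: mult.assoc)
  finally show ?thesis .
qed

lemma vaddL_map: "vaddL (map x xs) (map y xs) = map (\<lambda>i. x i + y i) xs"
  by (induction xs) simp_all

lemma polarL_polar:
  "polarL (cubic_coeffs n c) (map x [0..<n]) (map y [0..<n]) (map z [0..<n]) = polar n c x y z"
  unfolding polarL_def vaddL_map evalL_cform polar_eq ..

context finite_subfield
begin

definition unitv :: "nat \<Rightarrow> nat \<Rightarrow> 'u" where
  "unitv i = (\<lambda>j. if j = i then e else 0)"

text \<open>Each of the six summands contributes one ordering of the indices, and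
  \<open>upper\<close> keeps the sorted ones. The number of orderings that are sorted, 1, 2 or 6, is
  the factor \<open>mult3\<close>.\<close>

lemma polar_unitv:
  assumes c: "c \<in> cubics n" and ijk: "i < n" "j < n" "k < n"
  shows "polar n c (unitv i) (unitv j) (unitv k) = tau c i j k"
proof -
  have cK: "c m \<in> K" for m using c by (simp add: cubics_def)
  have one: "(\<Sum>a<n. \<Sum>b<n. \<Sum>d<n. upper c a b d * (unitv i a * unitv j b * unitv k d)) = upper c i j
      k"
    if "i < n" "j < n" "k < n" for i j k
  proof -
    have "(\<Sum>a<n. \<Sum>b<n. \<Sum>d<n. upper c a b d * (unitv i a * unitv j b * unitv k d))
       = (\<Sum>a<n. \<Sum>b<n. \<Sum>d<n. if i = a \<and> j = b \<and> k = d then upper c a b d else 0)"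
    proof (intro sum.cong refl)
      fix a b d
      have "upper c a b d * (e * e * e) = upper c a b d"
        using cK[of "{#a, b, d#}"] e_mult by (auto simp: upper_def mult_e)
      then show "upper c a b d * (unitv i a * unitv j b * unitv k d)
          = (if i = a \<and> j = b \<and> k = d then upper c a b d else 0)"
        by (auto simp: unitv_def)
    qed
    also have "\<dots> = upper c i j k" using that by (intro sum_delta3) auto
    finally show ?thesis .
  qed
  have "polar n c (unitv i) (unitv j) (unitv k) = upper c i j k + upper c i k j + upper c j i k
      + upper c j k i + upper c k i j + upper c k j i"
    unfolding polar_def distrib_left sum.distrib using ijk by (simp add: one)
  also have "\<dots> = tau c i j k"
  proof -
    have m: "{#i, k, j#} = {#i, j, k#}" "{#j, i, k#} = {#i, j, k#}" "{#j, k, i#} = {#i, j, k#}"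
      "{#k, i, j#} = {#i, j, k#}" "{#k, j, i#} = {#i, j, k#}"
      by (simp_all add: add_mset_commute)
    show ?thesis unfolding upper_def tau_def mult3_def m
      by (cases "i \<le> j"; cases "j \<le> k"; cases "i \<le> k"; auto)
  qed
  finally show ?thesis .
qed

lemma cform_unitv: "c \<in> cubics n \<Longrightarrow> i < n \<Longrightarrow> cform n c (unitv i) = c {#i, i, i#}"
proof -
  assume c: "c \<in> cubics n" and i: "i < n"
  have cK: "c m \<in> K" for m using c by (simp add: cubics_def)
  have "cform n c (unitv i) = (\<Sum>a<n. \<Sum>b<n. \<Sum>d<n. if i = a \<and> i = b \<and> i = d then c {#a, b, d#} else
      0)"
    unfolding cform_def
  proof (intro sum.cong refl)
    fix a b d
    have "c {#i, i, i#} * (e * e * e) = c {#i, i, i#}"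
      using cK[of "{#i, i, i#}"] e_mult by (auto simp: mult_e)
    then show "upper c a b d * (unitv i a * unitv i b * unitv i d)
        = (if i = a \<and> i = b \<and> i = d then c {#a, b, d#} else 0)"
      by (auto simp: unitv_def upper_def)
  qed
  also have "\<dots> = c {#i, i, i#}" using i by (intro sum_delta3) auto
  finally show ?thesis .
qed

text \<open>In general, polynomials over a small field are not determined by their values. For cubic
  forms, the polarisation at unit vectors yields the coefficients of all monomials with at least two
  different variables, up to the factor 2, which can be cancelled because the order is odd. The
  coefficients of the cubes are read off as values at unit vectors, since their factor 6 vanishes in
  characteristic 3.\<close>

lemma cform_inject:
  assumes c: "c \<in> cubics n" and d: "d \<in> cubics n"
    and eq: "\<And>x. (\<And>i. i < n \<Longrightarrow> x i \<in> K) \<Longrightarrow> cform n c x = cform n d x"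
  shows "c = d"
proof
  fix m
  show "c m = d m"
  proof (cases "m \<in> monomials3 n")
    case False
    then show ?thesis using c d by (simp add: cubics_def)
  next
    case True
    obtain xs where "mset xs = m" by (metis ex_mset)
    moreover from this True have "length xs = 3" by (auto simp: monomials3_def)
    ultimately obtain i j k where m: "m = {#i, j, k#}"
      by (auto simp: numeral_3_eq_3 length_Suc_conv)
    have ijk: "i < n" "j < n" "k < n" using True m by (auto simp: monomials3_def)
    have cK: "c m \<in> K" "d m \<in> K" using c d by (auto simp: cubics_def)
    have U: "unitv a b \<in> K" for a b by (simp add: unitv_def)
    have "polar n c (unitv i) (unitv j) (unitv k) = polar n d (unitv i) (unitv j) (unitv k)"
      unfolding polar_eq by (simp add: eq U)
    then have tau: "tau c i j k = tau d i j k" using polar_unitv c d ijk by simp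
    show ?thesis
    proof (cases "i = j \<and> j = k")
      case True
      have "cform n c (unitv i) = cform n d (unitv i)" by (simp add: eq U)
      then show ?thesis using cform_unitv c d ijk True m by simp
    next
      case False
      show ?thesis
      proof (cases "i = j \<or> j = k \<or> i = k")
        case True
        then have "2 * c m = 2 * d m" using tau False by (simp add: tau_def mult3_def m)
        moreover have "(c m - d m) + (c m - d m) = 2 * c m - 2 * d m" by (simp add: algebra_simps)
        ultimately have "(c m - d m) + (c m - d m) = 0" by simp
        with double_eq_0[OF diff_K[OF cK]] have "c m - d m = 0" by blast
        then show ?thesis by simp
      next
        case False
        then show ?thesis using tau by (simp add: tau_def mult3_def m)
      qed
    qed
  qed
qed

end

section \<open>Evaluation of polynomials\<close>

lemma prod_mset_count:
  fixes y :: "'a \<Rightarrow> 'u :: comm_monoid_mult"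
  assumes "finite S" "set_mset m \<subseteq> S"
  shows "(\<Prod>i\<in>S. y i ^ count m i) = prod_mset (image_mset y m)"
  using assms(2)
proof (induction m)
  case (add a m)
  have "(\<Prod>i\<in>S. y i ^ count (add_mset a m) i) = (\<Prod>i\<in>S. (if i = a then y i else 1) * y i ^ count m i)"
    by (intro prod.cong) auto
  also have "\<dots> = y a * (\<Prod>i\<in>S. y i ^ count m i)"
    using add.prems assms(1) by (simp add: prod.distrib prod.delta)
  finally show ?case using add by simp
qed simp

locale nat_cring = cring R for R :: "nat ring" (structure)
begin

lemma cring_R': "cring R"
  by unfold_locales

abbreviation mpolys :: "nat \<Rightarrow> (nat multiset \<Rightarrow> nat) set" where
  "mpolys n \<equiv> carrier (mpoly_ring R n)"

lemma mpoly_induct [consumes 1, case_names const padd pmult]: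
  assumes "P \<in> mpolys n"
    and "\<And>k. k \<in> carrier R \<Longrightarrow> Q (indexed_const k)"
    and "\<And>P P'. P \<in> mpolys n \<Longrightarrow> Q P \<Longrightarrow> P' \<in> mpolys n \<Longrightarrow> Q P' \<Longrightarrow> Q (indexed_padd P P')"
    and "\<And>P i. P \<in> mpolys n \<Longrightarrow> Q P \<Longrightarrow> i < n \<Longrightarrow> Q (indexed_pmult P i)"
  shows "Q P"
proof -
  have "P \<in> indexed_pset {..<n} (carrier R)" using assms(1) by (simp add: mpoly_ring_def)
  then show ?thesis
    by induction (use assms(2-4) in \<open>auto simp: mpoly_ring_def\<close>)
qed

lemma mpoly_closed [simp]: "P \<in> mpolys n \<Longrightarrow> P m \<in> carrier R"
  using mpoly_carrier_coeff by (simp add: carrier_coeff_def)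

lemma mpoly_support:
  assumes "P \<in> mpolys n"
  shows "finite {m. P m \<noteq> \<zero>}" "P m \<noteq> \<zero> \<Longrightarrow> set_mset m \<subseteq> {..<n}"
proof -
  have "finite {m. P m \<noteq> \<zero>} \<and> (\<forall>m. P m \<noteq> \<zero> \<longrightarrow> set_mset m \<subseteq> {..<n})"
    using assms
  proof (induction rule: mpoly_induct)
    case (const k)
    have "{m. (indexed_const k :: nat multiset \<Rightarrow> nat) m \<noteq> \<zero>} \<subseteq> {{#}}" by (auto simp:
        indexed_const_def)
    then show ?case by (auto simp: indexed_const_def dest: finite_subset)
  next
    case (padd P P')
    have "{m. indexed_padd P P' m \<noteq> \<zero>} \<subseteq> {m. P m \<noteq> \<zero>} \<union> {m. P' m \<noteq> \<zero>}"
      by (auto simp: indexed_padd_def)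
    then show ?case using padd by (auto intro: finite_subset[of _ "{m. P m \<noteq> \<zero>} \<union> {m. P' m \<noteq> \<zero>}"])
  next
    case (pmult P i)
    have sub: "{m. indexed_pmult P i m \<noteq> \<zero>} \<subseteq> add_mset i ` {m. P m \<noteq> \<zero>}"
    proof
      fix m assume "m \<in> {m. indexed_pmult P i m \<noteq> \<zero>}"
      then have "i \<in># m" "P (m - {#i#}) \<noteq> \<zero>" by (auto simp: indexed_pmult_def split: if_splits)
      then show "m \<in> add_mset i ` {m. P m \<noteq> \<zero>}" by (intro image_eqI[of _ _ "m - {#i#}"]) auto
    qed
    then have "finite {m. indexed_pmult P i m \<noteq> \<zero>}" using pmult by (auto intro: finite_subset)
    moreover have "set_mset m \<subseteq> {..<n}" if "indexed_pmult P i m \<noteq> \<zero>" for m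
    proof -
      from sub that obtain m' where "m = add_mset i m'" "P m' \<noteq> \<zero>" by blast
      then show ?thesis using pmult by auto
    qed
    ultimately show ?case by blast
  qed
  then show "finite {m. P m \<noteq> \<zero>}" "P m \<noteq> \<zero> \<Longrightarrow> set_mset m \<subseteq> {..<n}" by auto
qed

text \<open>Evaluation takes place in the product ring, at arbitrary points of it. The coefficients
  \<open>emb R (P m)\<close> keep every term in the ideal that represents \<open>R\<close>.\<close>

definition peval :: "(nat multiset \<Rightarrow> nat) \<Rightarrow> (nat \<Rightarrow> prod_ring) \<Rightarrow> prod_ring" where
  "peval P x = (\<Sum>m | P m \<noteq> \<zero>. emb R (P m) * prod_mset (image_mset x m))"

lemma emb_zero [simp]: "emb R \<zero> = 0"
  using emb_hom(4)[OF cring_R' zero_closed zero_closed] .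

lemma peval_superset: "finite S \<Longrightarrow> {m. P m \<noteq> \<zero>} \<subseteq> S \<Longrightarrow> peval P x = (\<Sum>m\<in>S. emb R (P m) * prod_mset
    (image_mset x m))"
  unfolding peval_def by (rule sum.mono_neutral_left) auto

lemma peval_const: "k \<in> carrier R \<Longrightarrow> peval (indexed_const k) x = emb R k"
  by (subst peval_superset[of "{{#}}"]) (auto simp: indexed_const_def)

lemma peval_padd:
  assumes "P \<in> mpolys n" "Q \<in> mpolys n"
  shows "peval (indexed_padd P Q) x = peval P x + peval Q x"
proof -
  let ?S = "{m. P m \<noteq> \<zero>} \<union> {m. Q m \<noteq> \<zero>}"
  have fin: "finite ?S" using mpoly_support(1) assms by auto
  have "peval (indexed_padd P Q) x = (\<Sum>m\<in>?S. emb R (P m \<oplus> Q m) * prod_mset (image_mset x m))"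
    using fin by (subst peval_superset[of ?S]) (auto simp: indexed_padd_def)
  also have "\<dots> = (\<Sum>m\<in>?S. emb R (P m) * prod_mset (image_mset x m)) + (\<Sum>m\<in>?S. emb R (Q m) *
      prod_mset (image_mset x m))"
    using assms by (simp add: emb_hom(1)[OF cring_R'] distrib_right sum.distrib)
  also have "\<dots> = peval P x + peval Q x"
    using fin by (subst (1 2) peval_superset[of ?S]) auto
  finally show ?thesis .
qed

lemma peval_pmult:
  assumes "P \<in> mpolys n"
  shows "peval (indexed_pmult P i) x = peval P x * x i"
proof -
  have "peval (indexed_pmult P i) x = (\<Sum>m\<in>add_mset i ` {m. P m \<noteq> \<zero>}. emb R (indexed_pmult P i m) *
      prod_mset (image_mset x m))"
  proof (rule peval_superset)
    show "{m. indexed_pmult P i m \<noteq> \<zero>} \<subseteq> add_mset i ` {m. P m \<noteq> \<zero>}"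
    proof
      fix m assume "m \<in> {m. indexed_pmult P i m \<noteq> \<zero>}"
      then have "i \<in># m" "P (m - {#i#}) \<noteq> \<zero>" by (auto simp: indexed_pmult_def split: if_splits)
      then show "m \<in> add_mset i ` {m. P m \<noteq> \<zero>}" by (intro image_eqI[of _ _ "m - {#i#}"]) auto
    qed
  qed (use mpoly_support(1)[OF assms] in auto)
  also have "\<dots> = (\<Sum>m | P m \<noteq> \<zero>. emb R (P m) * (x i * prod_mset (image_mset x m)))"
    by (subst sum.reindex) (auto simp: inj_on_def indexed_pmult_def)
  also have "\<dots> = peval P x * x i"
    unfolding peval_def sum_distrib_right by (intro sum.cong refl) (simp add: mult_ac)
  finally show ?thesis .
qed

lemma peval_mult:
  assumes P: "P \<in> mpolys n" and Q: "Q \<in> mpolys n"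
  shows "peval (mpoly_mult R P Q) x = peval P x * peval Q x"
  using Q
proof (induction rule: mpoly_induct)
  case (const k)
  have "peval (mpoly_mult R P (indexed_const k)) x = (\<Sum>m | P m \<noteq> \<zero>. emb R (P m \<otimes> k) * prod_mset
      (image_mset x m))"
    using mpoly_support(1)[OF P] const
    by (subst peval_superset[of "{m. P m \<noteq> \<zero>}"]) (auto simp: mpoly_mult_const[OF
        mpoly_carrier_coeff[OF P]])
  also have "\<dots> = peval P x * emb R k"
    unfolding peval_def sum_distrib_right
    using P const by (intro sum.cong refl) (simp add: emb_hom(2)[OF cring_R'] mult_ac)
  finally show ?case using const by (simp add: peval_const)
next
  case (padd Q Q')
  have "mpoly_mult R P Q \<in> mpolys n" "mpoly_mult R P Q' \<in> mpolys n"
    using mpoly_mult_closed P padd by auto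
  then show ?case using padd P
    by (simp add: mpoly_mult_add[OF mpoly_carrier_coeff mpoly_carrier_coeff mpoly_carrier_coeff,
        of _ n _ n _ n]
        peval_padd[of _ n] distrib_left)
next
  case (pmult Q i)
  have "mpoly_mult R P Q \<in> mpolys n" using mpoly_mult_closed P pmult by auto
  then show ?case using pmult P
    by (simp add: mpoly_mult_pmult[OF mpoly_carrier_coeff mpoly_carrier_coeff, of _ n _ n]
        peval_pmult[of _ n] mult.assoc)
qed

lemma mpoly_ring_ops:
  "P \<otimes>\<^bsub>mpoly_ring R n\<^esub> Q = mpoly_mult R P Q" "P \<oplus>\<^bsub>mpoly_ring R n\<^esub> Q = indexed_padd P Q"
  "\<one>\<^bsub>mpoly_ring R n\<^esub> = indexed_const \<one>" "\<zero>\<^bsub>mpoly_ring R n\<^esub> = indexed_const \<zero>"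
  by (simp_all add: mpoly_ring_def)

lemma indexed_const_mpoly [simp]: "k \<in> carrier R \<Longrightarrow> indexed_const k \<in> mpolys n"
  by (simp add: mpoly_ring_def indexed_pset.indexed_const)

lemma indexed_var_mpoly [simp]: "j < n \<Longrightarrow> indexed_var j \<in> mpolys n"
  by (simp add: mpoly_ring_def indexed_var_def indexed_pset.indexed_const
      indexed_pset.indexed_pmult)

lemma peval_finsum:
  assumes "finite S" "\<And>s. s \<in> S \<Longrightarrow> P s \<in> mpolys n"
  shows "peval (\<Oplus>\<^bsub>mpoly_ring R n\<^esub>s\<in>S. P s) x = (\<Sum>s\<in>S. peval (P s) x)"
proof -
  interpret MP: cring "mpoly_ring R n" by (rule cring_mpoly_ring)
  show ?thesis using assms
  proof (induction S)
    case empty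
    then show ?case by (simp add: mpoly_ring_ops peval_const)
  next
    case (insert s S)
    have "(\<Oplus>\<^bsub>mpoly_ring R n\<^esub>s\<in>insert s S. P s) = P s \<oplus>\<^bsub>mpoly_ring R n\<^esub> (\<Oplus>\<^bsub>mpoly_ring R n\<^esub>s\<in>S. P s)"
      using insert by (intro MP.finsum_insert) auto
    moreover have "(\<Oplus>\<^bsub>mpoly_ring R n\<^esub>s\<in>S. P s) \<in> mpolys n" using insert by (intro
        MP.finsum_closed) auto
    ultimately show ?case using insert by (simp add: mpoly_ring_ops(2) peval_padd[of _ n])
  qed
qed

lemma emb_one_mult: "a \<in> carrier R \<Longrightarrow> emb R \<one> * emb R a = emb R a" "a \<in> carrier R \<Longrightarrow> emb R a * emb R
    \<one> = emb R a"
  using emb_hom(2)[OF cring_R', symmetric] by simp_all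

text \<open>The factor in front is due to the empty product, which evaluates to the embedded unit of
  \<open>R\<close> and not to the unit of the product ring.\<close>

lemma peval_finprod:
  assumes "finite S" "\<And>s. s \<in> S \<Longrightarrow> P s \<in> mpolys n"
  shows "peval (\<Otimes>\<^bsub>mpoly_ring R n\<^esub>s\<in>S. P s) x = emb R \<one> * (\<Prod>s\<in>S. peval (P s) x)"
proof -
  interpret MP: cring "mpoly_ring R n" by (rule cring_mpoly_ring)
  show ?thesis using assms
  proof (induction S)
    case empty
    then show ?case by (simp add: mpoly_ring_ops peval_const)
  next
    case (insert s S)
    have "(\<Otimes>\<^bsub>mpoly_ring R n\<^esub>s\<in>insert s S. P s) = P s \<otimes>\<^bsub>mpoly_ring R n\<^esub> (\<Otimes>\<^bsub>mpoly_ring R n\<^esub>s\<in>S. P s)"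
      using insert by (intro MP.finprod_insert) auto
    moreover have "(\<Otimes>\<^bsub>mpoly_ring R n\<^esub>s\<in>S. P s) \<in> mpolys n" using insert by (intro
        MP.finprod_closed) auto
    ultimately show ?case using insert by (simp add: mpoly_ring_ops(1) peval_mult[of _ n] mult_ac)
  qed
qed

lemma peval_pow:
  assumes "P \<in> mpolys n"
  shows "peval (P [^]\<^bsub>mpoly_ring R n\<^esub> (k :: nat)) x = emb R \<one> * peval P x ^ k"
proof -
  interpret MP: cring "mpoly_ring R n" by (rule cring_mpoly_ring)
  show ?thesis
  proof (induction k)
    case (Suc k)
    then show ?case using assms by (simp add: mpoly_ring_ops(1) peval_mult[of _ n] mult_ac)
  qed (simp add: mpoly_ring_ops peval_const)
qed

lemma linear_form_mpoly: "(\<And>j. j < n \<Longrightarrow> a j \<in> carrier R) \<Longrightarrow> linear_form R n a \<in> mpolys n"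
proof -
  interpret MP: cring "mpoly_ring R n" by (rule cring_mpoly_ring)
  show "(\<And>j. j < n \<Longrightarrow> a j \<in> carrier R) \<Longrightarrow> ?thesis"
    unfolding linear_form_def by (intro MP.finsum_closed) auto
qed

lemma peval_linear_form:
  assumes "\<And>j. j < n \<Longrightarrow> a j \<in> carrier R"
  shows "peval (linear_form R n a) x = (\<Sum>j<n. emb R (a j) * x j)"
proof -
  interpret MP: cring "mpoly_ring R n" by (rule cring_mpoly_ring)
  have "peval (linear_form R n a) x = (\<Sum>j<n. peval (indexed_const (a j) \<otimes>\<^bsub>mpoly_ring R n\<^esub>
      indexed_var j) x)"
    unfolding linear_form_def using assms by (intro peval_finsum) auto
  also have "\<dots> = (\<Sum>j<n. emb R (a j) * x j)"
  proof (intro sum.cong refl)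
    fix j assume "j \<in> {..<n}"
    then show "peval (indexed_const (a j) \<otimes>\<^bsub>mpoly_ring R n\<^esub> indexed_var j) x = emb R (a j) * x j"
      using assms[of j] peval_pmult[of "indexed_const \<one>" n j x, OF indexed_const_mpoly[OF
          one_closed]]
      by (simp add: mpoly_ring_ops(1) peval_mult[of _ n] peval_const mult.assoc[symmetric]
          emb_one_mult(2)
          flip: indexed_var_def)
  qed
  finally show ?thesis .
qed

lemma matrix_row_pow_mpoly:
  assumes "\<forall>i<n. \<forall>j<n. A i j \<in> carrier R" "i < n"
  shows "linear_form R n (A i) [^]\<^bsub>mpoly_ring R n\<^esub> (k :: nat) \<in> mpolys n"
proof -
  interpret MP: cring "mpoly_ring R n" by (rule cring_mpoly_ring)
  show ?thesis using assms by (intro MP.nat_pow_closed linear_form_mpoly) auto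
qed

lemma subst_matrix_mpoly:
  assumes g: "g \<in> mpolys n" and A: "\<forall>i<n. \<forall>j<n. A i j \<in> carrier R"
  shows "subst_matrix R n g A \<in> mpolys n"
proof -
  interpret MP: cring "mpoly_ring R n" by (rule cring_mpoly_ring)
  show ?thesis unfolding subst_matrix_def
    using g matrix_row_pow_mpoly[OF A] by (intro MP.finsum_closed Pi_I MP.m_closed
        MP.finprod_closed) auto
qed

lemma peval_subst_matrix:
  assumes g: "g \<in> mpolys n" and A: "\<forall>i<n. \<forall>j<n. A i j \<in> carrier R"
  shows "peval (subst_matrix R n g A) x = peval g (\<lambda>i. \<Sum>j<n. emb R (A i j) * x j)"
proof -
  interpret MP: cring "mpoly_ring R n" by (rule cring_mpoly_ring)
  let ?y = "\<lambda>i. \<Sum>j<n. emb R (A i j) * x j"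
  let ?L = "\<lambda>m i. linear_form R n (A i) [^]\<^bsub>mpoly_ring R n\<^esub> count m i"
  have fp: "(\<Otimes>\<^bsub>mpoly_ring R n\<^esub>i\<in>{..<n}. ?L m i) \<in> mpolys n" for m
    using matrix_row_pow_mpoly[OF A] by (intro MP.finprod_closed) auto
  \<comment> \<open>The embedded unit is idempotent, so the copies of it that come with the powers
    are absorbed by the one in front.\<close>
  have e: "emb R \<one> * (\<Prod>i\<in>S. emb R \<one> * z i) = emb R \<one> * (\<Prod>i\<in>S. z i)" for S :: "nat set" and z
  proof (induction S rule: infinite_finite_induct)
    case (insert s S)
    have "emb R \<one> * (\<Prod>i\<in>insert s S. emb R \<one> * z i) = emb R \<one> * z s * (emb R \<one> * (\<Prod>i\<in>S. emb R \<one> * z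
        i))"
      using insert by (simp add: mult_ac)
    also have "\<dots> = (emb R \<one> * emb R \<one>) * (z s * (\<Prod>i\<in>S. z i))"
      unfolding insert.IH by (simp only: mult_ac)
    finally show ?case using insert by (simp add: emb_one_mult)
  qed auto
  have "peval (subst_matrix R n g A) x
      = (\<Sum>m | g m \<noteq> \<zero>. peval (indexed_const (g m) \<otimes>\<^bsub>mpoly_ring R n\<^esub> (\<Otimes>\<^bsub>mpoly_ring R n\<^esub>i\<in>{..<n}. ?L
          m i)) x)"
    unfolding subst_matrix_def using g fp mpoly_support(1)[OF g] by (intro peval_finsum
        MP.m_closed) auto
  also have "\<dots> = (\<Sum>m | g m \<noteq> \<zero>. emb R (g m) * prod_mset (image_mset ?y m))"
  proof (intro sum.cong refl)
    fix m assume "m \<in> {m. g m \<noteq> \<zero>}"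
    then have m: "set_mset m \<subseteq> {..<n}" using mpoly_support(2)[OF g] by simp
    have "peval (\<Otimes>\<^bsub>mpoly_ring R n\<^esub>i\<in>{..<n}. ?L m i) x = emb R \<one> * (\<Prod>i<n. peval (?L m i) x)"
      using matrix_row_pow_mpoly[OF A] by (intro peval_finprod) auto
    also have "(\<Prod>i<n. peval (?L m i) x) = (\<Prod>i<n. emb R \<one> * ?y i ^ count m i)"
      using A by (intro prod.cong refl) (simp add: peval_pow[OF linear_form_mpoly]
          peval_linear_form)
    also have "emb R \<one> * \<dots> = emb R \<one> * prod_mset (image_mset ?y m)"
      unfolding e using m by (simp add: prod_mset_count)
    finally have "peval (\<Otimes>\<^bsub>mpoly_ring R n\<^esub>i\<in>{..<n}. ?L m i) x = emb R \<one> * prod_mset (image_mset ?y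
        m)" .
    then show "peval (indexed_const (g m) \<otimes>\<^bsub>mpoly_ring R n\<^esub> (\<Otimes>\<^bsub>mpoly_ring R n\<^esub>i\<in>{..<n}. ?L m i)) x
        = emb R (g m) * prod_mset (image_mset ?y m)"
      using g fp by (simp add: mpoly_ring_ops(1) peval_mult[of _ n] peval_const
          mult.assoc[symmetric] emb_one_mult)
  qed
  finally show ?thesis by (simp add: peval_def)
qed

section \<open>Homogeneity, and cubic forms as free choices of coefficients\<close>

definition homogeneous :: "nat \<Rightarrow> (nat multiset \<Rightarrow> nat) \<Rightarrow> bool" where
  "homogeneous d P \<longleftrightarrow> (\<forall>m. P m \<noteq> \<zero> \<longrightarrow> size m = d)"

lemma homogeneous_mult:
  assumes "P \<in> mpolys n" "Q \<in> mpolys n" "homogeneous d P" "homogeneous d' Q"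
  shows "homogeneous (d + d') (mpoly_mult R P Q)"
  unfolding homogeneous_def
proof (intro allI impI, rule ccontr)
  fix m assume m: "mpoly_mult R P Q m \<noteq> \<zero>" "size m \<noteq> d + d'"
  have "P a \<otimes> Q (m - a) = \<zero>" if "a \<subseteq># m" for a
  proof -
    have "size m = size a + size (m - a)" using that by (metis size_union
        subset_mset.add_diff_inverse)
    then have "P a = \<zero> \<or> Q (m - a) = \<zero>" using assms(3,4) m(2) by (auto simp: homogeneous_def)
    then show ?thesis using assms(1,2) by auto
  qed
  then have "mpoly_mult R P Q m = (\<Oplus>a\<in>{a. a \<subseteq># m}. \<zero>)"
    unfolding mpoly_mult_def by (intro finsum_cong') auto
  with m(1) show False by simp
qed

lemma homogeneous_const: "homogeneous 0 (indexed_const k)"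
  by (auto simp: homogeneous_def indexed_const_def)

lemma homogeneous_var: "homogeneous 1 (indexed_var j)"
proof -
  have "size m = 1" if "indexed_var j m \<noteq> \<zero>" for m
  proof -
    have "j \<in># m" "m - {#j#} = {#}"
      using that by (auto simp: indexed_var_def indexed_pmult_def indexed_const_def split:
          if_splits)
    then have "m = {#j#}" by (metis insert_DiffM)
    then show ?thesis by simp
  qed
  then show ?thesis by (simp add: homogeneous_def)
qed

lemma homogeneous_finsum:
  assumes "finite S" "\<And>s. s \<in> S \<Longrightarrow> P s \<in> mpolys n" "\<And>s. s \<in> S \<Longrightarrow> homogeneous d (P s)"
  shows "homogeneous d (\<Oplus>\<^bsub>mpoly_ring R n\<^esub>s\<in>S. P s)"
proof -
  interpret MP: cring "mpoly_ring R n" by (rule cring_mpoly_ring)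
  show ?thesis using assms
  proof (induction S)
    case empty
    then show ?case by (simp add: mpoly_ring_ops homogeneous_def indexed_const_def)
  next
    case (insert s S)
    have eq: "(\<Oplus>\<^bsub>mpoly_ring R n\<^esub>s\<in>insert s S. P s) = indexed_padd (P s) (\<Oplus>\<^bsub>mpoly_ring R n\<^esub>s\<in>S. P s)"
      using insert by (subst MP.finsum_insert) (auto simp: mpoly_ring_ops(2))
    have "homogeneous d (P s)" "homogeneous d (\<Oplus>\<^bsub>mpoly_ring R n\<^esub>s\<in>S. P s)" using insert by auto
    then show ?case unfolding eq homogeneous_def indexed_padd_def by (metis l_zero zero_closed)
  qed
qed

lemma homogeneous_pow:
  assumes "P \<in> mpolys n" "homogeneous 1 P"
  shows "homogeneous k (P [^]\<^bsub>mpoly_ring R n\<^esub> (k :: nat))"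
proof -
  interpret MP: cring "mpoly_ring R n" by (rule cring_mpoly_ring)
  show ?thesis
  proof (induction k)
    case 0
    then show ?case by (simp add: mpoly_ring_ops homogeneous_const)
  next
    case (Suc k)
    then show ?case using homogeneous_mult[of "P [^]\<^bsub>mpoly_ring R n\<^esub> k" n P k 1] assms
      by (simp add: mpoly_ring_ops)
  qed
qed

lemma homogeneous_finprod:
  assumes "finite S" "\<And>s. s \<in> S \<Longrightarrow> P s \<in> mpolys n" "\<And>s. s \<in> S \<Longrightarrow> homogeneous (d s) (P s)"
  shows "homogeneous (sum d S) (\<Otimes>\<^bsub>mpoly_ring R n\<^esub>s\<in>S. P s)"
proof -
  interpret MP: cring "mpoly_ring R n" by (rule cring_mpoly_ring)
  show ?thesis using assms
  proof (induction S)
    case empty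
    then show ?case by (simp add: mpoly_ring_ops homogeneous_const)
  next
    case (insert s S)
    have eq: "(\<Otimes>\<^bsub>mpoly_ring R n\<^esub>s\<in>insert s S. P s) = mpoly_mult R (P s) (\<Otimes>\<^bsub>mpoly_ring R n\<^esub>s\<in>S. P s)"
      using insert by (subst MP.finprod_insert) (auto simp: mpoly_ring_ops(1))
    have "(\<Otimes>\<^bsub>mpoly_ring R n\<^esub>s\<in>S. P s) \<in> mpolys n" using insert by (intro MP.finprod_closed) auto
    then show ?case unfolding eq using insert homogeneous_mult[of "P s" n] by simp
  qed
qed

text \<open>Equality of values yields equality of polynomials by \<open>cform_inject\<close> only
  between cubic forms, hence the substituted polynomial has to be recognised as one.\<close>

lemma subst_matrix_cubic_forms:
  assumes g: "g \<in> cubic_forms R n" and A: "\<forall>i<n. \<forall>j<n. A i j \<in> carrier R"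
  shows "subst_matrix R n g A \<in> cubic_forms R n"
proof -
  interpret MP: cring "mpoly_ring R n" by (rule cring_mpoly_ring)
  have gm: "g \<in> mpolys n" using g by (simp add: cubic_forms_def)
  let ?L = "\<lambda>m i. linear_form R n (A i) [^]\<^bsub>mpoly_ring R n\<^esub> count m i"
  have row: "homogeneous 1 (linear_form R n (A i))" if "i < n" for i
    unfolding linear_form_def
  proof (rule homogeneous_finsum)
    fix j assume "j \<in> {..<n}"
    then have "indexed_const (A i j) \<in> mpolys n" "indexed_var j \<in> mpolys n" using A that by auto
    then show "homogeneous 1 (indexed_const (A i j) \<otimes>\<^bsub>mpoly_ring R n\<^esub> indexed_var j)"
      "indexed_const (A i j) \<otimes>\<^bsub>mpoly_ring R n\<^esub> indexed_var j \<in> mpolys n"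
      using homogeneous_mult[OF _ _ homogeneous_const homogeneous_var] by (auto simp:
          mpoly_ring_ops(1) intro: mpoly_mult_closed)
  qed simp
  have fp: "(\<Otimes>\<^bsub>mpoly_ring R n\<^esub>i\<in>{..<n}. ?L m i) \<in> mpolys n" for m
    using matrix_row_pow_mpoly[OF A] by (intro MP.finprod_closed) auto
  have "homogeneous 3 (subst_matrix R n g A)"
    unfolding subst_matrix_def
  proof (rule homogeneous_finsum)
    show "finite {m. g m \<noteq> \<zero>}" by (rule mpoly_support(1)[OF gm])
    fix m assume "m \<in> {m. g m \<noteq> \<zero>}"
    then have m: "size m = 3" "set_mset m \<subseteq> {..<n}" "g m \<in> carrier R"
      using g gm mpoly_support(2)[OF gm] by (auto simp: cubic_forms_def)
    show "indexed_const (g m) \<otimes>\<^bsub>mpoly_ring R n\<^esub> (\<Otimes>\<^bsub>mpoly_ring R n\<^esub>i\<in>{..<n}. ?L m i) \<in> mpolys n"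
      using m fp by (intro MP.m_closed) auto
    have "homogeneous (\<Sum>i<n. count m i) (\<Otimes>\<^bsub>mpoly_ring R n\<^esub>i\<in>{..<n}. ?L m i)"
      using A row by (intro homogeneous_finprod matrix_row_pow_mpoly homogeneous_pow
          linear_form_mpoly) auto
    moreover have "(\<Sum>i<n. count m i) = 3"
    proof -
      have "(\<Sum>i<n. count m i) = (\<Sum>i\<in>set_mset m. count m i)"
        using m(2) by (intro sum.mono_neutral_right) (auto simp: not_in_iff)
      then show ?thesis using m(1) by (simp add: size_multiset_overloaded_eq)
    qed
    ultimately show "homogeneous 3 (indexed_const (g m) \<otimes>\<^bsub>mpoly_ring R n\<^esub> (\<Otimes>\<^bsub>mpoly_ring R
        n\<^esub>i\<in>{..<n}. ?L m i))"
      using homogeneous_mult[OF indexed_const_mpoly[OF m(3)] fp homogeneous_const, of 3 m] by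
          (simp add: mpoly_ring_ops(1))
  qed
  then show ?thesis using subst_matrix_mpoly[OF gm A] by (auto simp: cubic_forms_def
      homogeneous_def)
qed

text \<open>Monomials are split off one at a time, and each is built from a constant by
  multiplication with variables, following the inductive definition of the polynomials.\<close>

lemma finsupp_mpoly:
  assumes "finite S" "\<And>m. m \<notin> S \<Longrightarrow> P m = \<zero>" "\<And>m. P m \<in> carrier R" "\<And>m. m \<in> S \<Longrightarrow> set_mset m \<subseteq> {..<n}"
  shows "P \<in> mpolys n"
  using assms
proof (induction S arbitrary: P)
  case empty
  then have "P = indexed_const \<zero>" by (auto simp: indexed_const_def)
  then show ?case by simp
next
  case (insert m0 S)
  have mono: "(\<lambda>m. if m = m0 then a else \<zero>) \<in> mpolys n" if "a \<in> carrier R" "set_mset m0 \<subseteq> {..<n}"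
      for a m0
    using that(2)
  proof (induction m0)
    case empty
    have "(\<lambda>m :: nat multiset. if m = {#} then a else \<zero>) = indexed_const a" by (simp add:
        indexed_const_def)
    then show ?case using that(1) by simp
  next
    case (add i m0)
    have "(\<lambda>m. if m = add_mset i m0 then a else \<zero>) = indexed_pmult (\<lambda>m. if m = m0 then a else \<zero>) i"
      by (auto simp: indexed_pmult_def fun_eq_iff dest: insert_DiffM)
    then show ?case using add by (auto simp: mpoly_ring_def intro: indexed_pset.indexed_pmult)
  qed
  let ?P = "P(m0 := \<zero>)"
  have "?P \<in> mpolys n" using insert.prems insert.hyps by (intro insert.IH) auto
  moreover have "(\<lambda>m. if m = m0 then P m0 else \<zero>) \<in> mpolys n" using insert.prems by (intro mono)
      auto
  moreover have "P = indexed_padd ?P (\<lambda>m. if m = m0 then P m0 else \<zero>)"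
    using insert.prems by (auto simp: indexed_padd_def fun_eq_iff)
  ultimately show ?case by (metis (no_types, lifting) mpoly_ring_def indexed_pset.indexed_padd
      partial_object.select_convs(1))
qed

text \<open>This identifies the uniform distribution on cubic forms with that of independent
  coefficients, and it matches the definition of \<open>cubics\<close>.\<close>

lemma cubic_forms_iff:
  "f \<in> cubic_forms R n \<longleftrightarrow> (\<forall>m. f m \<in> carrier R) \<and> (\<forall>m. m \<notin> monomials3 n \<longrightarrow> f m = \<zero>)"
proof
  assume f: "f \<in> cubic_forms R n"
  then have fm: "f \<in> mpolys n" by (simp add: cubic_forms_def)
  show "(\<forall>m. f m \<in> carrier R) \<and> (\<forall>m. m \<notin> monomials3 n \<longrightarrow> f m = \<zero>)"
    using f fm mpoly_support(2)[OF fm] unfolding cubic_forms_def monomials3_def by auto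
next
  assume f: "(\<forall>m. f m \<in> carrier R) \<and> (\<forall>m. m \<notin> monomials3 n \<longrightarrow> f m = \<zero>)"
  then have "f \<in> mpolys n" by (intro finsupp_mpoly[OF finite_monomials3[of n]]) (auto simp:
      monomials3_def)
  then show "f \<in> cubic_forms R n" using f unfolding cubic_forms_def monomials3_def by auto
qed

lemma peval_cform:
  assumes "f \<in> cubic_forms R n"
  shows "peval f x = cform n (\<lambda>m. emb R (f m)) x"
proof -
  define T where "T = {(i, j, k). i \<le> j \<and> j \<le> k \<and> k < n}"
  have inj: "inj_on (\<lambda>(i, j, k). {#i, j, k#}) T"
  proof (rule inj_onI)
    fix s t assume st: "s \<in> T" "t \<in> T" "(case s of (i, j, k) \<Rightarrow> {#i, j, k#}) = (case t of (i, j, k)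
        \<Rightarrow> {#i, j, k#})"
    obtain i j k i' j' k' where s: "s = (i, j, k)" and t: "t = (i', j', k')" by (metis prod_cases3)
    have T: "(i, j, k) \<in> T" "(i', j', k') \<in> T" and eq: "{#i, j, k#} = {#i', j', k'#}" using st s t
        by auto
    have "sorted_list_of_multiset {#i, j, k#} = [i, j, k]" "sorted_list_of_multiset {#i', j', k'#}
        = [i', j', k']"
      using T by (auto simp: T_def)
    then show "s = t" using eq s t by simp
  qed
  have img: "(\<lambda>(i, j, k). {#i, j, k#}) ` T = monomials3 n"
  proof (intro equalityI subsetI)
    fix m assume m: "m \<in> monomials3 n"
    define xs where "xs = sorted_list_of_multiset m"
    have xs: "sorted xs" "mset xs = m" by (simp_all add: xs_def)
    then have "length xs = 3" using m by (auto simp: monomials3_def)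
    then obtain i j k where ijk: "xs = [i, j, k]" by (auto simp: numeral_3_eq_3 length_Suc_conv)
    have m': "m = {#i, j, k#}" using xs(2) ijk by auto
    have "(i, j, k) \<in> T" using xs(1) m unfolding m' by (auto simp: T_def ijk monomials3_def)
    then show "m \<in> (\<lambda>(i, j, k). {#i, j, k#}) ` T" using m' by force
  qed (auto simp: T_def monomials3_def)
  have "peval f x = (\<Sum>m\<in>monomials3 n. emb R (f m) * prod_mset (image_mset x m))"
    using assms by (intro peval_superset) (auto simp: cubic_forms_iff)
  also have "\<dots> = (\<Sum>(i, j, k)\<in>T. emb R (f {#i, j, k#}) * (x i * x j * x k))"
    unfolding img[symmetric] by (subst sum.reindex[OF inj]) (auto simp: case_prod_unfold
        mult.assoc intro!: sum.cong)
  also have "\<dots> = (\<Sum>(i, j, k)\<in>{..<n} \<times> {..<n} \<times> {..<n}. upper (\<lambda>m. emb R (f m)) i j k * (x i * x j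
      * x k))"
    by (intro sum.mono_neutral_cong_left) (auto simp: T_def upper_def split: if_splits)
  also have "\<dots> = cform n (\<lambda>m. emb R (f m)) x"
    by (simp add: cform_def sum.cartesian_product)
  finally show ?thesis .
qed

lemma emb_finsum:
  assumes "finite S" "\<And>s. s \<in> S \<Longrightarrow> a s \<in> carrier R"
  shows "emb R (\<Oplus>s\<in>S. a s) = (\<Sum>s\<in>S. emb R (a s))"
  using assms
proof (induction S)
  case (insert s S)
  then have "(\<Oplus>s\<in>insert s S. a s) = a s \<oplus> (\<Oplus>s\<in>S. a s)" by (intro finsum_insert) auto
  then show ?case using insert by (simp add: emb_hom(1)[OF cring_R'])
qed simp

end

section \<open>The linear system of an isomorphism\<close>

definition mat_app :: "nat \<Rightarrow> (nat \<Rightarrow> nat \<Rightarrow> 'u) \<Rightarrow> (nat \<Rightarrow> 'u) \<Rightarrow> nat \<Rightarrow> 'u :: comm_ring_1" where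
  "mat_app n A x = (\<lambda>i. \<Sum>j<n. A i j * x j)"

lemma mat_app_cong: "(\<And>i. i < n \<Longrightarrow> x i = y i) \<Longrightarrow> mat_app n A x = mat_app n A y"
  by (simp add: mat_app_def)

lemma mat_app_add: "mat_app n A (\<lambda>i. x i + y i) i = mat_app n A x i + mat_app n A y i"
  by (simp add: mat_app_def distrib_left sum.distrib)

lemma mat_app_mat_app: "mat_app n A (mat_app n B x) i = (\<Sum>j<n. (\<Sum>k<n. A i k * B k j) * x j)"
proof -
  have "mat_app n A (mat_app n B x) i = (\<Sum>k<n. \<Sum>j<n. A i k * B k j * x j)"
    by (simp add: mat_app_def sum_distrib_left mult.assoc)
  also have "\<dots> = (\<Sum>j<n. (\<Sum>k<n. A i k * B k j) * x j)"
    by (subst sum.swap) (simp add: sum_distrib_right)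
  finally show ?thesis .
qed

context finite_subfield
begin

definition inverse_mats :: "nat \<Rightarrow> (nat \<Rightarrow> nat \<Rightarrow> 'u) \<Rightarrow> (nat \<Rightarrow> nat \<Rightarrow> 'u) \<Rightarrow> bool" where
  "inverse_mats n A B \<longleftrightarrow> (\<forall>i<n. \<forall>j<n. A i j \<in> K \<and> B i j \<in> K \<and>
     (\<Sum>k<n. A i k * B k j) = (if i = j then e else 0) \<and> (\<Sum>k<n. B i k * A k j) = (if i = j then e
       else 0))"

lemma inverse_mats_sym: "inverse_mats n A B \<Longrightarrow> inverse_mats n B A"
  by (auto simp: inverse_mats_def)

lemma sum_delta_e: "(i :: nat) < n \<Longrightarrow> x i \<in> K \<Longrightarrow> (\<Sum>j<n. (if i = j then e else 0) * x j) = x i"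
proof -
  assume "i < n" "x i \<in> K"
  have "(\<Sum>j<n. (if i = j then e else 0) * x j) = (\<Sum>j<n. if i = j then e * x j else 0)"
    by (intro sum.cong) auto
  also have "\<dots> = e * x i" using \<open>i < n\<close> by (subst sum.delta') auto
  finally show ?thesis using \<open>x i \<in> K\<close> by (simp add: e_mult)
qed

lemma mat_app_inverse:
  assumes "inverse_mats n A B" "\<And>i. i < n \<Longrightarrow> x i \<in> K" "i < n"
  shows "mat_app n A (mat_app n B x) i = x i"
proof -
  have "mat_app n A (mat_app n B x) i = (\<Sum>j<n. (if i = j then e else 0) * x j)"
    unfolding mat_app_mat_app using assms by (intro sum.cong refl) (simp add: inverse_mats_def)
  then show ?thesis using sum_delta_e[where x = x, OF assms(3) assms(2)[OF assms(3)]] by simp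
qed

lemma mat_app_K: "(\<And>i j. i < n \<Longrightarrow> j < n \<Longrightarrow> A i j \<in> K) \<Longrightarrow> (\<And>i. i < n \<Longrightarrow> x i \<in> K) \<Longrightarrow> i < n \<Longrightarrow> mat_app n A
    x i \<in> K"
  unfolding mat_app_def by (intro sum_K mult_K) auto

lemma unitv_K [simp]: "unitv i j \<in> K"
  by (simp add: unitv_def)

lemma mat_app_unitv: "(\<And>j. j < n \<Longrightarrow> A i j \<in> K) \<Longrightarrow> j < n \<Longrightarrow> mat_app n A (unitv j) i = A i j"
proof -
  assume A: "\<And>j. j < n \<Longrightarrow> A i j \<in> K" and j: "j < n"
  have "mat_app n A (unitv j) i = (\<Sum>k<n. if k = j then A i k * e else 0)"
    unfolding mat_app_def unitv_def by (intro sum.cong) auto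
  then show ?thesis using A j by (simp add: mult_e)
qed

text \<open>An injective map of the finite set \<open>K^n\<close> into itself is onto, and preimages
  of the unit vectors are the columns of a right inverse \<open>B\<close>. It is a left inverse as
  well, because \<open>A (B A) = A\<close> and \<open>A\<close> is injective.\<close>

lemma injective_matrix_invertible:
  assumes A: "\<And>i j. i < n \<Longrightarrow> j < n \<Longrightarrow> A i j \<in> K"
    and inj: "\<And>x. (\<And>i. i < n \<Longrightarrow> x i \<in> K) \<Longrightarrow> (\<And>i. i < n \<Longrightarrow> mat_app n A x i = 0) \<Longrightarrow> \<forall>i<n. x i = 0"
  shows "\<exists>B. inverse_mats n A B"
proof -
  let ?V = "{..<n} \<rightarrow>\<^sub>E K"
  let ?h = "\<lambda>x. restrict (mat_app n A x) {..<n}"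
  have eqI: "\<forall>i<n. x i = y i" if xy: "\<And>i. i < n \<Longrightarrow> x i \<in> K" "\<And>i. i < n \<Longrightarrow> y i \<in> K"
    "\<And>i. i < n \<Longrightarrow> mat_app n A x i = mat_app n A y i" for x y
  proof -
    have "mat_app n A (\<lambda>i. x i - y i) i = 0" if "i < n" for i
      using xy(3)[OF that] by (simp add: mat_app_def right_diff_distrib sum_subtractf)
    then have "\<forall>i<n. x i - y i = 0" using xy by (intro inj) auto
    then show ?thesis by simp
  qed
  have V: "finite ?V" by (simp add: finite_PiE)
  have "?h ` ?V \<subseteq> ?V" by (intro image_subsetI) (auto intro!: mat_app_K A)
  moreover have "inj_on ?h ?V"
  proof (rule inj_onI)
    fix x y assume x: "x \<in> ?V" and y: "y \<in> ?V" and eq: "?h x = ?h y"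
    have "\<forall>i<n. x i = y i"
    proof (rule eqI)
      fix i assume "i < n"
      then show "mat_app n A x i = mat_app n A y i" using fun_cong[OF eq, of i] by simp
    qed (use x y in auto)
    then show "x = y" using x y by (intro PiE_ext[OF x y]) auto
  qed
  ultimately have surj: "?h ` ?V = ?V" using V by (intro endo_inj_surj) auto
  have "\<exists>b. (\<forall>i<n. b i \<in> K) \<and> (\<forall>i<n. mat_app n A b i = unitv j i)" for j
  proof -
    have "restrict (unitv j) {..<n} \<in> ?V" by simp
    then have "restrict (unitv j) {..<n} \<in> ?h ` ?V" unfolding surj .
    then obtain b where b: "b \<in> ?V" "restrict (unitv j) {..<n} = ?h b" by (elim imageE)
    have "mat_app n A b i = unitv j i" if "i < n" for i
      using fun_cong[OF b(2), of i] that by simp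
    then show ?thesis using b(1) by (intro exI[of _ b]) auto
  qed
  then obtain b where b: "\<And>i j. i < n \<Longrightarrow> b j i \<in> K" "\<And>i j. i < n \<Longrightarrow> mat_app n A (b j) i = unitv j i"
      by metis
  define B where "B i j = b j i" for i j
  have AB: "(\<Sum>k<n. A i k * B k j) = (if i = j then e else 0)" if "i < n" for i j
    using b(2)[OF that, of j] by (simp add: mat_app_def B_def unitv_def)
  have BA: "(\<Sum>k<n. B i k * A k j) = (if i = j then e else 0)" if ij: "i < n" "j < n" for i j
  proof -
    let ?a = "\<lambda>k. A k j"
    have "mat_app n A (mat_app n B ?a) i = mat_app n A (unitv j) i" if "i < n" for i
    proof -
      have "mat_app n A (mat_app n B ?a) i = (\<Sum>k<n. (if i = k then e else 0) * ?a k)"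
        unfolding mat_app_mat_app using AB[OF that] by simp
      also have "\<dots> = A i j" using that ij A by (intro sum_delta_e) auto
      also have "\<dots> = mat_app n A (unitv j) i" using that ij A by (simp add: mat_app_unitv)
      finally show ?thesis .
    qed
    then have "\<forall>i<n. mat_app n B ?a i = unitv j i"
      using b(1) A ij by (intro eqI mat_app_K) (auto simp: B_def)
    then show ?thesis using ij by (simp add: mat_app_def unitv_def)
  qed
  have inv: "inverse_mats n A B"
    unfolding inverse_mats_def using AB BA A b(1) by (simp add: B_def)
  show ?thesis by (rule exI[of _ B]) (rule inv)
qed

section \<open>From isomorphisms to solutions and from solutions to adjoints\<close>

lemma polar_mat_app:
  assumes eq: "\<And>x. (\<And>i. i < n \<Longrightarrow> x i \<in> K) \<Longrightarrow> cform n c x = cform n d (mat_app n A x)"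
    and K: "\<And>i. i < n \<Longrightarrow> x i \<in> K" "\<And>i. i < n \<Longrightarrow> y i \<in> K" "\<And>i. i < n \<Longrightarrow> z i \<in> K"
  shows "polar n c x y z = polar n d (mat_app n A x) (mat_app n A y) (mat_app n A z)"
proof -
  have add: "mat_app n A (\<lambda>i. x i + y i) = (\<lambda>i. mat_app n A x i + mat_app n A y i)" for x y
    by (simp add: fun_eq_iff mat_app_add)
  show ?thesis unfolding polar_eq using K by (simp add: eq add)
qed

lemma polar_expand:
  assumes "\<And>i. i < n \<Longrightarrow> z i \<in> K"
  shows "polar n c x y z = (\<Sum>p<n. z p * polar n c x y (unitv p))"
proof -
  have "polar n c x y z = polar n c x y (\<lambda>i. \<Sum>p<n. z p * unitv p i)"
  proof (rule polar_cong)
    fix i assume i: "i < n"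
    have "(\<Sum>p<n. z p * unitv p i) = (\<Sum>p<n. (if i = p then e else 0) * z p)"
      by (intro sum.cong) (auto simp: unitv_def mult.commute)
    then show "z i = (\<Sum>p<n. z p * unitv p i)" using sum_delta_e[OF i, of z] assms[OF i] by simp
  qed auto
  then show ?thesis by (simp add: polar_sum)
qed

definition solves :: "nat \<Rightarrow> nat \<Rightarrow> (nat multiset \<Rightarrow> 'u) \<Rightarrow> (nat multiset \<Rightarrow> 'u) \<Rightarrow> (nat \<Rightarrow> nat \<Rightarrow> 'u)
    \<Rightarrow> (nat \<Rightarrow> nat \<Rightarrow> 'u) \<Rightarrow> (nat \<Rightarrow> nat \<Rightarrow> 'u) \<Rightarrow> bool" where
  "solves n r c d w a b \<longleftrightarrow> (\<forall>i<r. \<forall>j<n. \<forall>k<n.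
     polar n d (w i) (unitv j) (a k) + polar n c (unitv i) (unitv k) (b j) = 0)"

text \<open>The change of variables by the isomorphism \<open>A\<close>: applying \<open>B\<close>
  to \<open>a k\<close> turns the terms in \<open>d\<close> into terms in \<open>c\<close>, and
  combining the equations over \<open>j\<close> with the coefficients \<open>A j l\<close> replaces
  the unit vector \<open>e_j\<close> by \<open>A e_l\<close>, whose preimage is
  \<open>e_l\<close>.\<close>

lemma solves_adjoints:
  assumes c: "c \<in> cubics n" and AB: "inverse_mats n A B" and r: "r \<le> n"
    and eq: "\<And>x. (\<And>i. i < n \<Longrightarrow> x i \<in> K) \<Longrightarrow> cform n c x = cform n d (mat_app n A x)"
    and K: "\<And>k p. k < n \<Longrightarrow> p < n \<Longrightarrow> a k p \<in> K" "\<And>j p. j < n \<Longrightarrow> p < n \<Longrightarrow> b j p \<in> K"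
    and sol: "solves n r c d (\<lambda>i. mat_app n A (unitv i)) a b"
  shows "(restrict (\<lambda>(p, k). mat_app n B (a k) p) ({..<n} \<times> {..<n}),
    restrict (\<lambda>(l, p). \<Sum>j<n. A j l * b j p) ({..<n} \<times> {..<n})) \<in> adjoints n r c"
    (is "(?A, ?D) \<in> _")
proof -
  have AK: "A i j \<in> K" "B i j \<in> K" if "i < n" "j < n" for i j using AB that by (auto simp:
      inverse_mats_def)
  have "adj_eq n c ?A ?D i l k = 0" if "i < r" "l < n" "k < n" for i l k
  proof -
    have i: "i < n" using that r by simp
    have a: "mat_app n B (a k) p \<in> K" if "p < n" for p using AK(2) K(1)[OF \<open>k < n\<close>] that by (intro
        mat_app_K) auto
    have "(\<Sum>p<n. ?A (p, k) * tau c i l p) = (\<Sum>p<n. mat_app n B (a k) p * polar n c (unitv i)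
        (unitv l) (unitv p))"
      using that i c by (intro sum.cong refl) (simp add: polar_unitv)
    also have "\<dots> = polar n c (unitv i) (unitv l) (mat_app n B (a k))"
      using a by (subst (2) polar_expand) auto
    also have "\<dots> = polar n d (mat_app n A (unitv i)) (mat_app n A (unitv l)) (mat_app n A (mat_app
        n B (a k)))"
      using a by (intro polar_mat_app[OF eq]) auto
    also have "\<dots> = polar n d (mat_app n A (unitv i)) (\<lambda>s. \<Sum>j<n. A j l * unitv j s) (a k)"
    proof (rule polar_cong)
      fix s assume s: "s < n"
      have "(\<Sum>j<n. A j l * unitv j s) = (\<Sum>j<n. (if s = j then e else 0) * A j l)"
        by (intro sum.cong) (auto simp: unitv_def mult.commute)
      then show "mat_app n A (unitv l) s = (\<Sum>j<n. A j l * unitv j s)"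
        using sum_delta_e[OF s, of "\<lambda>j. A j l"] AK s that by (simp add: mat_app_unitv)
      show "mat_app n A (mat_app n B (a k)) s = a k s" using s K that by (intro mat_app_inverse[OF
          AB]) auto
    qed auto
    also have "\<dots> = (\<Sum>j<n. A j l * polar n d (mat_app n A (unitv i)) (unitv j) (a k))"
      by (subst (1 2) polar_swap(1)) (rule polar_sum)
    finally have 1: "(\<Sum>p<n. ?A (p, k) * tau c i l p) = (\<Sum>j<n. A j l * polar n d (mat_app n A
        (unitv i)) (unitv j) (a k))" .
    have bK: "(\<Sum>j<n. A j l * b j p) \<in> K" if "p < n" for p using AK K \<open>l < n\<close> that by (intro sum_K
        mult_K) auto
    have "(\<Sum>p<n. ?D (l, p) * tau c i p k) = (\<Sum>p<n. (\<Sum>j<n. A j l * b j p) * polar n c (unitv i)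
        (unitv k) (unitv p))"
      using that i c by (intro sum.cong refl) (simp add: polar_unitv tau_perm(1)[of c i k])
    also have "\<dots> = polar n c (unitv i) (unitv k) (\<lambda>p. \<Sum>j<n. A j l * b j p)"
      using bK by (subst (2) polar_expand) auto
    also have "\<dots> = (\<Sum>j<n. A j l * polar n c (unitv i) (unitv k) (b j))" by (rule polar_sum)
    finally have 2: "(\<Sum>p<n. ?D (l, p) * tau c i p k) = (\<Sum>j<n. A j l * polar n c (unitv i) (unitv
        k) (b j))" .
    have "adj_eq n c ?A ?D i l k = (\<Sum>j<n. A j l * (polar n d (mat_app n A (unitv i)) (unitv j) (a k)
        + polar n c (unitv i) (unitv k) (b j)))"
      unfolding adj_eq_def 1 2 by (simp add: distrib_left sum.distrib)
    also have "\<dots> = 0" using sol that by (intro sum.neutral) (simp add: solves_def)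
    finally show ?thesis .
  qed
  moreover have "?A \<in> mats n" "?D \<in> mats n"
    unfolding mats_def using AK K by (auto intro!: mat_app_K sum_K mult_K)
  ultimately show ?thesis by (auto simp: adjoints_def)
qed

text \<open>Moving all three arguments of the polarisation of \<open>d\<close> through
  \<open>A\<close> gives \<open>T_d(A e_i, e_j, A e_k) = T_c(e_i, B e_j, e_k)\<close>; the minus
  sign in the second family brings both terms to one side.\<close>

lemma solves_inverse:
  assumes AB: "inverse_mats n A B" and r: "r \<le> n"
    and eq: "\<And>x. (\<And>i. i < n \<Longrightarrow> x i \<in> K) \<Longrightarrow> cform n c x = cform n d (mat_app n A x)"
  shows "solves n r c d (\<lambda>i. mat_app n A (unitv i)) (\<lambda>k p. A p k) (\<lambda>j p. - B p j)"
  unfolding solves_def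
proof (intro allI impI)
  fix i j k assume ijk: "i < r" "j < n" "k < n"
  have AK: "A i j \<in> K" "B i j \<in> K" if "i < n" "j < n" for i j using AB that by (auto simp:
      inverse_mats_def)
  have "polar n d (mat_app n A (unitv i)) (unitv j) (\<lambda>p. A p k)
      = polar n d (mat_app n A (unitv i)) (mat_app n A (mat_app n B (unitv j))) (mat_app n A
          (unitv k))"
    using ijk AK mat_app_inverse[OF AB, of "unitv j"] by (intro polar_cong) (auto simp:
        mat_app_unitv)
  also have "\<dots> = polar n c (unitv i) (mat_app n B (unitv j)) (unitv k)"
    using AK by (intro polar_mat_app[OF eq, symmetric] mat_app_K) auto
  also have "\<dots> = polar n c (unitv i) (unitv k) (\<lambda>p. B p j)"
    using ijk AK by (subst polar_swap(1), intro polar_cong) (auto simp: mat_app_unitv)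
  finally have 1: "polar n d (mat_app n A (unitv i)) (unitv j) (\<lambda>p. A p k) = polar n c (unitv i)
      (unitv k) (\<lambda>p. B p j)" .
  have "polar n c (unitv i) (unitv k) (\<lambda>p. - B p j) = - polar n c (unitv i) (unitv k) (\<lambda>p. B p j)"
    using polar_sum[where S = "{0 :: nat}" and a = "\<lambda>_. - 1" and w = "\<lambda>_ p. B p j"] by simp
  then show "polar n d (mat_app n A (unitv i)) (unitv j) (\<lambda>p. A p k) + polar n c (unitv i) (unitv
      k) (\<lambda>p. - B p j) = 0"
    unfolding 1 by simp
qed

end

section \<open>Storing the unknowns of the system in one list\<close>

lemma dotL_append_left:
  "length v = length a + length b \<Longrightarrow> dotL (a @ b) v = dotL a (take (length a) v) + dotL b (drop
      (length a) v)"
  using dotL_append[of a "take (length a) v" b "drop (length a) v"] by simp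

lemma block_index_less: "b < m \<Longrightarrow> p < n \<Longrightarrow> b * n + p < m * n" for b m n p :: nat
proof -
  assume bp: "b < m" "p < n"
  have "b * n + p < (b + 1) * n" using bp by simp
  also have "\<dots> \<le> m * n" using bp by (intro mult_right_mono) auto
  finally show ?thesis .
qed

lemma dotL_kronL:
  assumes "length v = m * n"
  shows "dotL (kronL (map x [0..<m]) (map y [0..<n])) v = (\<Sum>b<m. \<Sum>p<n. x b * y p * v ! (b * n + p))"
  using assms
proof (induction m arbitrary: v)
  case (Suc m)
  have kron: "kronL (map x [0..<Suc m]) (map y [0..<n])
      = kronL (map x [0..<m]) (map y [0..<n]) @ scaleL (x m) (map y [0..<n])"
    by (simp add: kronL_def)
  have "dotL (scaleL (x m) (map y [0..<n])) (drop (m * n) v) = (\<Sum>p<n. x m * y p * v ! (m * n + p))"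
    using Suc.prems by (subst dotL_sum[of _ n]) (auto simp: algebra_simps)
  moreover have "dotL (kronL (map x [0..<m]) (map y [0..<n])) (take (m * n) v)
      = (\<Sum>b<m. \<Sum>p<n. x b * y p * v ! (b * n + p))"
  proof -
    show ?thesis using Suc.prems block_index_less[of _ m _ n] by (subst Suc.IH) (auto intro!:
        sum.cong)
  qed
  ultimately show ?case unfolding kron using Suc.prems by (subst dotL_append_left) (auto simp:
      add.commute)
qed (simp add: kronL_def)

text \<open>Only the first \<open>length xs\<close> blocks of \<open>u\<close> are read. For a
  solution of the system and a point these are the columns of the candidate matrix, and the second
  half of the unknowns is left aside.\<close>

lemma applyL_eq:
  "length acc = n \<Longrightarrow> length xs * n \<le> length u \<Longrightarrow>
    applyL xs u acc = map (\<lambda>p. acc ! p + (\<Sum>k<length xs. xs ! k * u ! (k * n + p))) [0..<n]"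
proof (induction xs arbitrary: u acc)
  case Nil
  then show ?case by (auto intro: nth_equalityI)
next
  case (Cons x xs)
  let ?acc = "vaddL acc (scaleL x u)"
  have len: "length ?acc = n" using Cons.prems by simp
  have "applyL (x # xs) u acc = map (\<lambda>p. ?acc ! p + (\<Sum>k<length xs. xs ! k * drop n u ! (k * n +
      p))) [0..<n]"
    using Cons.prems Cons.IH[OF len, of "drop n u"] by simp
  also have "\<dots> = map (\<lambda>p. acc ! p + (\<Sum>k<length (x # xs). (x # xs) ! k * u ! (k * n + p))) [0..<n]"
  proof (rule map_cong)
    fix p assume "p \<in> set [0..<n]"
    then have p: "p < n" by simp
    have "?acc ! p = acc ! p + x * u ! p" using p Cons.prems by simp
    moreover have "drop n u ! (k * n + p) = u ! (Suc k * n + p)" for k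
      using Cons.prems by (simp add: add.assoc)
    ultimately show "?acc ! p + (\<Sum>k<length xs. xs ! k * drop n u ! (k * n + p))
        = acc ! p + (\<Sum>k<length (x # xs). (x # xs) ! k * u ! (k * n + p))"
      by (simp add: sum.lessThan_Suc_shift add.assoc del: sum.lessThan_Suc)
  qed simp
  finally show ?case .
qed

context finite_subfield
begin

lemma unitsL_unitv: "unitsL e n = map (\<lambda>i. map (unitv i) [0..<n]) [0..<n]"
  by (simp add: unitsL_def unitv_def)

lemma polar_K:
  assumes "c \<in> cubics n" "\<And>i. i < n \<Longrightarrow> x i \<in> K" "\<And>i. i < n \<Longrightarrow> y i \<in> K" "\<And>i. i < n \<Longrightarrow> z i \<in> K"
  shows "polar n c x y z \<in> K"
proof -
  have "upper c i j k \<in> K" for i j k using assms(1) by (simp add: upper_def cubics_def)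
  then show ?thesis unfolding polar_def using assms by (intro sum_K mult_K add_K) auto
qed

definition eq_vec where
  "eq_vec n c d w i j k =
    kronL (map (unitv k) [0..<n]) (map (\<lambda>p. polar n d (w i) (unitv j) (unitv p)) [0..<n]) @
    kronL (map (unitv j) [0..<n]) (map (\<lambda>p. polar n c (unitv i) (unitv k) (unitv p)) [0..<n])"

lemma set_eqiL:
  assumes "r \<le> n"
  shows "set (eqiL (cubic_coeffs n c) (cubic_coeffs n d) (unitsL e n) (map (\<lambda>i. map (w i) [0..<n])
      [0..<r]) (unitsL e n))
    = (\<Union>i<r. \<Union>j<n. eq_vec n c d w i j ` {..<n})"
proof -
  have zip: "zip (map f [0..<n]) (map g [0..<r]) = map (\<lambda>i. (f i, g i)) [0..<r]" for f :: "nat \<Rightarrow>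
      'u list" and g :: "nat \<Rightarrow> 'u list"
    using assms by (intro nth_equalityI) auto
  show ?thesis
    unfolding eqiL_def unitsL_unitv zip eq_vec_def[abs_def]
    by (simp add: eqjL_def eqkL_def polarL_polar comp_def image_image atLeast0LessThan)
qed

lemma eqiL_vecs:
  assumes "r \<le> n" "c \<in> cubics n" "d \<in> cubics n" "\<And>i p. i < r \<Longrightarrow> p < n \<Longrightarrow> w i p \<in> K"
  shows "set (eqiL (cubic_coeffs n c) (cubic_coeffs n d) (unitsL e n) (map (\<lambda>i. map (w i) [0..<n])
      [0..<r]) (unitsL e n))
    \<subseteq> vecs (2 * (n * n))"
proof -
  have kron: "kronL u v \<in> vecs (n * n)" if "u \<in> vecs n" "v \<in> vecs n" for u v
  proof -
    have "set (kronL u v) \<subseteq> K" using that unfolding kronL_def vecs_def scaleL_def by (auto simp: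
        subset_iff)
    then show ?thesis using that by (simp add: vecs_def)
  qed
  have app: "u @ v \<in> vecs (2 * (n * n))" if "u \<in> vecs (n * n)" "v \<in> vecs (n * n)" for u v
    using that by (auto simp: vecs_def)
  have vec: "map h [0..<n] \<in> vecs n" if "\<And>p. p < n \<Longrightarrow> h p \<in> K" for h
    using that by (auto simp: vecs_def)
  show ?thesis unfolding set_eqiL[OF assms(1)]
    using assms by (auto simp: eq_vec_def intro!: app kron vec polar_K)
qed

lemma eqiL_solves:
  assumes r: "r \<le> n" and c: "c \<in> cubics n" "d \<in> cubics n" and w: "\<And>i p. i < r \<Longrightarrow> p < n \<Longrightarrow> w i p \<in> K"
    and v: "v \<in> vecs (2 * (n * n))"
  shows "(\<forall>l\<in>set (eqiL (cubic_coeffs n c) (cubic_coeffs n d) (unitsL e n) (map (\<lambda>i. map (w i)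
      [0..<n]) [0..<r]) (unitsL e n)). dotL l v = 0)
    \<longleftrightarrow> solves n r c d w (\<lambda>k p. v ! (k * n + p)) (\<lambda>j p. v ! (n * n + (j * n + p)))"
proof -
  note idx = block_index_less[of _ n _ n]
  have len: "length v = n * n + n * n" using vecsD(1)[OF v] by simp
  have vK: "v ! i \<in> K" if "i < n * n + n * n" for i using vecsD(2)[OF v] that by simp
  have block: "dotL (kronL (map (unitv k) [0..<n]) (map y [0..<n])) u = (\<Sum>p<n. u ! (k * n + p) * y
      p)"
    if "k < n" "length u = n * n" "\<And>p. p < n \<Longrightarrow> y p \<in> K" for k u y
  proof -
    have "dotL (kronL (map (unitv k) [0..<n]) (map y [0..<n])) u = (\<Sum>b<n. \<Sum>p<n. unitv k b * y p *
        u ! (b * n + p))"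
      by (rule dotL_kronL[OF that(2)])
    also have "\<dots> = (\<Sum>b<n. if b = k then \<Sum>p<n. e * y p * u ! (b * n + p) else 0)"
      by (intro sum.cong refl) (auto simp: unitv_def intro!: sum.neutral)
    also have "\<dots> = (\<Sum>p<n. e * y p * u ! (k * n + p))" using that(1) by simp
    also have "\<dots> = (\<Sum>p<n. u ! (k * n + p) * y p)"
      using that(3) by (intro sum.cong refl) (simp add: e_mult mult.commute)
    finally show ?thesis .
  qed
  have dot: "dotL (eq_vec n c d w i j k) v
     = polar n d (w i) (unitv j) (\<lambda>p. v ! (k * n + p)) + polar n c (unitv i) (unitv k) (\<lambda>p. v ! (n
         * n + (j * n + p)))"
    if ijk: "i < r" "j < n" "k < n" for i j k
  proof -
    have "polar n d (w i) (unitv j) (\<lambda>p. v ! (k * n + p)) = (\<Sum>p<n. v ! (k * n + p) * polar n d (w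
        i) (unitv j) (unitv p))"
      using vK idx ijk by (intro polar_expand) (simp add: trans_less_add1)
    moreover have "polar n c (unitv i) (unitv k) (\<lambda>p. v ! (n * n + (j * n + p)))
        = (\<Sum>p<n. v ! (n * n + (j * n + p)) * polar n c (unitv i) (unitv k) (unitv p))"
      using vK idx ijk by (intro polar_expand) simp
    moreover have "(\<Sum>p<n. take (n * n) v ! (k * n + p) * y p) = (\<Sum>p<n. v ! (k * n + p) * y p)" for
        y :: "nat \<Rightarrow> 'u"
      using idx ijk len by (intro sum.cong refl) simp
    moreover have "(\<Sum>p<n. drop (n * n) v ! (j * n + p) * y p) = (\<Sum>p<n. v ! (n * n + (j * n + p)) *
        y p)" for y :: "nat \<Rightarrow> 'u"
      using len by (intro sum.cong refl) simp
    ultimately show ?thesis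
      unfolding eq_vec_def using ijk len c w by (subst dotL_append_left) (simp_all add: block
          polar_K)
  qed
  show ?thesis unfolding set_eqiL[OF r] solves_def using dot by (auto simp: lessThan_iff)
qed

text \<open>The map of \<open>solves_adjoints\<close> is injective on solutions: the first family is
  recovered by applying \<open>A\<close> to \<open>B a_k\<close>, the second by undoing the
  combination with the transpose of \<open>A\<close> through the transpose of
  \<open>B\<close>.\<close>

lemma card_solutions:
  assumes r: "r \<le> n" and c: "c \<in> cubics n" "d \<in> cubics n" and AB: "inverse_mats n A B"
    and eq: "\<And>x. (\<And>i. i < n \<Longrightarrow> x i \<in> K) \<Longrightarrow> cform n c x = cform n d (mat_app n A x)"
  defines "S \<equiv> {v \<in> vecs (2 * (n * n)). solves n r c d (\<lambda>i. mat_app n A (unitv i)) (\<lambda>k p. v ! (k *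
      n + p)) (\<lambda>j p. v ! (n * n + (j * n + p)))}"
  shows "card S \<le> card (adjoints n r c)"
proof -
  let ?h = "\<lambda>v. (restrict (\<lambda>(p, k). mat_app n B (\<lambda>p. v ! (k * n + p)) p) ({..<n} \<times> {..<n}),
    restrict (\<lambda>(l, p). \<Sum>j<n. A j l * v ! (n * n + (j * n + p))) ({..<n} \<times> {..<n}))"
  note idx = block_index_less[of _ n _ n]
  have vK: "v ! (k * n + p) \<in> K" "v ! (n * n + (k * n + p)) \<in> K" if "v \<in> S" "k < n" "p < n" for v
      k p
    using that idx[of k p] vecsD(2)[of v "2 * (n * n)"] by (auto simp: S_def)
  have "?h ` S \<subseteq> adjoints n r c"
  proof (rule image_subsetI)
    fix v assume v: "v \<in> S"
    show "?h v \<in> adjoints n r c"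
      using v by (intro solves_adjoints[OF c(1) AB r eq]) (auto simp: S_def intro: vK[OF v])
  qed
  moreover have "inj_on ?h S"
  proof (rule inj_onI)
    fix u v assume uv: "u \<in> S" "v \<in> S" and eq: "?h u = ?h v"
    have AK: "A i j \<in> K" "B i j \<in> K" if "i < n" "j < n" for i j using AB that by (auto simp:
        inverse_mats_def)
    have first: "u ! (k * n + p) = v ! (k * n + p)" if kp: "k < n" "p < n" for k p
    proof -
      have "mat_app n B (\<lambda>p. u ! (k * n + p)) s = mat_app n B (\<lambda>p. v ! (k * n + p)) s" if "s < n"
          for s
        using arg_cong[OF eq, of "\<lambda>h. fst h (s, k)"] that kp by simp
      then have "mat_app n A (mat_app n B (\<lambda>p. u ! (k * n + p))) = mat_app n A (mat_app n B (\<lambda>p. v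
          ! (k * n + p)))"
        by (rule mat_app_cong)
      then show ?thesis
        using mat_app_inverse[OF AB, of "\<lambda>p. u ! (k * n + p)" p] mat_app_inverse[OF AB, of "\<lambda>p. v
            ! (k * n + p)" p] vK uv kp
        by simp
    qed
    have second: "u ! (n * n + (j * n + p)) = v ! (n * n + (j * n + p))" if jp: "j < n" "p < n"
        for j p
    proof -
      have recover: "z j = (\<Sum>l<n. B l j * (\<Sum>s<n. A s l * z s))" if "\<And>s. s < n \<Longrightarrow> z s \<in> K" for z
      proof -
        have "(\<Sum>l<n. B l j * (\<Sum>s<n. A s l * z s)) = (\<Sum>s<n. (\<Sum>l<n. A s l * B l j) * z s)"
          unfolding sum_distrib_left sum_distrib_right by (subst sum.swap) (simp add: mult_ac)
        also have "\<dots> = (\<Sum>s<n. (if j = s then e else 0) * z s)"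
          using AB jp by (intro sum.cong refl) (auto simp: inverse_mats_def)
        also have "\<dots> = z j" using sum_delta_e[of j n z] jp that by simp
        finally show ?thesis ..
      qed
      have "(\<Sum>s<n. A s l * u ! (n * n + (s * n + p))) = (\<Sum>s<n. A s l * v ! (n * n + (s * n + p)))"
          if "l < n" for l
        using arg_cong[OF eq, of "\<lambda>h. snd h (l, p)"] that jp by simp
      then show ?thesis
        using recover[of "\<lambda>s. u ! (n * n + (s * n + p))"] recover[of "\<lambda>s. v ! (n * n + (s * n +
            p))"] vK uv jp by simp
    qed
    show "u = v"
    proof (rule nth_equalityI)
      show "length u = length v" using uv by (simp add: S_def vecs_def)
      fix i assume "i < length u"
      then have i: "i < n * n + n * n" using uv by (simp add: S_def vecs_def)
      have dm: "m = (m div n) * n + m mod n" "m div n < n" "m mod n < n" if "m < n * n" for m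
        using that by (cases "n = 0"; simp add: less_mult_imp_div_less)+
      show "u ! i = v ! i"
      proof (cases "i < n * n")
        case True
        then show ?thesis using first[OF dm(2,3)[OF True]] dm(1)[OF True] by simp
      next
        case False
        then have "i - n * n < n * n" "i = n * n + (i - n * n)" using i by auto
        then show ?thesis using second[OF dm(2,3)[of "i - n * n"]] dm(1)[of "i - n * n"] by metis
      qed
    qed
  qed
  ultimately show ?thesis by (intro card_inj_on_le[of ?h]) auto
qed

end

section \<open>Correctness of the algorithm\<close>

lemma mpoly_closed_cring: "cring R \<Longrightarrow> P \<in> carrier (mpoly_ring R n) \<Longrightarrow> P m \<in> carrier R" for R :: "nat
    ring"
  by (rule nat_cring.mpoly_closed) (simp_all add: nat_cring_def)

context iso_run
begin

interpretation nat_cring R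
  by (simp add: nat_cring_def cring_R)

abbreviation subK :: "prod_ring set" where
  "subK \<equiv> emb R ` carrier R"

lemma el_inject: "a \<in> subK \<Longrightarrow> b \<in> subK \<Longrightarrow> el a = el b \<longleftrightarrow> a = b"
  by (auto simp: el_def cring_R)

lemma ev_inject: "set u \<subseteq> subK \<Longrightarrow> set v \<subseteq> subK \<Longrightarrow> ev u = ev v \<longleftrightarrow> u = v"
proof (rule encl_inject)
  assume "set u \<subseteq> subK" "set v \<subseteq> subK"
  moreover have "inj_on el subK" by (simp add: inj_on_def el_inject)
  ultimately show "inj_on el (set u \<union> set v)" by (meson inj_on_subset Un_least)
qed

lemma set_els: "set els = subK"
  by (auto simp: els_def carrier_R)

context
  assumes odd_q: "odd q"
begin

interpretation F: finite_subfield subK "emb R \<one>\<^bsub>R\<^esub>"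
  by (rule finite_subfield_emb(1)[OF field_R carrier_R odd_q])

lemma F_q: "F.q = q"
  unfolding F.q_def by (rule finite_subfield_emb(2)[OF field_R carrier_R odd_q])

lemma emb_cubics: "f \<in> cubic_forms R n \<Longrightarrow> (\<lambda>m. emb R (f m)) \<in> F.cubics n"
  by (auto simp: F.cubics_def cubic_forms_iff)

lemma bij_cubics: "bij_betw (\<lambda>f m. emb R (f m)) (cubic_forms R n) (F.cubics n)"
proof (rule bij_betw_byWitness[where f' = "\<lambda>c m. proj R (c m)"])
  show "\<forall>f\<in>cubic_forms R n. (\<lambda>m. proj R (emb R (f m))) = f"
    by (auto simp: cubic_forms_iff cring_R)
  show "\<forall>c\<in>F.cubics n. (\<lambda>m. emb R (proj R (c m))) = c"
  proof
    fix c assume "c \<in> F.cubics n"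
    then have "c m \<in> subK" for m by (simp add: F.cubics_def)
    then have "emb R (proj R (c m)) = c m" for m by (metis imageE proj_emb_same[OF cring_R])
    then show "(\<lambda>m. emb R (proj R (c m))) = c" by simp
  qed
  show "(\<lambda>f m. emb R (f m)) ` cubic_forms R n \<subseteq> F.cubics n" using emb_cubics by auto
  show "(\<lambda>c m. proj R (c m)) ` F.cubics n \<subseteq> cubic_forms R n"
    by (auto simp: F.cubics_def cubic_forms_iff proj_closed[OF cring_R] proj_ops(1)[OF cring_R])
qed

text \<open>Isomorphism becomes an identity between functions on \<open>K^n\<close>. The way back to
  an identity between polynomials rests on \<open>cform_inject\<close>.\<close>

lemma isomorphic_forms_iff:
  assumes f: "f \<in> cubic_forms R n" and g: "g \<in> cubic_forms R n"
  shows "isomorphic_forms R n f g \<longleftrightarrow> (\<exists>A B. F.inverse_mats n A B \<and>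
    (\<forall>x. (\<forall>i<n. x i \<in> subK) \<longrightarrow> cform n (\<lambda>m. emb R (f m)) x = cform n (\<lambda>m. emb R (g m)) (mat_app n A
      x)))"
proof
  assume "isomorphic_forms R n f g"
  then obtain A where A: "A \<in> general_linear R n" "f = subst_matrix R n g A"
    by (auto simp: isomorphic_forms_def)
  then have AK: "\<forall>i<n. \<forall>j<n. A i j \<in> carrier R" by (simp add: general_linear_def)
  from A(1) obtain B where BK: "\<forall>i<n. \<forall>j<n. B i j \<in> carrier R"
    and AB: "\<forall>i<n. \<forall>j<n. (\<Oplus>\<^bsub>R\<^esub>k\<in>{..<n}. A i k \<otimes>\<^bsub>R\<^esub> B k j) = (if i = j then \<one>\<^bsub>R\<^esub> else \<zero>\<^bsub>R\<^esub>)"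
    and BA: "\<forall>i<n. \<forall>j<n. (\<Oplus>\<^bsub>R\<^esub>k\<in>{..<n}. B i k \<otimes>\<^bsub>R\<^esub> A k j) = (if i = j then \<one>\<^bsub>R\<^esub> else \<zero>\<^bsub>R\<^esub>)"
    by (auto simp: general_linear_def)
  let ?A = "\<lambda>i j. emb R (A i j)" and ?B = "\<lambda>i j. emb R (B i j)"
  have sum: "(\<Sum>k<n. emb R (C i k) * emb R (D k j)) = (if i = j then emb R \<one>\<^bsub>R\<^esub> else 0)"
    if "\<forall>i<n. \<forall>j<n. C i j \<in> carrier R" "\<forall>i<n. \<forall>j<n. D i j \<in> carrier R" "i < n" "j < n"
      "\<forall>i<n. \<forall>j<n. (\<Oplus>\<^bsub>R\<^esub>k\<in>{..<n}. C i k \<otimes>\<^bsub>R\<^esub> D k j) = (if i = j then \<one>\<^bsub>R\<^esub> else \<zero>\<^bsub>R\<^esub>)" for C D i j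
  proof -
    have "(\<Sum>k<n. emb R (C i k) * emb R (D k j)) = (\<Sum>k<n. emb R (C i k \<otimes>\<^bsub>R\<^esub> D k j))"
      using that by (intro sum.cong refl) (simp add: emb_hom(2)[OF cring_R])
    also have "\<dots> = emb R (\<Oplus>\<^bsub>R\<^esub>k\<in>{..<n}. C i k \<otimes>\<^bsub>R\<^esub> D k j)"
      using that by (intro emb_finsum[symmetric]) auto
    finally show ?thesis using that by simp
  qed
  have "F.inverse_mats n ?A ?B"
    unfolding F.inverse_mats_def using AK BK sum[OF AK BK _ _ AB] sum[OF BK AK _ _ BA] by auto
  moreover have "cform n (\<lambda>m. emb R (f m)) x = cform n (\<lambda>m. emb R (g m)) (mat_app n ?A x)" for x
  proof -
    have "g \<in> mpolys n" using g by (simp add: cubic_forms_def)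
    then have "peval f x = peval g (\<lambda>i. \<Sum>j<n. emb R (A i j) * x j)"
      unfolding A(2) by (rule peval_subst_matrix[OF _ AK])
    then show ?thesis unfolding peval_cform[OF f] peval_cform[OF g] mat_app_def .
  qed
  ultimately show "\<exists>A B. F.inverse_mats n A B \<and>
    (\<forall>x. (\<forall>i<n. x i \<in> subK) \<longrightarrow> cform n (\<lambda>m. emb R (f m)) x = cform n (\<lambda>m. emb R (g m)) (mat_app n A
      x))"
    by (intro exI[of _ ?A] exI[of _ ?B]) auto
next
  assume "\<exists>A B. F.inverse_mats n A B \<and>
    (\<forall>x. (\<forall>i<n. x i \<in> subK) \<longrightarrow> cform n (\<lambda>m. emb R (f m)) x = cform n (\<lambda>m. emb R (g m)) (mat_app n A
      x))"
  then obtain A B where inv: "F.inverse_mats n A B"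
    and eq: "\<And>x. (\<And>i. i < n \<Longrightarrow> x i \<in> subK) \<Longrightarrow> cform n (\<lambda>m. emb R (f m)) x = cform n (\<lambda>m. emb R (g
        m)) (mat_app n A x)"
    by blast
  let ?A = "\<lambda>i j. proj R (A i j)" and ?B = "\<lambda>i j. proj R (B i j)"
  have AK: "\<forall>i<n. \<forall>j<n. ?A i j \<in> carrier R" "\<forall>i<n. \<forall>j<n. ?B i j \<in> carrier R"
    using proj_closed[OF cring_R] by auto
  have emb_proj: "emb R (proj R a) = a" if "a \<in> subK" for a using that by (auto simp: cring_R)
  have fin: "(\<Oplus>\<^bsub>R\<^esub>k\<in>{..<n}. proj R (C i k) \<otimes>\<^bsub>R\<^esub> proj R (D k j)) = proj R (\<Sum>k<n. C i k * D k j)"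
      for C D :: "nat \<Rightarrow> nat \<Rightarrow> prod_ring" and i j
  proof -
    have "(\<Oplus>\<^bsub>R\<^esub>k\<in>S. proj R (h k)) = proj R (\<Sum>k\<in>S. h k)" if "finite S" for S :: "nat set" and h
      using that
    proof (induction S)
      case empty
      then show ?case by (simp add: proj_ops(1)[OF cring_R])
    next
      case (insert s S)
      then have "(\<Oplus>\<^bsub>R\<^esub>k\<in>insert s S. proj R (h k)) = proj R (h s) \<oplus>\<^bsub>R\<^esub> (\<Oplus>\<^bsub>R\<^esub>k\<in>S. proj R (h k))"
        using proj_closed[OF cring_R] by (intro finsum_insert) auto
      then show ?case using insert by (simp add: proj_ops(3)[OF cring_R])
    qed
    from this[of "{..<n}" "\<lambda>k. C i k * D k j"] show ?thesis by (simp add: proj_ops(4)[OF cring_R])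
  qed
  have one: "proj R (emb R \<one>\<^bsub>R\<^esub>) = \<one>\<^bsub>R\<^esub>" "proj R 0 = \<zero>\<^bsub>R\<^esub>" by (simp_all add: cring_R proj_ops)
  have "?A \<in> general_linear R n"
    unfolding general_linear_def using AK inv one
    by (auto simp: fin F.inverse_mats_def intro!: exI[of _ ?B])
  moreover have "f = subst_matrix R n g ?A"
  proof -
    have s: "subst_matrix R n g ?A \<in> cubic_forms R n" by (rule subst_matrix_cubic_forms[OF g AK(1)])
    have "(\<lambda>m. emb R (f m)) = (\<lambda>m. emb R (subst_matrix R n g ?A m))"
    proof (rule F.cform_inject[OF emb_cubics[OF f] emb_cubics[OF s]])
      fix x assume x: "\<And>i. i < n \<Longrightarrow> x i \<in> subK"
      have "cform n (\<lambda>m. emb R (subst_matrix R n g ?A m)) x = peval (subst_matrix R n g ?A) x"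
        by (rule peval_cform[OF s, symmetric])
      also have "\<dots> = peval g (\<lambda>i. \<Sum>j<n. emb R (?A i j) * x j)"
        using g AK by (intro peval_subst_matrix) (auto simp: cubic_forms_def)
      also have "\<dots> = cform n (\<lambda>m. emb R (g m)) (mat_app n A x)"
        unfolding peval_cform[OF g] using inv
        by (intro cform_cong) (auto simp: mat_app_def F.inverse_mats_def emb_proj intro!: sum.cong)
      also have "\<dots> = cform n (\<lambda>m. emb R (f m)) x" using eq[of x] x by simp
      finally show "cform n (\<lambda>m. emb R (f m)) x = cform n (\<lambda>m. emb R (subst_matrix R n g ?A m)) x"
          ..
    qed
    then have "emb R (f m) = emb R (subst_matrix R n g ?A m)" for m by (rule fun_cong)
    then show ?thesis using f s by (auto simp: fun_eq_iff cubic_forms_iff emb_inject[OF cring_R])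
  qed
  ultimately show "isomorphic_forms R n f g" by (auto simp: isomorphic_forms_def)
qed

lemma set_n_lists_els: "set (List.n_lists m els) = F.vecs m"
  by (auto simp: set_n_lists set_els F.vecs_def)

lemma hd0_eqiL:
  assumes "length ws = 40"
  shows "length (hd0 (eqiL f g (unitsL (emb R \<one>\<^bsub>R\<^esub>) n) ws (unitsL (emb R \<one>\<^bsub>R\<^esub>) n))) = 2 * (n * n)"
proof (cases "n = 0")
  case True
  then show ?thesis by (simp add: hd0_def eqiL_def)
next
  case False
  let ?E = "unitsL (emb R \<one>\<^bsub>R\<^esub>) n"
  have "eqiL f g ?E ws ?E \<noteq> []"
  proof -
    obtain x xs w ws' where "?E = x # xs" "ws = w # ws'"
      using False assms by (cases ?E; cases ws) (auto simp: unitsL_def)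
    moreover have "length (eqjL f g x w ?E ?E) \<noteq> 0" using False by (simp add: length_eqjL)
    ultimately show ?thesis by (auto simp: eqiL_def)
  qed
  then show ?thesis
    using length_eqiL(2)[of ?E f g ws] by (simp add: hd0_def length_unitsL_elem)
qed

lemma applyL_mat_app:
  assumes "length u = 2 * (n * n)" "p < n"
  shows "applyL (map x [0..<n]) u (replicate n 0) ! p = mat_app n (\<lambda>p k. u ! (k * n + p)) x p"
  using assms by (subst applyL_eq[of _ n]) (auto simp: mat_app_def mult.commute)

text \<open>All compared values lie in the embedded field, where the encodings are injective, and
  the list of points runs through all of \<open>K^n\<close>.\<close>

lemma checkL_iff:
  assumes f: "f \<in> cubic_forms R n" and g: "g \<in> cubic_forms R n" and u: "u \<in> F.vecs (2 * (n * n))"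
  defines "A \<equiv> \<lambda>p k. u ! (k * n + p)"
  shows "checkL (cubic_coeffs n (\<lambda>m. emb R (f m))) (cubic_coeffs n (\<lambda>m. emb R (g m))) u
      (List.n_lists n els) (replicate n 0)
    \<longleftrightarrow> (\<forall>x. (\<forall>i<n. x i \<in> subK) \<longrightarrow>
      cform n (\<lambda>m. emb R (f m)) x = cform n (\<lambda>m. emb R (g m)) (mat_app n A x) \<and>
      ((\<forall>i<n. mat_app n A x i = 0) \<longrightarrow> (\<forall>i<n. x i = 0)))" (is "?L \<longleftrightarrow> ?R")
proof -
  let ?f = "cubic_coeffs n (\<lambda>m. emb R (f m))" and ?g = "cubic_coeffs n (\<lambda>m. emb R (g m))"
  have AK: "A i j \<in> subK" if "i < n" "j < n" for i j
    unfolding A_def using F.vecsD(2)[OF u] block_index_less[OF that(2,1)] by simp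
  have cK: "cform n (\<lambda>m. emb R (h m)) x \<in> subK" if "h \<in> cubic_forms R n" "\<And>i. i < n \<Longrightarrow> x i \<in> subK"
      for h x
  proof -
    have "upper (\<lambda>m. emb R (h m)) i j k \<in> subK" for i j k
      using emb_cubics[OF that(1)] by (simp add: upper_def F.cubics_def)
    then show ?thesis unfolding cform_def using that(2) by (intro F.sum_K F.mult_K) auto
  qed
  have chk: "chkL ?f ?g (map x [0..<n]) (applyL (map x [0..<n]) u (replicate n 0)) (replicate n 0) \<longleftrightarrow>
      cform n (\<lambda>m. emb R (f m)) x = cform n (\<lambda>m. emb R (g m)) (mat_app n A x) \<and>
      ((\<forall>i<n. mat_app n A x i = 0) \<longrightarrow> (\<forall>i<n. x i = 0))" if x: "\<And>i. i < n \<Longrightarrow> x i \<in> subK" for x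
  proof -
    have "length (applyL (map x [0..<n]) u (replicate n 0)) = n"
      using F.vecsD(1)[OF u] by (subst applyL_eq[of _ n]) auto
    then have app: "applyL (map x [0..<n]) u (replicate n 0) = map (mat_app n A x) [0..<n]"
      using F.vecsD(1)[OF u] by (intro nth_equalityI) (auto simp: applyL_mat_app A_def)
    have AxK: "mat_app n A x i \<in> subK" if "i < n" for i using AK x that by (rule F.mat_app_K)
    have z: "map y [0..<n] = replicate n 0 \<longleftrightarrow> (\<forall>i<n. y i = 0)" for y :: "nat \<Rightarrow> prod_ring"
      by (auto simp: list_eq_iff_nth_eq)
    have "el (evalL ?f (map x [0..<n])) = el (evalL ?g (map (mat_app n A x) [0..<n])) \<longleftrightarrow>
        cform n (\<lambda>m. emb R (f m)) x = cform n (\<lambda>m. emb R (g m)) (mat_app n A x)"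
      unfolding evalL_cform using f g x AxK by (intro el_inject cK) auto
    moreover have "ev (map y [0..<n]) = ev (replicate n 0) \<longleftrightarrow> (\<forall>i<n. y i = 0)" if "\<And>i. i < n \<Longrightarrow> y i
        \<in> subK" for y
      using that F.zero_K by (subst ev_inject) (auto simp: z)
    ultimately show ?thesis unfolding chkL_def app using x AxK by simp
  qed
  show ?thesis
  proof
    assume L: ?L
    show ?R
    proof (intro allI impI)
      fix x assume "\<forall>i<n. x i \<in> subK"
      then have x: "\<And>i. i < n \<Longrightarrow> x i \<in> subK" by simp
      then have "map x [0..<n] \<in> set (List.n_lists n els)" unfolding set_n_lists_els F.vecs_def by
          auto
      with L have "chkL ?f ?g (map x [0..<n]) (applyL (map x [0..<n]) u (replicate n 0))
          (replicate n 0)"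
        unfolding checkL_def by blast
      then show "cform n (\<lambda>m. emb R (f m)) x = cform n (\<lambda>m. emb R (g m)) (mat_app n A x) \<and>
          ((\<forall>i<n. mat_app n A x i = 0) \<longrightarrow> (\<forall>i<n. x i = 0))" using chk[OF x] by simp
    qed
  next
    assume R: ?R
    show ?L unfolding checkL_def
    proof
      fix v assume "v \<in> set (List.n_lists n els)"
      then have v: "v \<in> F.vecs n" unfolding set_n_lists_els .
      then have x: "\<And>i. i < n \<Longrightarrow> v ! i \<in> subK" by (rule F.vecsD(2))
      have "v = map (\<lambda>i. v ! i) [0..<n]" using F.vecsD(1)[OF v] by (metis map_nth)
      then show "chkL ?f ?g v (applyL v u (replicate n 0)) (replicate n 0)"
        using chk[of "\<lambda>i. v ! i"] R x by metis
    qed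
  qed
qed

lemma zero_test: "a \<in> subK \<Longrightarrow> is_zero a \<longleftrightarrow> a = 0"
  using el_inject F.zero_K by simp

text \<open>Pairing with the unit vectors cuts the tuple of guesses to length \<open>n\<close>. This
  matters for \<open>n < 40\<close>, where soundness is claimed too.\<close>

lemma eqiL_take: "eqiL f g Es ws Es = eqiL f g Es (take (length Es) ws) Es"
proof -
  have "zip xs ys = zip xs (take (length xs) ys)" for xs ys :: "'b list"
  proof (induction xs arbitrary: ys)
    case (Cons x xs)
    show ?case using Cons.IH by (cases ys) auto
  qed simp
  then show ?thesis unfolding eqiL_def by (metis (no_types))
qed

text \<open>The check on all points makes the matrix injective, hence invertible, and shows that it
  transforms \<open>g\<close> into \<open>f\<close>. What elimination has to supply is that the
  entries of a candidate lie in the embedded field.\<close>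

lemma iso_test_sound:
  assumes f: "f \<in> cubic_forms R n" and g: "g \<in> cubic_forms R n"
    and test: "iso_test (cubic_coeffs n (\<lambda>m. emb R (f m))) (cubic_coeffs n (\<lambda>m. emb R (g m)))"
  shows "isomorphic_forms R n f g"
proof -
  let ?e = "emb R \<one>\<^bsub>R\<^esub>" and ?N = "2 * (n * n)"
  let ?f = "cubic_coeffs n (\<lambda>m. emb R (f m))" and ?g = "cubic_coeffs n (\<lambda>m. emb R (g m))"
  from test obtain ws cs where ws: "ws \<in> set (List.n_lists 40 (List.n_lists n els))"
    and cs: "cs \<in> set (List.n_lists (169 * n) els)"
    and check: "checkL ?f ?g (lincombL cs (kernL is_zero (eqiL ?f ?g (unitsL ?e n) ws (unitsL ?e
        n)) (unitsL ?e ?N)) (replicate ?N 0))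
      (List.n_lists n els) (replicate n 0)"
    unfolding iso_test_def tupsL_def tryL_def candsL_def by (auto simp: set_n_lists hd0_eqiL)
  have ws': "length ws = 40" "\<And>i. i < 40 \<Longrightarrow> ws ! i \<in> F.vecs n"
    using ws set_n_lists_els[of n] by (auto simp: set_n_lists)
  define r where "r = min n 40"
  have "take n ws = map (\<lambda>i. map (\<lambda>p. ws ! i ! p) [0..<n]) [0..<r]"
    using ws' F.vecsD(1)[OF ws'(2)] by (intro nth_equalityI) (auto simp: r_def intro!:
        nth_equalityI)
  then have eqs: "eqiL ?f ?g (unitsL ?e n) ws (unitsL ?e n) = eqiL ?f ?g (unitsL ?e n) (map (\<lambda>i.
      map (\<lambda>p. ws ! i ! p) [0..<n]) [0..<r]) (unitsL ?e n)"
    using eqiL_take[of ?f ?g "unitsL ?e n" ws] by simp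
  have "set (eqiL ?f ?g (unitsL ?e n) ws (unitsL ?e n)) \<subseteq> F.vecs ?N"
    unfolding eqs using emb_cubics f g F.vecsD(2)[OF ws'(2)] by (intro F.eqiL_vecs) (auto simp:
        r_def)
  then have "set (kernL is_zero (eqiL ?f ?g (unitsL ?e n) ws (unitsL ?e n)) (unitsL ?e ?N)) \<subseteq>
      F.vecs ?N"
    by (intro F.kernL_vecs zero_test)
  then have u: "lincombL cs (kernL is_zero (eqiL ?f ?g (unitsL ?e n) ws (unitsL ?e n)) (unitsL ?e
      ?N)) (replicate ?N 0) \<in> F.vecs ?N"
    using cs F.zero_K by (intro F.lincombL_vecs) (auto simp: set_n_lists_els F.vecs_def)
  define u where "u = lincombL cs (kernL is_zero (eqiL ?f ?g (unitsL ?e n) ws (unitsL ?e n))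
      (unitsL ?e ?N)) (replicate ?N 0)"
  define A where "A = (\<lambda>p k. u ! (k * n + p))"
  have uN: "u \<in> F.vecs ?N" using u by (simp add: u_def)
  have R: "\<forall>x. (\<forall>i<n. x i \<in> subK) \<longrightarrow>
      cform n (\<lambda>m. emb R (f m)) x = cform n (\<lambda>m. emb R (g m)) (mat_app n A x) \<and>
      ((\<forall>i<n. mat_app n A x i = 0) \<longrightarrow> (\<forall>i<n. x i = 0))"
    using check checkL_iff[OF f g uN] unfolding u_def[symmetric] A_def by blast
  have AK: "A i j \<in> subK" if "i < n" "j < n" for i j
    unfolding A_def using F.vecsD(2)[OF uN] block_index_less[OF that(2,1)] by simp
  obtain B where "F.inverse_mats n A B"
    using F.injective_matrix_invertible[of n A] AK R by metis
  then show ?thesis unfolding isomorphic_forms_iff[OF f g] using R by blast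
qed

text \<open>The successful tuple consists of the images of the unit vectors under an isomorphism
  \<open>A\<close>. For it the system is solved by \<open>A\<close> and its negated inverse, and the
  bound on the adjoints limits the whole solution space, so that this solution is among the
  enumerated combinations.\<close>

lemma iso_test_complete:
  assumes f: "f \<in> cubic_forms R n" and g: "g \<in> cubic_forms R n" and iso: "isomorphic_forms R n f g"
    and n: "40 \<le> n" and adj: "card (F.adjoints n 40 (\<lambda>m. emb R (f m))) \<le> q ^ (169 * n)"
  shows "iso_test (cubic_coeffs n (\<lambda>m. emb R (f m))) (cubic_coeffs n (\<lambda>m. emb R (g m)))"
proof -
  let ?e = "emb R \<one>\<^bsub>R\<^esub>" and ?N = "2 * (n * n)"
  let ?c = "\<lambda>m. emb R (f m)" and ?d = "\<lambda>m. emb R (g m)"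
  from iso obtain A B where AB: "F.inverse_mats n A B"
    and eq: "\<And>x. (\<And>i. i < n \<Longrightarrow> x i \<in> subK) \<Longrightarrow> cform n ?c x = cform n ?d (mat_app n A x)"
    unfolding isomorphic_forms_iff[OF f g] by blast
  have AK: "A i j \<in> subK" "B i j \<in> subK" if "i < n" "j < n" for i j
    using AB that by (auto simp: F.inverse_mats_def)
  define w where "w i = mat_app n A (F.unitv i)" for i
  have wK: "w i p \<in> subK" if "p < n" for i p unfolding w_def using AK(1) that by (intro
      F.mat_app_K) auto
  define ws where "ws = map (\<lambda>i. map (w i) [0..<n]) [0..<40]"
  let ?eqs = "eqiL (cubic_coeffs n ?c) (cubic_coeffs n ?d) (unitsL ?e n) ws (unitsL ?e n)"
  have ws: "ws \<in> set (List.n_lists 40 (List.n_lists n els))"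
    using wK by (auto simp: set_n_lists[of 40] set_n_lists_els ws_def F.vecs_def)
  have eqs: "set ?eqs \<subseteq> F.vecs ?N"
    unfolding ws_def using n emb_cubics f g wK by (intro F.eqiL_vecs) auto
  \<comment> \<open>Position \<open>t\<close> is row \<open>t mod n\<close> of block
    \<open>t div n\<close>: first the columns of \<open>A\<close>, then the negated columns of its
    inverse.\<close>
  define v where "v = map (\<lambda>t. if t < n * n then A (t mod n) (t div n)
      else - B ((t - n * n) mod n) ((t - n * n) div n)) [0..<?N]"
  note idx = block_index_less[of _ n _ n]
  have vA: "v ! (k * n + p) = A p k" and vB: "v ! (n * n + (k * n + p)) = - B p k" if "k < n" "p <
      n" for k p
    using idx[OF that] that by (auto simp: v_def trans_less_add1)
  have v: "v \<in> F.vecs ?N"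
  proof (rule F.vecsI)
    fix t assume t: "t < ?N"
    have n0: "0 < n" using n by simp
    have "t div n < n" if "t < n * n" for t using that by (simp add: less_mult_imp_div_less)
    then show "v ! t \<in> subK"
      using t n0 AK F.uminus_K by (auto simp: v_def)
  qed (simp add: v_def)
  have cd: "?c \<in> F.cubics n" "?d \<in> F.cubics n" using emb_cubics f g by auto
  have "F.solves n 40 ?c ?d w (\<lambda>k p. v ! (k * n + p)) (\<lambda>j p. v ! (n * n + (j * n + p)))"
    unfolding F.solves_def
  proof (intro allI impI)
    fix i j k assume ijk: "i < (40 :: nat)" "j < n" "k < n"
    have "polar n ?d (w i) (F.unitv j) (\<lambda>p. v ! (k * n + p)) = polar n ?d (w i) (F.unitv j) (\<lambda>p. A
        p k)"
      using vA ijk by (intro polar_cong) auto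
    moreover have "polar n ?c (F.unitv i) (F.unitv k) (\<lambda>p. v ! (n * n + (j * n + p))) = polar n ?c
        (F.unitv i) (F.unitv k) (\<lambda>p. - B p j)"
      using vB ijk by (intro polar_cong) auto
    ultimately show "polar n ?d (w i) (F.unitv j) (\<lambda>p. v ! (k * n + p)) + polar n ?c (F.unitv i)
        (F.unitv k) (\<lambda>p. v ! (n * n + (j * n + p))) = 0"
      using F.solves_inverse[OF AB n eq] ijk unfolding F.solves_def w_def by simp
  qed
  then have dot: "\<forall>l\<in>set ?eqs. dotL l v = 0"
    unfolding ws_def using F.eqiL_solves[OF n cd _ v, of w] wK by blast
  have card: "card {v \<in> F.vecs ?N. \<forall>l\<in>set ?eqs. dotL l v = 0} \<le> F.q ^ (169 * n)"
  proof -
    have "{v \<in> F.vecs ?N. \<forall>l\<in>set ?eqs. dotL l v = 0}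
        = {v \<in> F.vecs ?N. F.solves n 40 ?c ?d w (\<lambda>k p. v ! (k * n + p)) (\<lambda>j p. v ! (n * n + (j * n
            + p)))}"
      unfolding ws_def using F.eqiL_solves[OF n cd, of w] wK by blast
    then show ?thesis
      using F.card_solutions[OF n cd AB eq] adj unfolding w_def F_q by simp
  qed
  obtain cs where cs: "cs \<in> F.vecs (169 * n)" "lincombL cs (kernL is_zero ?eqs (unitsL ?e ?N))
      (replicate ?N 0) = v"
    using F.kernel_enumeration[OF zero_test eqs v dot card] by blast
  have "checkL (cubic_coeffs n ?c) (cubic_coeffs n ?d) v (List.n_lists n els) (replicate n 0)"
    unfolding checkL_iff[OF f g v]
  proof (intro allI impI conjI)
    fix x assume x: "\<forall>i<n. x i \<in> subK"
    have app: "mat_app n (\<lambda>p k. v ! (k * n + p)) x i = mat_app n A x i" if "i < n" for i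
      using vA that by (simp add: mat_app_def)
    show "cform n ?c x = cform n ?d (mat_app n (\<lambda>p k. v ! (k * n + p)) x)"
      using eq[of x] x app cform_cong[of n "mat_app n A x" "mat_app n (\<lambda>p k. v ! (k * n + p)) x"
          ?d] by simp
    fix i assume zero: "\<forall>i<n. mat_app n (\<lambda>p k. v ! (k * n + p)) x i = 0" and i: "i < n"
    have "x i = mat_app n B (mat_app n A x) i"
      using F.mat_app_inverse[OF F.inverse_mats_sym[OF AB], of x i] x i by simp
    also have "\<dots> = mat_app n B (\<lambda>_. 0) i"
      using zero app by (subst mat_app_cong[of n "mat_app n A x" "\<lambda>_. 0"]) auto
    also have "\<dots> = 0" by (simp add: mat_app_def)
    finally show "x i = 0" .
  qed
  moreover have "length ws = 40" by (simp add: ws_def)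
  moreover have "cs \<in> set (List.n_lists (169 * n) els)" using cs by (simp add: set_n_lists_els)
  ultimately show ?thesis
    unfolding iso_test_def tupsL_def tryL_def candsL_def using ws cs(2) by (auto simp: hd0_eqiL
        intro!: bexI[of _ ws] bexI[of _ cs])
qed

text \<open>By soundness and completeness, an error for some \<open>g\<close> forces
  \<open>f\<close> to have more than \<open>q^(169 n)\<close> adjoints. This is a condition on
  \<open>f\<close> alone, so one exceptional set serves all \<open>g\<close>.\<close>

lemma card_bad_forms:
  assumes n: "80 \<le> n"
  shows "card {f \<in> cubic_forms R n. \<exists>g\<in>cubic_forms R n.
      \<not> (iso_test (cubic_coeffs n (\<lambda>m. emb R (f m))) (cubic_coeffs n (\<lambda>m. emb R (g m))) \<longleftrightarrow>
          isomorphic_forms R n f g)} * q ^ n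
    \<le> card (cubic_forms R n)"
    (is "card ?bad * _ \<le> _")
proof -
  let ?h = "\<lambda>f m. emb R (f m)"
  let ?C = "{c \<in> F.cubics n. card (F.adjoints n 40 c) > F.q ^ (169 * n)}"
  have bij: "inj_on ?h (cubic_forms R n)" "?h ` cubic_forms R n = F.cubics n"
    using bij_cubics by (auto simp: bij_betw_def)
  have "?h ` ?bad \<subseteq> ?C"
  proof (rule image_subsetI, rule ccontr)
    fix f assume f: "f \<in> ?bad" "?h f \<notin> ?C"
    then have "card (F.adjoints n 40 (?h f)) \<le> q ^ (169 * n)" using emb_cubics by (auto simp: F_q
        not_less)
    then show False using f iso_test_sound iso_test_complete n by auto
  qed
  moreover have "inj_on ?h ?bad" using bij(1) by (rule inj_on_subset) auto
  ultimately have "card ?bad \<le> card ?C" by (intro card_inj_on_le[of ?h]) auto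
  then have "card ?bad * q ^ n \<le> card ?C * q ^ n" by (rule mult_right_mono) simp
  also have "\<dots> \<le> card (F.cubics n)" using F.card_many_adjoints[OF n] by (simp add: F_q)
  also have "\<dots> = card (cubic_forms R n)" using bij card_image by metis
  finally show ?thesis .
qed

lemma finite_cubic_forms: "finite (cubic_forms R n)"
  using bij_cubics bij_betw_finite F.finite_cubics by blast

end

end

theorem theorem3p1:
  shows "\<exists>(P :: program) (t :: nat \<Rightarrow> nat) (e :: nat \<Rightarrow> nat).
    (\<lambda>n. real (t n)) \<in> O(\<lambda>n. real n) \<and>
    (\<lambda>n. real (e n)) \<in> \<Omega>(\<lambda>n. real n) \<and>
    (\<forall>(R :: nat ring) (q :: nat) (n :: nat).
       field R \<and> carrier R = {..<q} \<and> odd q \<longrightarrow>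
         (\<forall>f\<in>cubic_forms R n. \<forall>g\<in>cubic_forms R n.
            halts_within P (enc_input R q n f g) (q ^ t n)) \<and>
         real (card {f \<in> cubic_forms R n. \<exists>g\<in>cubic_forms R n.
            \<not> (accepts P (enc_input R q n f g) \<longleftrightarrow> isomorphic_forms R n f g)})
           / real (card (cubic_forms R n)) \<le> 1 / real q ^ e n)"
proof (rule exI[of _ iso_program], rule exI[of _ "\<lambda>n. 4800 * (n + 1)"],
    rule exI[of _ "\<lambda>n. if 80 \<le> n then n else 0"], intro conjI allI impI)
  show "(\<lambda>n. real (4800 * (n + 1))) \<in> O(\<lambda>n. real n)"
    by (rule bigoI[of _ 9600]) (auto intro!: eventually_sequentiallyI[of 1])
  \<comment> \<open>For \<open>n\<close> below 80 the exponent 0 reduces the claim to a fraction of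
    at most 1; the lower bound on its growth concerns large \<open>n\<close> only.\<close>
  show "(\<lambda>n. real (if 80 \<le> n then n else 0)) \<in> \<Omega>(\<lambda>n. real n)"
    by (rule landau_omega.bigI[of 1]) (auto intro!: eventually_sequentiallyI[of 80])
next
  fix R :: "nat ring" and q n :: nat
  assume "field R \<and> carrier R = {..<q} \<and> odd q"
  then have R: "field R" "carrier R = {..<q}" and odd: "odd q" by auto
  interpret F: finite_subfield "emb R ` carrier R" "emb R \<one>\<^bsub>R\<^esub>"
    by (rule finite_subfield_emb(1)[OF R odd])
  have q: "3 \<le> q" using F.card_K_ge_3 finite_subfield_emb(2)[OF R odd] by simp
  \<comment> \<open>The exponent exceeds both \<open>169 n\<close> and \<open>40 n\<close>, the
    exponents of the enumerated lists, and leaves room for \<open>1000 <= 3^7\<close> and for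
    \<open>200 (n + 1)^3\<close>, which is at most \<open>q^(5 + 3 n)\<close>.\<close>
  define M where "M = q ^ (200 * (n + 1))"
  have less: "q ^ a < M" if "a < 200 * (n + 1)" for a
    unfolding M_def using q that by (intro power_strict_increasing) auto
  have pow: "3 ^ a \<le> q ^ a" for a using q by (intro power_mono) auto
  interpret iso_run R q n M
  proof (rule iso_run.intro)
    show "field R" "carrier R = {..<q}" by fact+
    show "q < M" using less[of 1] by simp
    have "1000 \<le> (3 :: nat) ^ 7" by simp
    also have "\<dots> \<le> q ^ 7" by (rule pow)
    also have "\<dots> < M" by (rule less) simp
    finally show "1000 \<le> M" by simp
    have "n + 1 \<le> 2 ^ n" by (metis Suc_eq_plus1 Suc_leI less_exp)
    also have "\<dots> \<le> q ^ n" using q by (intro power_mono) auto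
    finally have "(n + 1) ^ 3 \<le> (q ^ n) ^ 3" by (rule power_mono) simp
    moreover have "200 \<le> q ^ 5" using pow[of 5] by simp
    ultimately have "200 * (n + 1) ^ 3 \<le> q ^ 5 * (q ^ n) ^ 3" by (intro mult_mono) simp_all
    also have "\<dots> = q ^ (5 + n * 3)" by (simp add: power_add power_mult)
    also have "\<dots> < M" by (rule less) simp
    finally show "200 * (n + 1) ^ 3 < M" .
  qed
  have closed: "h m \<in> carrier R" if "h \<in> cubic_forms R n" for h m
    using that mpoly_closed_cring[OF cring_R] by (auto simp: cubic_forms_def)
  have correct: "halts_within iso_program (enc_input R q n f g) (M ^ 24)"
    "accepts iso_program (enc_input R q n f g) \<longleftrightarrow>
      iso_test (cubic_coeffs n (\<lambda>m. emb R (f m))) (cubic_coeffs n (\<lambda>m. emb R (g m)))"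
    if "f \<in> cubic_forms R n" "g \<in> cubic_forms R n" for f g
    using iso_program_correct[of f g] closed that less[of "169 * n"] less[of "n * 40"] by simp_all
  \<comment> \<open>Here \<open>4800 = 24 * 200\<close>.\<close>
  have time: "M ^ 24 = q ^ (4800 * (n + 1))" unfolding M_def by (simp flip: power_mult)
  show "\<forall>f\<in>cubic_forms R n. \<forall>g\<in>cubic_forms R n.
      halts_within iso_program (enc_input R q n f g) (q ^ (4800 * (n + 1)))"
    unfolding time[symmetric] using correct(1) by simp
  let ?bad = "{f \<in> cubic_forms R n. \<exists>g\<in>cubic_forms R n.
      \<not> (accepts iso_program (enc_input R q n f g) \<longleftrightarrow> isomorphic_forms R n f g)}"
  show "real (card ?bad) / real (card (cubic_forms R n)) \<le> 1 / real q ^ (if 80 \<le> n then n else 0)"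
  proof (cases "80 \<le> n")
    case True
    have "?bad = {f \<in> cubic_forms R n. \<exists>g\<in>cubic_forms R n.
      \<not> (iso_test (cubic_coeffs n (\<lambda>m. emb R (f m))) (cubic_coeffs n (\<lambda>m. emb R (g m))) \<longleftrightarrow>
          isomorphic_forms R n f g)}"
      using correct(2) by auto
    then have "card ?bad * q ^ n \<le> card (cubic_forms R n)"
      using card_bad_forms[OF odd True] by simp
    then have "real (card ?bad * q ^ n) \<le> real (card (cubic_forms R n))" by (rule of_nat_mono)
    then have "real (card ?bad) * real q ^ n \<le> real (card (cubic_forms R n))" by simp
    then show ?thesis using True q by (cases "card (cubic_forms R n) = 0") (auto simp: field_simps)
  next
    case False
    have "card ?bad \<le> card (cubic_forms R n)" using finite_cubic_forms[OF odd] by (intro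
        card_mono) auto
    then show ?thesis using False by (cases "card (cubic_forms R n) = 0") (auto simp: field_simps)
  qed
qed

end
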